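(* Let $(W,S)$ be an infinite, irreducible Coxeter system, with positive system $\Phi^+$. Then $(W,S)$ is non-affine if and only if, for any reflection order $\prec$ on $\Phi^+$ and any positive integer $k$, there exists a subset $E\subset\Phi^+$ such that the restriction of $\prec$ to $E$ has the order type $(\omega+\omega^* )[k]$.
   Context: Root system. Let $(W,S)$ be a Coxeter system ($S$ an arbitrary set) with Coxeter matrix $m$. Let $V$ be a real vector space with a symmetric bilinear form $B$, and let $\Pi=\{\alpha_s\mid s\in S\}\subset V$ be a root basis: the $\alpha_s$ are in bijection with $S$; $B(\alpha_s,\alpha_{s'})=-\cos(\pi/m(s,s'))$ if $m(s,s')<\infty$ (so $B(\alpha_s,\alpha_s)=1$); $B(\alpha_s,\alpha_{s'})\le -1$ if $m(s,s')=\infty$; and $\Pi$ is positively independent (a finite sum $\sum k_s\alpha_s=0$ with all $k_s\ge 0$ forces all $k_s=0$). For instance, in the standard reflection representation $\Pi$ is a basis of $V$ and $B(\alpha_s,\alpha_{s'})=-\cos(\pi/m(s,s'))$, read as $-1$ if $m(s,s')=\infty$; this $B$ is the standard bilinear form. $W$ acts on $V$ by $s(v)=v-2B(v,\alpha_s)\alpha_s$ for $s\in S$. The root system is $\Phi=W\Pi$, and $\Phi^+$ is the set of roots that are nonnegative linear combinations of $\Pi$; then $\Phi=\Phi^+\sqcup -\Phi^+$. Reflection order. A total order $\prec$ on $\Phi^+$ is a reflection order if for all $\alpha,\beta\in\Phi^+$ with $\alpha\prec\beta$ and all $\gamma=a\alpha+b\beta\in\Phi^+$ with real $a,b>0$,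 one has $\alpha\prec\gamma\prec\beta$. Order types. $\omega$ is the order type of $\mathbb{N}$ with its usual order, $\omega^*$ the order type of the reversed order on $\mathbb{N}$, and $\omega+\omega^*$ the order type of a copy of $\omega$ followed by a copy of $\omega^*$. $[k]$ is the order type of a $k$-element totally ordered set, and $(\omega+\omega^* )[k]$ is the ordered sum of $k$ consecutive copies of $\omega+\omega^*$. Affine and non-affine. An infinite irreducible Coxeter system $(W,S)$ is affine (that is, $W$ is an affine Weyl group) if $S$ is finite and the standard bilinear form is positive semidefinite but not positive definite (this includes the infinite dihedral group); otherwise it is non-affine.
   Formalization: Added assumption: some finite subset of S generates an infinite subgroup of W (automatic for finite S). Without it the claim is false, e.g. for W of type A_∞ with roots e_i − e_j (i<j) ordered lexicographically: a well-ordered reflection order, so it contains no ω+ω*. *)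

theory Defs
  imports
    "HOL-Analysis.Linear_Algebra"
    "HOL-Algebra.Generated_Groups"
    "HOL-Algebra.Group_Action"
    "HOL-Library.Extended_Nat"
begin

section \<open>Coxeter systems\<close>

text \<open>The congruence on words in \<open>S\<close> generated by the relations
  \<open>(s t) ^ (m s t) = 1\<close> for finite \<open>m s t\<close>. As \<open>m s s = 1\<close> makes every
  letter its own inverse, the monoid of words modulo this congruence is the group with generators
  \<open>S\<close> and these relations; no formal inverses are needed.\<close>

inductive coxeter_equiv :: "'g set \<Rightarrow> ('g \<Rightarrow> 'g \<Rightarrow> enat) \<Rightarrow> 'g list \<Rightarrow> 'g list \<Rightarrow> bool"
  for S :: "'g set" and m :: "'g \<Rightarrow> 'g \<Rightarrow> enat" where
  relator: "\<lbrakk>s \<in> S; t \<in> S; m s t = enat n\<rbrakk>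
     \<Longrightarrow> coxeter_equiv S m (concat (replicate n [s, t])) []"
| refl: "us \<in> lists S \<Longrightarrow> coxeter_equiv S m us us"
| sym: "coxeter_equiv S m us vs \<Longrightarrow> coxeter_equiv S m vs us"
| trans: "\<lbrakk>coxeter_equiv S m us vs; coxeter_equiv S m vs ws\<rbrakk> \<Longrightarrow> coxeter_equiv S m us ws"
| append: "\<lbrakk>coxeter_equiv S m us us'; coxeter_equiv S m vs vs'\<rbrakk>
     \<Longrightarrow> coxeter_equiv S m (us @ vs) (us' @ vs')"

text \<open>The last assumption together with \<open>generates\<close> says that \<open>W\<close> is presented by the relations
  above. \<open>S\<close> may be infinite.\<close>

locale coxeter_system = group W
  for W :: "('g, 'b) monoid_scheme" (structure) +
  fixes S :: "'g set" and m :: "'g \<Rightarrow> 'g \<Rightarrow> enat"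
  assumes S_subset: "S \<subseteq> carrier W"
    and generates: "generate W S = carrier W"
    and m_diag: "s \<in> S \<Longrightarrow> m s s = 1"
    and m_sym: "\<lbrakk>s \<in> S; t \<in> S\<rbrakk> \<Longrightarrow> m s t = m t s"
    and m_ge_2: "\<lbrakk>s \<in> S; t \<in> S; s \<noteq> t\<rbrakk> \<Longrightarrow> 2 \<le> m s t"
    and presentation: "\<lbrakk>us \<in> lists S; vs \<in> lists S\<rbrakk> \<Longrightarrow>
      foldr (\<otimes>) us \<one> = foldr (\<otimes>) vs \<one> \<longleftrightarrow> coxeter_equiv S m us vs"

text \<open>The Coxeter graph joins \<open>s \<noteq> t\<close> iff \<open>m s t \<noteq> 2\<close>; irreducibility is its connectedness.\<close>

definition irreducible_coxeter :: "'g set \<Rightarrow> ('g \<Rightarrow> 'g \<Rightarrow> enat) \<Rightarrow> bool" where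
  "irreducible_coxeter S m \<longleftrightarrow> S \<noteq> {} \<and>
     \<not> (\<exists>J. J \<subset> S \<and> J \<noteq> {} \<and> (\<forall>s\<in>J. \<forall>t\<in>S - J. m s t = 2))"

definition standard_entry :: "enat \<Rightarrow> real" where
  "standard_entry k = (case k of enat n \<Rightarrow> - cos (pi / real n) | \<infinity> \<Rightarrow> - 1)"

text \<open>The real vector space with basis \<open>S\<close>, as finitely supported functions, and its standard
  bilinear form.\<close>

definition standard_space :: "'g set \<Rightarrow> ('g \<Rightarrow> real) set" where
  "standard_space S = {x. finite {s. x s \<noteq> 0} \<and> {s. x s \<noteq> 0} \<subseteq> S}"

definition standard_form ::
    "('g \<Rightarrow> 'g \<Rightarrow> enat) \<Rightarrow> ('g \<Rightarrow> real) \<Rightarrow> ('g \<Rightarrow> real) \<Rightarrow> real" where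
  "standard_form m x y =
     (\<Sum>s | x s \<noteq> 0. \<Sum>t | y t \<noteq> 0. x s * y t * standard_entry (m s t))"

text \<open>Meant for infinite irreducible systems only.\<close>

definition affine_coxeter :: "'g set \<Rightarrow> ('g \<Rightarrow> 'g \<Rightarrow> enat) \<Rightarrow> bool" where
  "affine_coxeter S m \<longleftrightarrow> finite S \<and>
     (\<forall>x\<in>standard_space S. 0 \<le> standard_form m x x) \<and>
     \<not> (\<forall>x\<in>standard_space S. x \<noteq> (\<lambda>_. 0) \<longrightarrow> 0 < standard_form m x x)"

section \<open>Root systems\<close>

text \<open>\<open>B\<close> is the form on \<open>V\<close> (the whole type \<open>'v\<close>), \<open>\<alpha> ` S\<close> the root basis and \<open>\<rho>\<close> the action of
  \<open>W\<close> on \<open>V\<close>. Since \<open>S\<close> generates \<open>W\<close>, \<open>\<rho>\<close> is determined by its values on \<open>S\<close>.\<close>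

locale root_basis = coxeter_system W S m
  for W :: "('g, 'b) monoid_scheme" (structure)
    and S :: "'g set" and m :: "'g \<Rightarrow> 'g \<Rightarrow> enat" +
  fixes B :: "'v::real_vector \<Rightarrow> 'v \<Rightarrow> real"
    and \<alpha> :: "'g \<Rightarrow> 'v"
    and \<rho> :: "'g \<Rightarrow> 'v \<Rightarrow> 'v"
  assumes B_bilinear: "bilinear B"
    and B_sym: "B x y = B y x"
    and \<alpha>_inj: "inj_on \<alpha> S"
    and B_finite: "\<lbrakk>s \<in> S; t \<in> S; m s t = enat n\<rbrakk> \<Longrightarrow> B (\<alpha> s) (\<alpha> t) = - cos (pi / real n)"
    and B_infinite: "\<lbrakk>s \<in> S; t \<in> S; m s t = \<infinity>\<rbrakk> \<Longrightarrow> B (\<alpha> s) (\<alpha> t) \<le> - 1"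
    and positively_independent:
      "\<lbrakk>finite F; F \<subseteq> S; \<And>s. s \<in> F \<Longrightarrow> 0 \<le> k s; (\<Sum>s\<in>F. k s *\<^sub>R \<alpha> s) = 0; s \<in> F\<rbrakk> \<Longrightarrow> k s = 0"
    and action: "group_action W (UNIV :: 'v set) \<rho>"
    and action_simple: "s \<in> S \<Longrightarrow> \<rho> s v = v - (2 * B v (\<alpha> s)) *\<^sub>R \<alpha> s"

definition roots ::
    "('g, 'b) monoid_scheme \<Rightarrow> 'g set \<Rightarrow> ('g \<Rightarrow> 'v) \<Rightarrow> ('g \<Rightarrow> 'v \<Rightarrow> 'v) \<Rightarrow> 'v set" where
  "roots W S \<alpha> \<rho> = (\<Union>s\<in>S. orbit W \<rho> (\<alpha> s))"

definition pos_roots ::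
    "('g, 'b) monoid_scheme \<Rightarrow> 'g set \<Rightarrow> ('g \<Rightarrow> 'v::real_vector) \<Rightarrow> ('g \<Rightarrow> 'v \<Rightarrow> 'v) \<Rightarrow> 'v set"
  where
  "pos_roots W S \<alpha> \<rho> = {\<beta> \<in> roots W S \<alpha> \<rho>.
     \<exists>F k. finite F \<and> F \<subseteq> S \<and> (\<forall>s\<in>F. (0::real) \<le> k s) \<and> \<beta> = (\<Sum>s\<in>F. k s *\<^sub>R \<alpha> s)}"

section \<open>Reflection orders and order types\<close>

definition reflection_order :: "'v::real_vector set \<Rightarrow> ('v \<Rightarrow> 'v \<Rightarrow> bool) \<Rightarrow> bool" where
  "reflection_order P lt \<longleftrightarrow>
     irreflp_on P lt \<and> transp_on P lt \<and> totalp_on P lt \<and>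
     (\<forall>\<alpha>\<in>P. \<forall>\<beta>\<in>P. \<forall>a b :: real.
        lt \<alpha> \<beta> \<and> 0 < a \<and> 0 < b \<and> a *\<^sub>R \<alpha> + b *\<^sub>R \<beta> \<in> P \<longrightarrow>
        lt \<alpha> (a *\<^sub>R \<alpha> + b *\<^sub>R \<beta>) \<and> lt (a *\<^sub>R \<alpha> + b *\<^sub>R \<beta>) \<beta>)"

definition order_isomorphic ::
    "'a set \<Rightarrow> ('a \<Rightarrow> 'a \<Rightarrow> bool) \<Rightarrow> 'c set \<Rightarrow> ('c \<Rightarrow> 'c \<Rightarrow> bool) \<Rightarrow> bool" where
  "order_isomorphic A r A' r' \<longleftrightarrow>
     (\<exists>f. bij_betw f A A' \<and> (\<forall>x\<in>A. \<forall>y\<in>A. r x y \<longleftrightarrow> r' (f x) (f y)))"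

text \<open>The strict order of type \<open>\<omega> + \<omega>\<^sup>*\<close> on \<open>nat + nat\<close>: the left summand carries the usual
  order, the right one the reversed order.\<close>

fun omega_omega_star_less :: "nat + nat \<Rightarrow> nat + nat \<Rightarrow> bool" where
  "omega_omega_star_less (Inl i) (Inl j) \<longleftrightarrow> i < j"
| "omega_omega_star_less (Inl i) (Inr j) \<longleftrightarrow> True"
| "omega_omega_star_less (Inr i) (Inl j) \<longleftrightarrow> False"
| "omega_omega_star_less (Inr i) (Inr j) \<longleftrightarrow> j < i"

text \<open>\<open>(\<omega> + \<omega>\<^sup>*)[k]\<close> lives on \<open>{..<k} \<times> UNIV\<close>; the first component is the index of the copy.\<close>

definition copies_less :: "nat \<times> (nat + nat) \<Rightarrow> nat \<times> (nat + nat) \<Rightarrow> bool" where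
  "copies_less p q \<longleftrightarrow>
     fst p < fst q \<or> (fst p = fst q \<and> omega_omega_star_less (snd p) (snd q))"

definition has_type_omega_omega_star_copies ::
    "nat \<Rightarrow> 'a set \<Rightarrow> ('a \<Rightarrow> 'a \<Rightarrow> bool) \<Rightarrow> bool" where
  "has_type_omega_omega_star_copies k E lt \<longleftrightarrow>
     order_isomorphic ({..<k} \<times> (UNIV :: (nat + nat) set)) copies_less E lt"

end

theory Submission
  imports
    Defs
    "HOL-Analysis.Elementary_Metric_Spaces"
    "HOL-Analysis.Continuum_Not_Denumerable"
begin

text \<open>
  \<^bold>\<open>Non-affine systems.\<close> Let \<open>x\<close> and \<open>y\<close> be positive roots with \<open>B x y \<le> - 1\<close>. The reflections
  in them generate an infinite dihedral group, and it has infinitely many roots \<open>p x + q y\<close>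
  with \<open>p, q \<ge> 0\<close>. The axiom of a reflection order leaves only one way to arrange them: from
  the smaller of \<open>x, y\<close> to the larger one, in order of the ratio \<open>p : q\<close>. These ratios form a
  chain of type \<open>\<omega> + \<omega>\<^sup>*\<close> (\<open>dihedral_chains\<close>). So \<open>k + 1\<close> positive roots with pairwise
  products at most \<open>- 1\<close>, listed increasingly, yield \<open>k\<close> consecutive chains, one between each
  root and the next (\<open>copies_of_universal_families\<close>). Such a family \<open>X\<close> with at least three
  members can be enlarged: pick \<open>c \<in> X\<close> and take \<open>X - {c}\<close> together with its mirror image
  under the reflection in \<open>c\<close> (\<open>universal_family_doubling\<close>). Hence three roots suffice.

  Three roots are found by Lorentzian geometry. A non-affine system contains a connected
  finite set \<open>J\<close> of at least three generators on whose span \<open>B\<close> takes negative values, and if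
  the vertices of \<open>J\<close> are added one at a time, one may stop as soon as this happens; then,
  unless \<open>J\<close> already consists of three generators with pairwise products at most \<open>- 1\<close>, some
  vertex can be removed so that \<open>B\<close> becomes positive semidefinite. So \<open>B\<close> is Lorentzian on the
  span of \<open>J\<close>, modulo its radical. The product with the Perron-Frobenius eigenvector of the
  Gram matrix is a height function that is unbounded on the positive roots of \<open>J\<close>. Roots of
  height tending to infinity, divided by their height, accumulate at an isotropic vector \<open>\<eta>\<close>.
  Two isotropic vectors of positive height have negative product unless they are proportional
  modulo the radical, and the orbit of \<open>\<eta>\<close> contains three pairwise non-proportional rays,
  because otherwise all simple roots of \<open>J\<close> would lie in one plane modulo the radical, where
  three unit vectors with nonpositive products do not fit. Roots of great height close to
  these three rays have products below \<open>- 1\<close> (\<open>three_universal_roots\<close>).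

  \<^bold>\<open>Affine systems.\<close> Order the positive roots by the slope \<open>f / g\<close>, where \<open>g\<close> is the sum of
  the simple coordinates and \<open>f\<close> is a linear functional chosen so that no two roots have the
  same slope. This is a reflection order, since the slope of a positive combination lies
  strictly between the slopes of its terms. Only finitely many positive roots have bounded
  \<open>g\<close>, so the slopes of an infinite sequence of distinct roots can only accumulate at values
  of \<open>f\<close> on nonnegative isotropic vectors with \<open>g = 1\<close>. In the affine case there are only
  finitely many such vectors, whereas \<open>k\<close> copies of \<open>\<omega> + \<omega>\<^sup>*\<close> have \<open>k\<close> different accumulation
  points (\<open>copies_bounded_by_limit_points\<close>).

  \<^bold>\<open>Common ground.\<close> Both halves rest on the theorem of Tits that every root is positive or
  negative and that only the neutral element preserves positivity (\<open>sign_coherence\<close>,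
  \<open>trivial_if_preserves_positivity\<close>). It is proved here simultaneously for all subgroups
  generated by sets \<open>K \<subseteq> S\<close>, by measuring lengths in the letters of \<open>K\<close>. It implies that
  bounded sets of positive roots are finite if the simple roots are independent, and that \<open>K\<close>
  generates a finite group if \<open>B\<close> is positive definite on it.
\<close>

section \<open>Symmetric matrices with nonpositive off-diagonal entries\<close>

text \<open>
  The index type may be uncountable, so that the function space is not first countable;
  extracting subsequences coordinate by coordinate avoids the product topology.\<close>

lemma bounded_coords_convergent_subseq:
  fixes f :: "nat \<Rightarrow> 'a \<Rightarrow> real"
  assumes "finite K" and "\<And>n s. s \<in> K \<Longrightarrow> \<bar>f n s\<bar> \<le> M"
  shows "\<exists>l r. strict_mono r \<and> (\<forall>s\<in>K. (\<lambda>n. f (r n) s) \<longlonglongrightarrow> l s)"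
  using assms
proof (induction K rule: finite_induct)
  case empty
  show ?case by (rule exI, rule exI[of _ id]) (simp add: strict_mono_def)
next
  case (insert a K)
  then obtain l r where r: "strict_mono r" "\<forall>s\<in>K. (\<lambda>n. f (r n) s) \<longlonglongrightarrow> l s"
    by (metis insertCI)
  have "seq_compact {-M..M}" by (simp add: compact_imp_seq_compact)
  moreover have "\<forall>n. f (r n) a \<in> {-M..M}"
    using insert.prems[of a] by (metis abs_le_D1 abs_le_D2 atLeastAtMost_iff insertI1 minus_le_iff)
  ultimately obtain c r' where r': "strict_mono r'" "((\<lambda>n. f (r n) a) \<circ> r') \<longlonglongrightarrow> c"
    by (metis (no_types, lifting) seq_compactE)
  have "(\<lambda>n. f ((r \<circ> r') n) s) \<longlonglongrightarrow> (l(a := c)) s" if "s \<in> insert a K" for s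
  proof (cases "s = a")
    case True
    then show ?thesis using r'(2) by (simp add: o_def)
  next
    case False
    with that have "(\<lambda>n. f (r n) s) \<longlonglongrightarrow> l s" using r(2) by auto
    from LIMSEQ_subseq_LIMSEQ[OF this r'(1)] show ?thesis using False by (simp add: o_def)
  qed
  moreover have "strict_mono (r \<circ> r')" using r(1) r'(1) by (rule strict_mono_o)
  ultimately show ?case by blast
qed

text \<open>
  For small \<open>e\<close> of the sign opposite to \<open>b\<close> the linear term would win.\<close>

lemma linear_coeff_zero_of_quadratic_nonneg:
  fixes b c :: real
  assumes "\<And>e. 0 \<le> 2 * e * b + e^2 * c"
  shows "b = 0"
proof (rule ccontr)
  assume b: "b \<noteq> 0"
  define C where "C = \<bar>c\<bar> + 1"
  have C: "C > 0" "c < C" by (auto simp: C_def)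
  have "0 \<le> 2 * (-b/C) * b + (-b/C)^2 * c" by (rule assms)
  also have "\<dots> = (b^2 / C^2) * (c - 2 * C)"
    using C by (simp add: field_simps power2_eq_square)
  also have "\<dots> < 0" using b C by (intro mult_pos_neg) auto
  finally show False by simp
qed

definition matrix_form :: "'a set \<Rightarrow> ('a \<Rightarrow> 'a \<Rightarrow> real) \<Rightarrow> ('a \<Rightarrow> real) \<Rightarrow> ('a \<Rightarrow> real) \<Rightarrow> real" where
  "matrix_form K A x y = (\<Sum>s\<in>K. \<Sum>t\<in>K. x s * y t * A s t)"

lemma matrix_form_expand:
  "matrix_form K A (\<lambda>s. x s + e * y s) (\<lambda>s. x s + e * y s) =
    matrix_form K A x x + e * (matrix_form K A x y + matrix_form K A y x) + e^2 * matrix_form K A y y"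
  unfolding matrix_form_def power2_eq_square
  by (simp add: algebra_simps sum.distrib sum_distrib_left)

lemma matrix_form_sym:
  assumes "\<And>s t. s \<in> K \<Longrightarrow> t \<in> K \<Longrightarrow> A s t = A t s"
  shows "matrix_form K A x y = matrix_form K A y x"
  unfolding matrix_form_def
  by (subst sum.swap) (intro sum.cong HOL.refl, use assms in auto)

lemma matrix_form_scale: "matrix_form K A (\<lambda>s. c * x s) (\<lambda>s. d * y s) = c * d * matrix_form K A x y"
  unfolding matrix_form_def by (simp add: sum_distrib_left mult_ac)

lemma matrix_form_indicator_left:
  assumes "finite K" "s \<in> K"
  shows "matrix_form K A (\<lambda>u. if u = s then 1 else 0) x = (\<Sum>t\<in>K. A s t * x t)"
proof -
  have "matrix_form K A (\<lambda>u. if u = s then 1 else 0) x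
      = (\<Sum>u\<in>K. if u = s then (\<Sum>t\<in>K. A s t * x t) else 0)"
    unfolding matrix_form_def by (intro sum.cong HOL.refl) (auto simp: mult.commute)
  then show ?thesis using assms by simp
qed

lemma matrix_form_eigenvector:
  assumes "\<And>s. s \<in> K \<Longrightarrow> (\<Sum>t\<in>K. A s t * x t) = \<mu> * x s"
  shows "matrix_form K A x x = \<mu> * (\<Sum>s\<in>K. (x s)^2)"
proof -
  have "matrix_form K A x x = (\<Sum>s\<in>K. x s * (\<Sum>t\<in>K. A s t * x t))"
    unfolding matrix_form_def by (simp add: sum_distrib_left mult_ac)
  also have "\<dots> = (\<Sum>s\<in>K. \<mu> * (x s)^2)"
    by (intro sum.cong HOL.refl) (simp add: assms power2_eq_square)
  finally show ?thesis by (simp add: sum_distrib_left)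
qed

text \<open>
  An isotropic vector minimizes a positive semidefinite form, so the derivative in each
  coordinate direction vanishes there.\<close>

lemma psd_isotropic_kernel:
  assumes K: "finite K" and sym: "\<And>s t. s \<in> K \<Longrightarrow> t \<in> K \<Longrightarrow> A s t = A t s"
    and psd: "\<And>y. 0 \<le> matrix_form K A y y" and iso: "matrix_form K A x x = 0" and s: "s \<in> K"
  shows "(\<Sum>t\<in>K. A s t * x t) = 0"
proof -
  let ?i = "\<lambda>u. if u = s then 1 else (0::real)"
  have "0 \<le> 2 * e * matrix_form K A ?i x + e^2 * matrix_form K A ?i ?i" for e
    using psd[of "\<lambda>u. x u + e * ?i u"] iso matrix_form_sym[where K = K and A = A and x = x and y = ?i, OF sym]
    unfolding matrix_form_expand by simp
  from linear_coeff_zero_of_quadratic_nonneg[OF this]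
  show ?thesis using matrix_form_indicator_left[OF K s] by metis
qed

text \<open>
  Absolute values leave the diagonal terms alone and can only decrease the off-diagonal ones.
  So minimizers of the form may be taken nonnegative.\<close>

lemma matrix_form_abs_le:
  assumes "\<And>s t. s \<in> K \<Longrightarrow> t \<in> K \<Longrightarrow> s \<noteq> t \<Longrightarrow> A s t \<le> 0"
  shows "matrix_form K A (\<lambda>s. \<bar>x s\<bar>) (\<lambda>s. \<bar>x s\<bar>) \<le> matrix_form K A x x"
  unfolding matrix_form_def
proof (intro sum_mono)
  fix s t assume st: "s \<in> K" "t \<in> K"
  show "\<bar>x s\<bar> * \<bar>x t\<bar> * A s t \<le> x s * x t * A s t"
  proof (cases "s = t")
    case False
    have "x s * x t \<le> \<bar>x s\<bar> * \<bar>x t\<bar>" by (metis abs_ge_self abs_mult)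
    then show ?thesis using assms[OF st False] by (rule mult_right_mono_neg)
  qed (simp add: abs_mult_self_eq)
qed

text \<open>
  On the zero set \<open>J\<close> of \<open>x\<close> the eigenvalue equation is a vanishing sum of nonpositive terms,
  so every entry that joins \<open>J\<close> to the support of \<open>x\<close> is zero. Connectedness then makes \<open>J\<close>
  empty.\<close>

lemma nonneg_eigenvector_pos:
  fixes A :: "'a \<Rightarrow> 'a \<Rightarrow> real" and x :: "'a \<Rightarrow> real"
  assumes K: "finite K" and off: "\<And>s t. s \<in> K \<Longrightarrow> t \<in> K \<Longrightarrow> s \<noteq> t \<Longrightarrow> A s t \<le> 0"
    and conn: "\<And>J. J \<subset> K \<Longrightarrow> J \<noteq> {} \<Longrightarrow> \<exists>s\<in>J. \<exists>t\<in>K - J. A s t \<noteq> 0"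
    and x0: "\<And>s. s \<in> K \<Longrightarrow> 0 \<le> x s" and nz: "\<exists>s\<in>K. x s \<noteq> 0"
    and eig: "\<And>s. s \<in> K \<Longrightarrow> (\<Sum>t\<in>K. A s t * x t) = \<mu> * x s"
    and s: "s \<in> K"
  shows "0 < x s"
proof (rule ccontr)
  define J where "J = {s\<in>K. x s = 0}"
  assume "\<not> 0 < x s"
  with x0[OF s] have "x s = 0" by simp
  with s have "J \<noteq> {}" unfolding J_def by auto
  moreover have "J \<subset> K" using nz by (auto simp: J_def)
  ultimately obtain s t where st: "s \<in> J" "t \<in> K - J" "A s t \<noteq> 0" using conn by blast
  have nonpos: "A s u * x u \<le> 0" if "u \<in> K" for u
  proof (cases "u = s")
    case False
    with st that have "A s u \<le> 0" by (intro off) (auto simp: J_def)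
    then show ?thesis using x0[OF that] by (rule mult_nonpos_nonneg)
  qed (use st in \<open>simp add: J_def\<close>)
  have "(\<Sum>u\<in>K. A s u * x u) = 0" using eig[of s] st by (simp add: J_def)
  then have "(\<Sum>u\<in>K. - (A s u * x u)) = 0" unfolding sum_negf by simp
  then have "\<forall>u\<in>K. - (A s u * x u) = 0"
    by (subst (asm) sum_nonneg_eq_0_iff) (use nonpos K in auto)
  then have "A s t * x t = 0" using st by (metis DiffD1 neg_equal_0_iff_equal)
  with st show False by (auto simp: J_def)
qed

text \<open>
  The least eigenvalue \<open>\<mu>\<close> is the minimum of the form on the unit sphere. The absolute value
  of a minimizer is again a minimizer, hence isotropic for the semidefinite matrix \<open>A - \<mu>\<close>,
  hence an eigenvector. The sign of \<open>\<mu>\<close> tells whether the form is positive definite, only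
  semidefinite, or indefinite.\<close>

lemma perron_frobenius:
  assumes K: "finite K" "K \<noteq> {}" and sym: "\<And>s t. s \<in> K \<Longrightarrow> t \<in> K \<Longrightarrow> A s t = A t s"
    and off: "\<And>s t. s \<in> K \<Longrightarrow> t \<in> K \<Longrightarrow> s \<noteq> t \<Longrightarrow> A s t \<le> 0"
    and conn: "\<And>J. J \<subset> K \<Longrightarrow> J \<noteq> {} \<Longrightarrow> \<exists>s\<in>J. \<exists>t\<in>K - J. A s t \<noteq> 0"
  obtains \<mu> x where "\<And>s. s \<in> K \<Longrightarrow> 0 < x s"
    and "\<And>s. s \<in> K \<Longrightarrow> (\<Sum>t\<in>K. A s t * x t) = \<mu> * x s"
    and "\<And>y. \<mu> * (\<Sum>s\<in>K. (y s)^2) \<le> matrix_form K A y y"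
proof -
  define sph where "sph = {y :: 'a \<Rightarrow> real. (\<Sum>s\<in>K. (y s)^2) = 1}"
  define Q where "Q y = matrix_form K A y y" for y
  define \<mu> where "\<mu> = Inf (Q ` sph)"
  have coord: "\<bar>y s\<bar> \<le> 1" if "y \<in> sph" "s \<in> K" for y s
  proof -
    have "(y s)^2 \<le> (\<Sum>s\<in>K. (y s)^2)" using K that by (intro member_le_sum) auto
    with that show ?thesis by (simp add: sph_def abs_square_le_1)
  qed
  have bdd: "bdd_below (Q ` sph)"
  proof (rule bdd_belowI2)
    fix y assume y: "y \<in> sph"
    have "- \<bar>A s t\<bar> \<le> y s * y t * A s t" if "s \<in> K" "t \<in> K" for s t
    proof -
      have "\<bar>y s * y t * A s t\<bar> \<le> 1 * 1 * \<bar>A s t\<bar>"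
        unfolding abs_mult using y that by (intro mult_mono coord) auto
      then show ?thesis by linarith
    qed
    then show "(\<Sum>s\<in>K. \<Sum>t\<in>K. - \<bar>A s t\<bar>) \<le> Q y"
      unfolding Q_def matrix_form_def by (intro sum_mono) auto
  qed
  obtain s0 where s0: "s0 \<in> K" using K by blast
  have "(\<lambda>s. if s = s0 then 1 else 0) \<in> sph"
  proof -
    have "(\<Sum>s\<in>K. (if s = s0 then 1 else 0 :: real)^2) = (\<Sum>s\<in>K. if s = s0 then 1 else 0)"
      by (intro sum.cong) auto
    also have "\<dots> = 1" using K s0 by simp
    finally show ?thesis by (simp add: sph_def)
  qed
  then have ne: "sph \<noteq> {}" by blast
  have "\<exists>y\<in>sph. Q y < \<mu> + inverse (real (Suc n))" for n
    using cInf_lessD[of "Q ` sph" "\<mu> + inverse (real (Suc n))"] ne unfolding \<mu>_def by auto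
  then obtain f where f: "\<And>n. f n \<in> sph" "\<And>n. Q (f n) < \<mu> + inverse (real (Suc n))"
    by metis
  obtain l r where r: "strict_mono r" and l: "\<And>s. s \<in> K \<Longrightarrow> (\<lambda>n. f (r n) s) \<longlonglongrightarrow> l s"
    using bounded_coords_convergent_subseq[OF K(1), of f 1] coord f(1) by blast
  have Qlim: "(\<lambda>n. Q (f (r n))) \<longlonglongrightarrow> Q l"
    unfolding Q_def matrix_form_def by (intro tendsto_intros l)
  have "(\<lambda>n. \<mu> + inverse (real (Suc (r n)))) \<longlonglongrightarrow> \<mu> + 0"
    using LIMSEQ_subseq_LIMSEQ[OF LIMSEQ_inverse_real_of_nat r]
    by (intro tendsto_intros) (simp add: o_def)
  then have Ql: "Q l \<le> \<mu> + 0"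
    by (rule LIMSEQ_le[OF Qlim]) (use f(2) less_imp_le in blast)
  have "(\<lambda>n. \<Sum>s\<in>K. (f (r n) s)^2) \<longlonglongrightarrow> (\<Sum>s\<in>K. (l s)^2)" by (intro tendsto_intros l)
  moreover have "(\<lambda>n. \<Sum>s\<in>K. (f (r n) s)^2) = (\<lambda>n. 1)" using f(1) by (simp add: sph_def)
  ultimately have l1: "l \<in> sph" unfolding sph_def by (simp add: LIMSEQ_const_iff)
  have lower: "\<mu> * (\<Sum>s\<in>K. (y s)^2) \<le> Q y" for y
  proof (cases "(\<Sum>s\<in>K. (y s)^2) = 0")
    case True
    then have "\<And>s. s \<in> K \<Longrightarrow> y s = 0" using K by (simp add: sum_nonneg_eq_0_iff)
    then show ?thesis using True by (simp add: Q_def matrix_form_def)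
  next
    case False
    define N where "N = (\<Sum>s\<in>K. (y s)^2)"
    have N: "N > 0" using False by (simp add: N_def sum_nonneg order_less_le)
    define c where "c = inverse (sqrt N)"
    have c: "c^2 * N = 1" using N by (simp add: c_def power_inverse)
    have "(\<lambda>s. c * y s) \<in> sph"
      using c by (simp add: sph_def power_mult_distrib sum_distrib_left[symmetric] N_def)
    then have "\<mu> \<le> Q (\<lambda>s. c * y s)" unfolding \<mu>_def by (intro cInf_lower bdd) auto
    also have "\<dots> = c^2 * Q y" unfolding Q_def by (simp add: matrix_form_scale power2_eq_square)
    finally have "\<mu> * N \<le> c^2 * Q y * N" using N by (simp add: mult_right_mono)
    also have "\<dots> = (c^2 * N) * Q y" by simp
    finally show ?thesis unfolding c unfolding N_def by simp
  qed
  define x where "x s = \<bar>l s\<bar>" for s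
  have x1: "(\<Sum>s\<in>K. (x s)^2) = 1" using l1 by (simp add: x_def sph_def)
  have "Q x \<le> Q l" unfolding Q_def x_def by (rule matrix_form_abs_le) (rule off)
  with Ql lower[of x] x1 have Qx: "Q x = \<mu>" by simp
  define M where "M s t = A s t - (if s = t then \<mu> else 0)" for s t
  have M: "matrix_form K M y y = Q y - \<mu> * (\<Sum>s\<in>K. (y s)^2)" for y
  proof -
    have "matrix_form K M y y = (\<Sum>s\<in>K. (\<Sum>t\<in>K. y s * y t * A s t) - (\<Sum>t\<in>K. if s = t then \<mu> * (y s)^2 else 0))"
      unfolding matrix_form_def M_def sum_subtractf[symmetric]
      by (intro sum.cong HOL.refl) (auto simp: algebra_simps power2_eq_square)
    also have "\<dots> = (\<Sum>s\<in>K. (\<Sum>t\<in>K. y s * y t * A s t) - \<mu> * (y s)^2)"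
    proof (rule sum.cong[OF HOL.refl])
      fix s assume "s \<in> K"
      then have "(\<Sum>t\<in>K. if s = t then \<mu> * (y s)^2 else 0) = \<mu> * (y s)^2" using K by simp
      then show "(\<Sum>t\<in>K. y s * y t * A s t) - (\<Sum>t\<in>K. if s = t then \<mu> * (y s)^2 else 0)
          = (\<Sum>t\<in>K. y s * y t * A s t) - \<mu> * (y s)^2" by simp
    qed
    finally show ?thesis by (simp add: sum_subtractf Q_def matrix_form_def sum_distrib_left)
  qed
  have eig: "(\<Sum>t\<in>K. A s t * x t) = \<mu> * x s" if s: "s \<in> K" for s
  proof -
    have "(\<Sum>t\<in>K. M s t * x t) = 0"
    proof (rule psd_isotropic_kernel[OF K(1) _ _ _ s])
      show "M s t = M t s" if "s \<in> K" "t \<in> K" for s t using sym[OF that] by (simp add: M_def)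
      show "0 \<le> matrix_form K M y y" for y using lower[of y] by (simp add: M)
      show "matrix_form K M x x = 0" by (simp add: M Qx x1)
    qed
    also have "(\<Sum>t\<in>K. M s t * x t) = (\<Sum>t\<in>K. A s t * x t) - (\<Sum>t\<in>K. if s = t then \<mu> * x s else 0)"
      unfolding M_def sum_subtractf[symmetric] by (intro sum.cong HOL.refl) (auto simp: algebra_simps)
    finally show ?thesis using K s by simp
  qed
  have nz: "\<exists>s\<in>K. x s \<noteq> 0" using x1 by (metis (mono_tags, lifting) sum.neutral zero_neq_one zero_power2)
  have pos: "0 < x s" if "s \<in> K" for s
    by (rule nonneg_eigenvector_pos[OF K(1) off conn _ nz eig that]) (auto simp: x_def)
  show thesis by (rule that[OF pos eig]) (use lower in \<open>auto simp: Q_def\<close>)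
qed

text \<open>
  Chebyshev polynomials of the second kind with the index shifted by one, so that
  \<open>cheb (cos \<theta>) n = sin (n \<theta>) / sin \<theta>\<close>. At \<open>c = - B x y\<close>, consecutive values are the
  coordinates of the roots obtained from two unit vectors \<open>x\<close> and \<open>y\<close> by reflecting in them.\<close>

fun cheb :: "real \<Rightarrow> nat \<Rightarrow> real" where
  "cheb c 0 = 0"
| "cheb c (Suc 0) = 1"
| "cheb c (Suc (Suc n)) = 2 * c * cheb c (Suc n) - cheb c n"

lemma cheb_sin: "cheb (cos \<theta>) n * sin \<theta> = sin (real n * \<theta>)"
proof (induction "cos \<theta>" n rule: cheb.induct)
  case (3 n)
  have "sin (real (Suc (Suc n)) * \<theta>) + sin (real n * \<theta>) = 2 * cos \<theta> * sin (real (Suc n) * \<theta>)"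
    using sin_add[of "real (Suc n) * \<theta>" \<theta>] sin_diff[of "real (Suc n) * \<theta>" \<theta>]
    by (simp add: algebra_simps)
  with 3 show ?case by (simp add: algebra_simps)
qed auto

lemma cheb_increasing:
  assumes "1 \<le> c"
  shows "cheb c n + 1 \<le> cheb c (Suc n) \<and> 0 \<le> cheb c n"
proof (induction n)
  case (Suc n)
  then have "0 \<le> cheb c (Suc n)" by simp
  then have "2 * cheb c (Suc n) \<le> 2 * c * cheb c (Suc n)" using assms by (simp add: mult_right_mono)
  moreover have "cheb c (Suc (Suc n)) = 2 * c * cheb c (Suc n) - cheb c n" by simp
  ultimately show ?case using Suc by linarith
qed simp

lemma cheb_nonneg_of_cos:
  assumes "2 \<le> m" "n \<le> m"
  shows "0 \<le> cheb (cos (pi / real m)) n"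
proof -
  have s: "sin (pi / real m) > 0" using assms by (intro sin_gt_zero) (auto simp: field_simps)
  have "real n * (pi / real m) \<le> pi" using assms by (simp add: field_simps mult_right_mono)
  then have "0 \<le> sin (real n * (pi / real m))" by (intro sin_ge_zero) auto
  then show ?thesis using cheb_sin[of "pi / real m" n] s
    by (metis mult_less_0_iff not_le)
qed

text \<open>
  Neighbouring roots of a dihedral subsystem span the same area as its two simple roots.\<close>

lemma cheb_det: "cheb c (Suc n) * cheb c (Suc n) - cheb c n * cheb c (Suc (Suc n)) = 1"
  by (induction n) (simp_all add: algebra_simps)

section \<open>Words and their action on the representation space\<close>

context root_basis
begin

definition word_prod :: "'g list \<Rightarrow> 'g" where
  "word_prod us = foldr (\<otimes>) us \<one>"

lemma word_prod_simps [simp]: "word_prod [] = \<one>" "word_prod (s # us) = s \<otimes> word_prod us"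
  by (simp_all add: word_prod_def)

lemma rev_in_lists [simp]: "us \<in> lists A \<Longrightarrow> rev us \<in> lists A"
  by (simp add: in_lists_conv_set)

definition refl_in :: "'v \<Rightarrow> 'v \<Rightarrow> 'v" where
  "refl_in \<beta> v = v - (2 * B v \<beta>) *\<^sub>R \<beta>"

definition act :: "'g list \<Rightarrow> 'v \<Rightarrow> 'v" where
  "act us = foldr (\<lambda>s. refl_in (\<alpha> s)) us"

lemmas B_simps = bilinear_ladd[OF B_bilinear] bilinear_radd[OF B_bilinear]
  bilinear_lsub[OF B_bilinear] bilinear_rsub[OF B_bilinear]
  bilinear_lneg[OF B_bilinear] bilinear_rneg[OF B_bilinear]
  bilinear_lmul[OF B_bilinear] bilinear_rmul[OF B_bilinear]
  bilinear_lzero[OF B_bilinear] bilinear_rzero[OF B_bilinear]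

lemma B_sum_left: "B (\<Sum>i\<in>I. f i) y = (\<Sum>i\<in>I. B (f i) y)"
  using linear_sum[of "\<lambda>x. B x y" f I] B_bilinear unfolding bilinear_def by blast

lemma B_sum_right: "B y (\<Sum>i\<in>I. f i) = (\<Sum>i\<in>I. B y (f i))"
  using linear_sum[of "B y" f I] B_bilinear unfolding bilinear_def by blast

lemma act_simps [simp]:
  "act [] v = v" "act (s # us) v = refl_in (\<alpha> s) (act us v)"
  "act (us @ vs) v = act us (act vs v)"
  by (simp_all add: act_def)

lemma refl_in_linear: "linear (refl_in \<beta>)"
  by (rule linearI) (simp_all add: refl_in_def B_simps algebra_simps)

lemma act_linear: "linear (act us)"
proof (induction us)
  case Nil
  show ?case by (rule linearI) simp_all
next
  case (Cons s us)
  have "act (s # us) = refl_in (\<alpha> s) \<circ> act us" by (rule ext) simp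
  with linear_compose[OF Cons refl_in_linear] show ?case by metis
qed

lemmas act_add = linear_add[OF act_linear] and act_scale = linear_scale[OF act_linear]
  and act_diff = linear_diff[OF act_linear] and act_neg = linear_neg[OF act_linear]

lemma B_simple_self: "s \<in> S \<Longrightarrow> B (\<alpha> s) (\<alpha> s) = 1"
  using B_finite[of s s 1] m_diag[of s] by (simp add: one_enat_def)

lemma B_refl_in: "B \<beta> \<beta> = 1 \<Longrightarrow> B (refl_in \<beta> v) (refl_in \<beta> w) = B v w"
  unfolding refl_in_def by (simp add: B_simps B_sym[of \<beta> w] algebra_simps)

lemma refl_in_invol: "B \<beta> \<beta> = 1 \<Longrightarrow> refl_in \<beta> (refl_in \<beta> v) = v"
  unfolding refl_in_def by (simp add: B_simps algebra_simps)

lemma refl_in_self: "B \<beta> \<beta> = 1 \<Longrightarrow> refl_in \<beta> \<beta> = - \<beta>"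
  unfolding refl_in_def by (simp add: scaleR_2)

lemma B_act: "us \<in> lists S \<Longrightarrow> B (act us v) (act us w) = B v w"
  by (induction us) (auto simp: B_refl_in B_simple_self)

lemma act_rev: "us \<in> lists S \<Longrightarrow> act us (act (rev us) v) = v"
  by (induction us arbitrary: v) (auto simp: refl_in_invol B_simple_self)

lemma act_rev': "us \<in> lists S \<Longrightarrow> act (rev us) (act us v) = v"
  using act_rev[of "rev us" v] by simp

text \<open>
  Reflections in arbitrary roots thereby come from words, which makes the facts about words
  applicable to them.\<close>

lemma act_conj_reflection:
  assumes "us \<in> lists S"
  shows "act (us @ [s] @ rev us) v = refl_in (act us (\<alpha> s)) v"
proof -
  have "B (act (rev us) v) (\<alpha> s) = B v (act us (\<alpha> s))"
    using B_act[of "rev us" v "act us (\<alpha> s)"] act_rev'[OF assms] assms by simp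
  then show ?thesis
    by (simp add: refl_in_def act_diff act_scale act_rev[OF assms])
qed

lemma word_prod_closed: "us \<in> lists S \<Longrightarrow> word_prod us \<in> carrier W"
  using S_subset by (induction us) auto

lemma word_prod_append:
  "us \<in> lists S \<Longrightarrow> vs \<in> lists S \<Longrightarrow> word_prod (us @ vs) = word_prod us \<otimes> word_prod vs"
proof (induction us)
  case (Cons s us)
  then have "s \<in> carrier W" using S_subset by auto
  with Cons show ?case by (simp add: m_assoc word_prod_closed)
qed (use word_prod_closed in auto)

lemma simple_sq: "s \<in> S \<Longrightarrow> s \<otimes> s = \<one>"
  using coxeter_equiv.relator[of s S s m 1] m_diag[of s] presentation[of "[s,s]" "[]"] S_subset
  by (auto simp: one_enat_def)

lemma word_prod_rev: "us \<in> lists S \<Longrightarrow> word_prod us \<otimes> word_prod (rev us) = \<one>"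
proof (induction us)
  case (Cons s us)
  then have s: "s \<in> S" "s \<in> carrier W" using S_subset by auto
  have c: "word_prod us \<in> carrier W" "word_prod (rev us) \<in> carrier W"
    using Cons by (auto intro!: word_prod_closed)
  have "word_prod (s # us) \<otimes> word_prod (rev (s # us)) = (s \<otimes> word_prod us) \<otimes> (word_prod (rev us) \<otimes> s)"
    using Cons s word_prod_append[of "rev us" "[s]"] by simp
  also have "\<dots> = s \<otimes> (word_prod us \<otimes> word_prod (rev us)) \<otimes> s"
    using s c by (simp add: m_assoc)
  finally show ?case using Cons s simple_sq by simp
qed simp

lemma \<rho>_one: "\<rho> \<one> v = v"
proof -
  interpret A: group_action W UNIV \<rho> by (rule action)
  show ?thesis using A.id_eq_one by (metis UNIV_I restrict_apply')
qed

lemma \<rho>_word_prod: "us \<in> lists S \<Longrightarrow> \<rho> (word_prod us) v = act us v"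
proof (induction us)
  case (Cons s us)
  interpret A: group_action W UNIV \<rho> by (rule action)
  have "\<rho> (s \<otimes> word_prod us) v = \<rho> s (\<rho> (word_prod us) v)"
    using A.composition_rule[of v s "word_prod us"] Cons.prems word_prod_closed S_subset by auto
  with Cons show ?case by (simp add: action_simple refl_in_def)
qed (simp add: \<rho>_one)

lemma act_eq_of_word_prod_eq:
  assumes "us \<in> lists S" "vs \<in> lists S" "word_prod us = word_prod vs"
  shows "act us = act vs"
  using \<rho>_word_prod assms by (intro ext) metis

text \<open>
  The generators are involutions, so inverses can be written without inverse letters.\<close>

lemma generate_eq_words: "K \<subseteq> S \<Longrightarrow> generate W K = word_prod ` lists K"
proof
  assume K: "K \<subseteq> S"
  then have l: "lists K \<subseteq> lists S" by auto
  show "word_prod ` lists K \<subseteq> generate W K"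
  proof
    fix g assume "g \<in> word_prod ` lists K"
    then obtain us where us: "us \<in> lists K" "g = word_prod us" by blast
    from us(1) have "word_prod us \<in> generate W K"
      by (induction us) (auto intro: generate.intros)
    with us show "g \<in> generate W K" by simp
  qed
  show "generate W K \<subseteq> word_prod ` lists K"
  proof
    fix g assume "g \<in> generate W K"
    then show "g \<in> word_prod ` lists K"
    proof (induction rule: generate.induct)
      case one
      show ?case by (rule image_eqI[of _ _ "[]"]) auto
    next
      case (incl h)
      then show ?case using K S_subset by (intro image_eqI[of _ _ "[h]"]) auto
    next
      case (inv h)
      then have "inv h = h" using K S_subset simple_sq by (metis inv_equality subsetD)
      then show ?case using inv K S_subset by (intro image_eqI[of _ _ "[h]"]) auto
    next
      case (eng g h)
      then obtain us vs where uv: "us \<in> lists K" "vs \<in> lists K" "g = word_prod us" "h = word_prod vs" by blast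
      with l have "us \<in> lists S" "vs \<in> lists S" by blast+
      with uv show ?case by (intro image_eqI[of _ _ "us @ vs"]) (auto simp: word_prod_append)
    qed
  qed
qed

text \<open>
  All relators have even length. This is what rules out \<open>l(ws) = l(w)\<close> for the length function
  below.\<close>

lemma word_length_parity:
  assumes "us \<in> lists S" "vs \<in> lists S" "word_prod us = word_prod vs"
  shows "even (length us) = even (length vs)"
proof -
  have "coxeter_equiv S m us vs" using presentation assms by (simp add: word_prod_def)
  then show ?thesis
  proof (induction rule: coxeter_equiv.induct)
    case (relator s t n)
    show ?case by (induction n) auto
  qed auto
qed

text \<open>
  The letters are restricted to \<open>K\<close>. Measuring lengths inside the subgroup generated by \<open>K\<close>
  lets the sign theorem be proved for this subgroup directly, without showing that it is
  itself a Coxeter group or that its length function is the restriction of the one of \<open>W\<close>.\<close>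

definition word_length :: "'g set \<Rightarrow> 'g list \<Rightarrow> nat" where
  "word_length K us = (LEAST n. \<exists>vs\<in>lists K. word_prod vs = word_prod us \<and> length vs = n)"

lemma word_length_le:
  "vs \<in> lists K \<Longrightarrow> word_prod vs = word_prod us \<Longrightarrow> word_length K us \<le> length vs"
  unfolding word_length_def by (rule Least_le) blast

lemma reduced_word:
  assumes "us \<in> lists K"
  obtains vs where "vs \<in> lists K" "word_prod vs = word_prod us" "length vs = word_length K us"
proof -
  have "\<exists>n. \<exists>vs\<in>lists K. word_prod vs = word_prod us \<and> length vs = n" using assms by blast
  from LeastI_ex[OF this] show ?thesis using that unfolding word_length_def by blast
qed

lemma word_length_cong: "word_prod us = word_prod vs \<Longrightarrow> word_length K us = word_length K vs"
  unfolding word_length_def by simp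

lemma word_prod_cancel: "us \<in> lists S \<Longrightarrow> vs \<in> lists S \<Longrightarrow> s \<in> S \<Longrightarrow> word_prod (us @ s # s # vs) = word_prod (us @ vs)"
proof -
  assume a: "us \<in> lists S" "vs \<in> lists S" "s \<in> S"
  then have s: "s \<in> carrier W" using S_subset by auto
  have "word_prod (s # s # vs) = word_prod vs"
    using a s word_prod_closed[of vs] by (simp add: m_assoc[symmetric] simple_sq)
  then show ?thesis using a word_prod_append[of us "s # s # vs"] word_prod_append[of us vs]
    by (simp del: word_prod_simps)
qed

lemma word_length_snoc:
  assumes K: "K \<subseteq> S" and us: "us \<in> lists K" and s: "s \<in> K"
  shows "word_length K (us @ [s]) = Suc (word_length K us) \<or> Suc (word_length K (us @ [s])) = word_length K us"
proof -
  have l: "lists K \<subseteq> lists S" using K by auto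
  obtain vs where vs: "vs \<in> lists K" "word_prod vs = word_prod us" "length vs = word_length K us"
    using reduced_word[OF us] .
  obtain ws where ws: "ws \<in> lists K" "word_prod ws = word_prod (us @ [s])" "length ws = word_length K (us @ [s])"
    using reduced_word[of "us @ [s]" K] us s by auto
  have S: "us \<in> lists S" "vs \<in> lists S" "ws \<in> lists S" "s \<in> S" using us vs ws s l K by auto
  have "word_prod (vs @ [s]) = word_prod (us @ [s])"
    using S vs word_prod_append[of vs "[s]"] word_prod_append[of us "[s]"] by simp
  then have 1: "word_length K (us @ [s]) \<le> Suc (word_length K us)"
    using word_length_le[of "vs @ [s]" K "us @ [s]"] vs s by simp
  have "word_prod (ws @ [s]) = word_prod us"
    using S ws word_prod_append[of ws "[s]"] word_prod_append[of "us @ [s]" "[s]"] word_prod_cancel[of us "[]" s]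
    by simp
  then have 2: "word_length K us \<le> Suc (word_length K (us @ [s]))"
    using word_length_le[of "ws @ [s]" K us] ws s by simp
  have "even (length ws) = even (length (us @ [s]))" "even (length vs) = even (length us)"
    using word_length_parity[of ws "us @ [s]"] word_length_parity[of vs us] ws vs S by auto
  then have "word_length K us \<noteq> word_length K (us @ [s])" using vs(3) ws(3) by (metis even_Suc length_append_singleton)
  with 1 2 show ?thesis by linarith
qed

end

section \<open>Sign coherence of roots\<close>

fun alternating :: "nat \<Rightarrow> 'a \<Rightarrow> 'a \<Rightarrow> 'a list" where
  "alternating 0 s t = []"
| "alternating (Suc k) s t = alternating k t s @ [t]"

text \<open>
  The definition adds letters on the right; extending an alternating word on the left needs
  the letter that depends on the parity of its length.\<close>

lemma alternating_Cons: "alternating (Suc k) s t = (if even k then t else s) # alternating k s t"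
proof (induction k arbitrary: s t)
  case (Suc k)
  have "alternating (Suc (Suc k)) s t = alternating (Suc k) t s @ [t]" by simp
  also have "\<dots> = (if even k then s else t) # (alternating k t s @ [t])" unfolding Suc by simp
  finally show ?case by simp
qed simp

lemma alternating_add:
  "alternating (j + k) s t = (if even k then alternating j s t else alternating j t s) @ alternating k s t"
  by (induction k arbitrary: s t) auto

lemma rev_alternating: "rev (alternating n s t) = (if even n then alternating n t s else alternating n s t)"
proof (induction n arbitrary: s t)
  case (Suc n)
  have "rev (alternating (Suc n) s t) = t # rev (alternating n t s)" by simp
  also have "\<dots> = (if even (Suc n) then alternating (Suc n) t s else alternating (Suc n) s t)"
    unfolding alternating_Cons Suc by simp
  finally show ?case .
qed simp

lemma length_alternating [simp]: "length (alternating n s t) = n"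
  by (induction n arbitrary: s t) auto

lemma alternating_in_lists: "s \<in> A \<Longrightarrow> t \<in> A \<Longrightarrow> alternating n s t \<in> lists A"
  by (induction n arbitrary: s t) auto

lemma concat_replicate_alternating: "concat (replicate n [s, t]) = alternating (2 * n) s t"
proof (induction n)
  case (Suc n)
  have "concat (replicate (Suc n) [s, t]) = concat (replicate n [s, t]) @ [s, t]"
    by (induction n) auto
  with Suc show ?case by simp
qed simp

context root_basis
begin

definition cone :: "'g set \<Rightarrow> 'v set" where
  "cone K = {v. \<exists>F k. finite F \<and> F \<subseteq> K \<and> (\<forall>s\<in>F. (0::real) \<le> k s) \<and> v = (\<Sum>s\<in>F. k s *\<^sub>R \<alpha> s)}"

lemma cone_mono: "K \<subseteq> L \<Longrightarrow> v \<in> cone K \<Longrightarrow> v \<in> cone L"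
  unfolding cone_def by blast

lemma cone_finite_combination:
  assumes "finite K"
  shows "v \<in> cone K \<longleftrightarrow> (\<exists>x. (\<forall>s. 0 \<le> x s) \<and> v = (\<Sum>s\<in>K. x s *\<^sub>R \<alpha> s))"
proof
  assume "v \<in> cone K"
  then obtain F k where F: "finite F" "F \<subseteq> K" "\<forall>s\<in>F. (0::real) \<le> k s" "v = (\<Sum>s\<in>F. k s *\<^sub>R \<alpha> s)"
    unfolding cone_def by blast
  have "v = (\<Sum>s\<in>K. (if s \<in> F then k s else 0) *\<^sub>R \<alpha> s)"
    unfolding F(4) by (rule sum.mono_neutral_cong_left) (use F assms in auto)
  with F(3) show "\<exists>x. (\<forall>s. 0 \<le> x s) \<and> v = (\<Sum>s\<in>K. x s *\<^sub>R \<alpha> s)"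
    by (intro exI[of _ "\<lambda>s. if s \<in> F then k s else 0"]) auto
next
  assume "\<exists>x. (\<forall>s. 0 \<le> x s) \<and> v = (\<Sum>s\<in>K. x s *\<^sub>R \<alpha> s)"
  then obtain x where "\<forall>s. 0 \<le> x s" "v = (\<Sum>s\<in>K. x s *\<^sub>R \<alpha> s)" by blast
  with assms show "v \<in> cone K" unfolding cone_def
    by (intro CollectI exI[of _ K] exI[of _ x]) simp
qed

lemma cone_coefficients:
  assumes "finite K" "v \<in> cone K"
  obtains x where "\<forall>s. 0 \<le> x s" "v = (\<Sum>s\<in>K. x s *\<^sub>R \<alpha> s)"
  using cone_finite_combination[OF assms(1), THEN iffD1, OF assms(2)] by (elim exE conjE)

lemma cone_combination:
  assumes "finite K" "\<And>s. s \<in> K \<Longrightarrow> 0 \<le> x s"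
  shows "(\<Sum>s\<in>K. x s *\<^sub>R \<alpha> s) \<in> cone K"
  unfolding cone_def using assms by (intro CollectI exI[of _ K] exI[of _ x]) simp

lemma cone_support: "v \<in> cone K \<Longrightarrow> \<exists>F. finite F \<and> F \<subseteq> K \<and> v \<in> cone F"
  unfolding cone_def by (smt (verit, best) mem_Collect_eq order_refl)

lemma cone_two_finite:
  assumes "v \<in> cone K" "w \<in> cone K"
  obtains F where "finite F" "F \<subseteq> K" "v \<in> cone F" "w \<in> cone F"
proof -
  obtain F G where "finite F" "F \<subseteq> K" "v \<in> cone F" "finite G" "G \<subseteq> K" "w \<in> cone G"
    using assms cone_support by meson
  then show thesis using that[of "F \<union> G"] cone_mono[of F "F \<union> G" v] cone_mono[of G "F \<union> G" w] by auto
qed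

lemma cone_add: "v \<in> cone K \<Longrightarrow> w \<in> cone K \<Longrightarrow> v + w \<in> cone K"
proof -
  assume "v \<in> cone K" "w \<in> cone K"
  from cone_two_finite[OF this] obtain F where F: "finite F" "F \<subseteq> K" "v \<in> cone F" "w \<in> cone F" .
  obtain x where x: "\<forall>s. 0 \<le> x s" "v = (\<Sum>s\<in>F. x s *\<^sub>R \<alpha> s)"
    using cone_coefficients[OF F(1) F(3)] .
  obtain y where y: "\<forall>s. 0 \<le> y s" "w = (\<Sum>s\<in>F. y s *\<^sub>R \<alpha> s)"
    using cone_coefficients[OF F(1) F(4)] .
  have "v + w = (\<Sum>s\<in>F. (x s + y s) *\<^sub>R \<alpha> s)" unfolding x y by (simp add: sum.distrib scaleR_left_distrib)
  with x y have "v + w \<in> cone F" using cone_combination[OF F(1), of "\<lambda>s. x s + y s"] by simp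
  with F(2) show ?thesis by (rule cone_mono)
qed

lemma cone_scale: "v \<in> cone K \<Longrightarrow> 0 \<le> c \<Longrightarrow> c *\<^sub>R v \<in> cone K"
proof -
  assume "v \<in> cone K" "0 \<le> c"
  then obtain F where F: "finite F" "F \<subseteq> K" "v \<in> cone F" using cone_support[of v K] by metis
  obtain x where x: "\<forall>s. 0 \<le> x s" "v = (\<Sum>s\<in>F. x s *\<^sub>R \<alpha> s)"
    using cone_coefficients[OF F(1) F(3)] .
  have "c *\<^sub>R v = (\<Sum>s\<in>F. (c * x s) *\<^sub>R \<alpha> s)" unfolding x by (simp add: scaleR_sum_right)
  with x \<open>0 \<le> c\<close> have "c *\<^sub>R v \<in> cone F" using cone_combination[OF F(1), of "\<lambda>s. c * x s"] by simp
  with F(2) show ?thesis by (rule cone_mono)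
qed

lemma cone_simple: "s \<in> K \<Longrightarrow> \<alpha> s \<in> cone K"
  unfolding cone_def by (rule CollectI, rule exI[of _ "{s}"], rule exI[of _ "\<lambda>_. 1"]) simp

lemma cone_pointed:
  assumes "K \<subseteq> S" "v \<in> cone K" "- v \<in> cone K"
  shows "v = 0"
proof -
  obtain F where F: "finite F" "F \<subseteq> K" "v \<in> cone F" "- v \<in> cone F"
    using cone_two_finite[OF assms(2,3)] .
  obtain x where x: "\<forall>s. 0 \<le> x s" "v = (\<Sum>s\<in>F. x s *\<^sub>R \<alpha> s)"
    using cone_coefficients[OF F(1) F(3)] .
  obtain y where y: "\<forall>s. 0 \<le> y s" "- v = (\<Sum>s\<in>F. y s *\<^sub>R \<alpha> s)"
    using cone_coefficients[OF F(1) F(4)] .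
  have "(\<Sum>s\<in>F. (x s + y s) *\<^sub>R \<alpha> s) = v + - v"
    unfolding y(2) unfolding x(2) by (simp add: sum.distrib scaleR_left_distrib)
  then have "x s + y s = 0" if "s \<in> F" for s
    using positively_independent[of F "\<lambda>s. x s + y s" s] F x y that assms by auto
  then have "x s = 0" if "s \<in> F" for s using x(1) y(1) that by (metis add_nonneg_eq_0_iff)
  then show ?thesis using x by simp
qed

lemma B_simple_nonpos: "s \<in> S \<Longrightarrow> t \<in> S \<Longrightarrow> s \<noteq> t \<Longrightarrow> B (\<alpha> s) (\<alpha> t) \<le> 0"
proof -
  assume st: "s \<in> S" "t \<in> S" "s \<noteq> t"
  show ?thesis
  proof (cases "m s t")
    case (enat n)
    with m_ge_2[OF st] have "2 \<le> n" by (metis enat_ord_simps(1) numeral_eq_enat)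
    then have "pi / real n \<le> pi / 2" by (intro divide_left_mono) auto
    moreover have "0 \<le> pi / real n" by simp
    ultimately have "cos (pi / real n) \<ge> 0" using pi_ge_zero by (intro cos_ge_zero) linarith+
    with B_finite[OF st(1,2) enat] show ?thesis by simp
  next
    case infinity
    with B_infinite[OF st(1,2)] show ?thesis by simp
  qed
qed

text \<open>
  An alternating word of length \<open>2 * n\<close> is trivial and consists of two alternating words of
  length \<open>n\<close>, so one half equals the reversal of the other.\<close>

lemma braid_relation:
  assumes st: "s \<in> S" "t \<in> S" and n: "m s t = enat n"
  shows "word_prod (alternating n s t) = word_prod (alternating n t s)"
proof -
  let ?a = "alternating n s t" and ?b = "if even n then alternating n s t else alternating n t s"
  have l: "?a \<in> lists S" "?b \<in> lists S" using alternating_in_lists[of s S t n] alternating_in_lists[of t S s n] st by simp_all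
  have "coxeter_equiv S m (?b @ ?a) []"
    using coxeter_equiv.relator[of s S t m n] st n
    unfolding concat_replicate_alternating mult_2 alternating_add by simp
  then have 1: "word_prod ?b \<otimes> word_prod ?a = \<one>"
    using presentation[of "?b @ ?a" "[]"] l word_prod_append[OF l(2,1)] by (auto simp: word_prod_def)
  have 2: "word_prod ?a \<otimes> word_prod (rev ?a) = \<one>" using l by (rule_tac word_prod_rev)
  have "word_prod ?b = word_prod ?b \<otimes> (word_prod ?a \<otimes> word_prod (rev ?a))"
    using word_prod_closed[OF l(2)] unfolding 2 by simp
  also have "\<dots> = word_prod (rev ?a)"
    using 1 l word_prod_closed[OF l(2)] word_prod_closed[OF l(1)] word_prod_closed[of "rev ?a"]
    by (simp add: m_assoc[symmetric])
  finally show ?thesis unfolding rev_alternating by (auto split: if_splits)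
qed

lemma act_alternating:
  assumes st: "s \<in> S" "t \<in> S"
  shows "act (alternating k s t) (\<alpha> s) =
    cheb (- B (\<alpha> s) (\<alpha> t)) (Suc k) *\<^sub>R \<alpha> (if even k then s else t) +
    cheb (- B (\<alpha> s) (\<alpha> t)) k *\<^sub>R \<alpha> (if even k then t else s)"
proof (induction k)
  case (Suc k)
  let ?c = "- B (\<alpha> s) (\<alpha> t)"
  let ?a = "if even k then t else s" and ?b = "if even k then s else t"
  have a: "B (\<alpha> ?a) (\<alpha> ?a) = 1" and b: "B (\<alpha> ?b) (\<alpha> ?a) = - ?c"
    using st B_sym by (auto simp: B_simple_self)
  have "act (alternating (Suc k) s t) (\<alpha> s) = refl_in (\<alpha> ?a) (act (alternating k s t) (\<alpha> s))"
    unfolding alternating_Cons by simp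
  also have "\<dots> = cheb ?c (Suc k) *\<^sub>R refl_in (\<alpha> ?a) (\<alpha> ?b) + cheb ?c k *\<^sub>R refl_in (\<alpha> ?a) (\<alpha> ?a)"
    unfolding Suc by (simp add: linear_add[OF refl_in_linear] linear_scale[OF refl_in_linear])
  also have "\<dots> = cheb ?c (Suc (Suc k)) *\<^sub>R \<alpha> ?a + cheb ?c (Suc k) *\<^sub>R \<alpha> ?b"
    unfolding refl_in_self[OF a] refl_in_def[of _ "\<alpha> ?b"] b
    by (simp add: algebra_simps scaleR_2)
  finally show ?case by simp
qed simp

text \<open>
  The dihedral case of sign coherence: for \<open>m s t = n\<close> the value is
  \<open>sin (k * pi / n) / sin (pi / n)\<close>, and for \<open>m s t = \<infinity>\<close> the sequence increases from \<open>0\<close>.\<close>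

lemma cheb_edge_nonneg:
  assumes st: "s \<in> S" "t \<in> S" "s \<noteq> t" and k: "\<And>n. m s t = enat n \<Longrightarrow> k \<le> n"
  shows "0 \<le> cheb (- B (\<alpha> s) (\<alpha> t)) k"
proof (cases "m s t")
  case (enat n)
  with m_ge_2[OF st] have "2 \<le> n" by (metis enat_ord_simps(1) numeral_eq_enat)
  from cheb_nonneg_of_cos[OF this k[OF enat]] B_finite[OF st(1,2) enat] show ?thesis by simp
next
  case infinity
  with B_infinite[OF st(1,2)] have "1 \<le> - B (\<alpha> s) (\<alpha> t)" by simp
  from cheb_increasing[OF this] show ?thesis by blast
qed

text \<open>
  Induction on the length of \<open>w\<close>. Let \<open>t\<close> be the last letter of a reduced word, so \<open>t \<noteq> s\<close>,
  and split off from the right the longest possible alternating word in \<open>s, t\<close>, as \<open>w = v d\<close>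
  with lengths adding up. Maximality makes both \<open>vs\<close> and \<open>vt\<close> longer than \<open>v\<close>, so \<open>v\<close> sends
  both simple roots into the cone by induction. The dihedral element \<open>d\<close> sends \<open>\<alpha> s\<close> to a
  combination of them whose coefficients are nonnegative because \<open>d\<close> is shorter than \<open>m s t\<close>;
  otherwise the braid relation would let \<open>w\<close> end in \<open>s\<close>.\<close>

theorem ascent_maps_simple_root_to_cone:
  assumes K: "K \<subseteq> S" and "us \<in> lists K" "s \<in> K"
    and "word_length K us < word_length K (us @ [s])"
  shows "act us (\<alpha> s) \<in> cone K"
  using assms(2-)
proof (induction "word_length K us" arbitrary: us s rule: less_induct)
  case less
  note s = \<open>s \<in> K\<close>
  have l: "lists K \<subseteq> lists S" using K by auto
  note inS = subsetD[OF l] subsetD[OF K]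
  obtain us0 where us0: "us0 \<in> lists K" "word_prod us0 = word_prod us" "length us0 = word_length K us"
    using reduced_word[OF less(2)] .
  have act_us: "act us0 = act us" by (rule act_eq_of_word_prod_eq) (use us0 less(2) inS in auto)
  have prod_snoc: "word_prod (xs @ ys) = word_prod (xs' @ ys)"
    if "word_prod xs = word_prod xs'" "xs \<in> lists K" "xs' \<in> lists K" "ys \<in> lists K" for xs xs' ys
    using that word_prod_append[of xs ys] word_prod_append[of xs' ys] inS by auto
  have asc: "length us0 < word_length K (us0 @ [s])"
    using less(4) word_length_cong[OF prod_snoc[OF us0(2) us0(1) less(2), of "[s]"]] s us0(3) by simp
  show ?case
  proof (cases us0 rule: rev_cases)
    case Nil
    then show ?thesis using cone_simple[OF s] act_us by (metis act_simps(1))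
  next
    case (snoc us1 t)
    have t: "t \<in> K" "us1 \<in> lists K" using us0 snoc by auto
    have "s \<noteq> t"
    proof
      assume "s = t"
      then have "word_prod us1 = word_prod (us0 @ [s])"
        using word_prod_cancel[of us1 "[]" s] inS t s snoc by simp
      then have "word_length K (us0 @ [s]) \<le> length us1" using word_length_le t by blast
      with asc snoc show False by simp
    qed
    define A where "A = {k. \<exists>vs\<in>lists K. word_prod us = word_prod (vs @ alternating k s t) \<and>
      length vs + k = length us0}"
    have alt: "alternating k x y \<in> lists K" if "x \<in> K" "y \<in> K" for k x y
      using that by (intro alternating_in_lists)
    have "1 \<in> A" unfolding A_def using t us0 snoc by (auto intro!: bexI[of _ us1])
    have finA: "finite A" by (rule finite_subset[of _ "{..length us0}"]) (auto simp: A_def)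
    \<comment> \<open>The longest alternating tail that can be split off without wasting length.\<close>
    define k where "k = Max A"
    have kA: "k \<in> A" unfolding k_def using finA \<open>1 \<in> A\<close> by (intro Max_in) auto
    have k1: "1 \<le> k" unfolding k_def using finA \<open>1 \<in> A\<close> by (intro Max_ge)
    have kmax: "Suc k \<notin> A" using Max_ge[OF finA, of "Suc k"] unfolding k_def by auto
    obtain vs where vs: "vs \<in> lists K" "word_prod us = word_prod (vs @ alternating k s t)"
        "length vs + k = length us0"
      using kA unfolding A_def by blast
    have short: "length us0 \<le> length ws + j"
      if "ws \<in> lists K" "word_prod us = word_prod (ws @ alternating j s t)" for ws j
      using word_length_le[of "ws @ alternating j s t" K us] that alt[OF s t(1)] us0(3) by auto
    have vs_red: "word_length K vs = length vs"
    proof (rule antisym)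
      show "word_length K vs \<le> length vs" using vs by (intro word_length_le) auto
      obtain ws where ws: "ws \<in> lists K" "word_prod ws = word_prod vs" "length ws = word_length K vs"
        using reduced_word[OF vs(1)] .
      have "length us0 \<le> length ws + k"
        by (rule short[OF ws(1)]) (use vs(2) prod_snoc[OF ws(2,1) vs(1) alt[OF s t(1)]] in simp)
      with vs(3) ws(3) show "length vs \<le> word_length K vs" by simp
    qed
    define a where "a = (if even k then t else s)"
    define b where "b = (if even k then s else t)"
    have ab: "a \<in> K" "b \<in> K" using s t by (auto simp: a_def b_def)
    have up: "word_length K vs < word_length K (vs @ [x])" if x: "x \<in> K"
      and bad: "\<And>ws. ws \<in> lists K \<Longrightarrow> word_prod (ws @ [x]) = word_prod vs \<Longrightarrow> Suc (length ws) = length vs \<Longrightarrow> False" for x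
    proof (rule ccontr)
      assume "\<not> ?thesis"
      then have *: "Suc (word_length K (vs @ [x])) = length vs"
        using word_length_snoc[OF K vs(1) x] vs_red by linarith
      obtain ws where ws: "ws \<in> lists K" "word_prod ws = word_prod (vs @ [x])" "length ws = word_length K (vs @ [x])"
        using reduced_word[of "vs @ [x]" K] vs x by auto
      have "word_prod (ws @ [x]) = word_prod ((vs @ [x]) @ [x])"
        by (rule prod_snoc) (use ws vs x in auto)
      also have "\<dots> = word_prod vs" using word_prod_cancel[of vs "[]" x] vs x inS by simp
      finally show False using bad[OF ws(1)] ws(3) * by simp
    qed
    \<comment> \<open>If the next letter on the left shortened the rest, the alternating tail could be made longer.\<close>
    have up_a: "word_length K vs < word_length K (vs @ [a])"
    proof (rule up[OF ab(1)])
      fix ws assume ws: "ws \<in> lists K" "word_prod (ws @ [a]) = word_prod vs" "Suc (length ws) = length vs"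
      have "word_prod us = word_prod ((ws @ [a]) @ alternating k s t)"
        unfolding vs(2) by (rule prod_snoc) (use ws vs ab alt s t in auto)
      also have "(ws @ [a]) @ alternating k s t = ws @ alternating (Suc k) s t"
        unfolding alternating_Cons a_def by simp
      finally have "Suc k \<in> A" unfolding A_def using ws vs(3) by auto
      with kmax show False ..
    qed
    \<comment> \<open>If the first letter of the tail shortened the rest, it would cancel and the word would not be reduced.\<close>
    have up_b: "word_length K vs < word_length K (vs @ [b])"
    proof (rule up[OF ab(2)])
      fix ws assume ws: "ws \<in> lists K" "word_prod (ws @ [b]) = word_prod vs" "Suc (length ws) = length vs"
      obtain k' where k': "k = Suc k'" using k1 by (cases k) auto
      have "word_prod us = word_prod ((ws @ [b]) @ alternating k s t)"
        unfolding vs(2) by (rule prod_snoc) (use ws vs ab alt s t in auto)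
      also have "(ws @ [b]) @ alternating k s t = ws @ b # b # alternating k' s t"
        unfolding k' alternating_Cons b_def by simp
      also have "word_prod \<dots> = word_prod (ws @ alternating k' s t)"
        by (rule word_prod_cancel) (use ws ab alt s t inS in auto)
      finally have "length us0 \<le> length ws + k'" by (rule short[OF ws(1)])
      with ws vs(3) k' show False by simp
    qed
    have "word_length K vs < word_length K us" using vs_red vs(3) us0(3) k1 by simp
    then have pa: "act vs (\<alpha> a) \<in> cone K" and pb: "act vs (\<alpha> b) \<in> cone K"
      using less(1) vs(1) ab up_a up_b by auto
    \<comment> \<open>A tail of full length could be rewritten to end in \<open>s\<close>, and multiplication by \<open>s\<close> would shorten the word.\<close>
    have k_less: "Suc k \<le> n" if n: "m s t = enat n" for n
    proof (rule ccontr)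
      assume "\<not> Suc k \<le> n"
      then obtain j where j: "k = j + n" by (metis add.commute le_Suc_ex not_less_eq_eq)
      have "2 \<le> n" using m_ge_2[of s t] n s t \<open>s \<noteq> t\<close> inS by (metis enat_ord_simps(1) numeral_eq_enat)
      then obtain n' where n': "n = Suc n'" by (cases n) auto
      define X where "X = (if even n then alternating j s t else alternating j t s)"
      have X: "X \<in> lists K" "length X = j" using alt s t by (auto simp: X_def)
      have "word_prod us = word_prod ((vs @ X) @ alternating n s t)"
        unfolding vs(2) j alternating_add X_def by simp
      also have "\<dots> = word_prod ((vs @ X) @ alternating n t s)"
        using word_prod_append[of "vs @ X" "alternating n s t"] word_prod_append[of "vs @ X" "alternating n t s"]
          braid_relation[OF _ _ n] X vs s t inS alt by auto
      also have "(vs @ X) @ alternating n t s = (vs @ X @ alternating n' s t) @ [s]" by (simp add: n')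
      finally have eq: "word_prod us = word_prod ((vs @ X @ alternating n' s t) @ [s])" .
      have "word_prod (us @ [s]) = word_prod (((vs @ X @ alternating n' s t) @ [s]) @ [s])"
        by (rule prod_snoc[OF eq]) (use vs X alt s t less(2) in auto)
      also have "\<dots> = word_prod (vs @ X @ alternating n' s t)"
        using word_prod_cancel[of "vs @ X @ alternating n' s t" "[]" s] vs X alt s t inS by auto
      finally have "word_length K (us @ [s]) \<le> length (vs @ X @ alternating n' s t)"
        by (intro word_length_le) (use vs X alt s t in auto)
      then have "word_length K (us @ [s]) < length us0" using vs(3) X j n' by simp
      with less(4) us0(3) show False by simp
    qed
    have "act us (\<alpha> s) = act vs (act (alternating k s t) (\<alpha> s))"
      using act_eq_of_word_prod_eq[OF _ _ vs(2)] less(2) vs(1) alt s t inS by auto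
    also have "\<dots> = cheb (- B (\<alpha> s) (\<alpha> t)) (Suc k) *\<^sub>R act vs (\<alpha> b) + cheb (- B (\<alpha> s) (\<alpha> t)) k *\<^sub>R act vs (\<alpha> a)"
      using act_alternating[of s t k] s t inS unfolding a_def b_def by (simp add: act_add act_scale)
    also have "\<dots> \<in> cone K"
    proof (intro cone_add cone_scale pa pb)
      show "0 \<le> cheb (- B (\<alpha> s) (\<alpha> t)) (Suc k)" "0 \<le> cheb (- B (\<alpha> s) (\<alpha> t)) k"
        using cheb_edge_nonneg[of s t] k_less s t inS \<open>s \<noteq> t\<close> by (auto dest: Suc_leD)
    qed
    finally show ?thesis .
  qed
qed

text \<open>
  If \<open>ws\<close> is shorter than \<open>w\<close>, then \<open>ws\<close> is an element that \<open>s\<close> makes longer, and it sends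
  \<open>\<alpha> s\<close> to the negative of what \<open>w\<close> does.\<close>

theorem sign_coherence:
  assumes K: "K \<subseteq> S" and us: "us \<in> lists K" and s: "s \<in> K"
  shows "act us (\<alpha> s) \<in> cone K \<or> - act us (\<alpha> s) \<in> cone K"
  using word_length_snoc[OF K us s]
proof
  assume "word_length K (us @ [s]) = Suc (word_length K us)"
  then show ?thesis using ascent_maps_simple_root_to_cone[OF K us s] by simp
next
  assume *: "Suc (word_length K (us @ [s])) = word_length K us"
  have sS: "s \<in> S" "us \<in> lists S" using s us K by auto
  have "word_prod ((us @ [s]) @ [s]) = word_prod us"
    using word_prod_cancel[of us "[]" s] sS by simp
  then have "word_length K (us @ [s]) < word_length K ((us @ [s]) @ [s])"
    using word_length_cong[of "(us @ [s]) @ [s]" us K] * by simp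
  then have "act (us @ [s]) (\<alpha> s) \<in> cone K"
    using us s by (intro ascent_maps_simple_root_to_cone[OF K]) auto
  then show ?thesis using refl_in_self[OF B_simple_self[OF sS(1)]] by (simp add: act_neg)
qed

text \<open>
  A nontrivial element has a last letter \<open>t\<close> in a reduced word, and it sends \<open>\<alpha> t\<close> to a
  negative root.\<close>

theorem trivial_if_preserves_positivity:
  assumes K: "K \<subseteq> S" and us: "us \<in> lists K" and pos: "\<And>s. s \<in> K \<Longrightarrow> act us (\<alpha> s) \<in> cone K"
  shows "word_prod us = \<one>"
proof -
  obtain vs where vs: "vs \<in> lists K" "word_prod vs = word_prod us" "length vs = word_length K us"
    using reduced_word[OF us] .
  show ?thesis
  proof (cases vs rule: rev_cases)
    case Nil
    then show ?thesis using vs by simp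
  next
    case (snoc ws t)
    have t: "t \<in> K" "t \<in> S" "ws \<in> lists K" "ws \<in> lists S" "us \<in> lists S" "vs \<in> lists S"
      using vs snoc K us by auto
    have "word_length K ws \<le> length ws" using t by (intro word_length_le) auto
    then have "word_length K ws < word_length K (ws @ [t])"
      using word_length_cong[OF vs(2), of K] vs(3) snoc by simp
    then have p: "act ws (\<alpha> t) \<in> cone K" by (rule ascent_maps_simple_root_to_cone[OF K t(3,1)])
    have "act us (\<alpha> t) = act vs (\<alpha> t)" using act_eq_of_word_prod_eq[OF t(6,5) vs(2)] by simp
    also have "\<dots> = - act ws (\<alpha> t)"
      unfolding snoc by (simp add: refl_in_self B_simple_self t act_neg)
    finally have "- act ws (\<alpha> t) \<in> cone K" using pos[OF t(1)] by simp
    with p have "act ws (\<alpha> t) = 0" by (intro cone_pointed[OF K])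
    then have "B (\<alpha> t) (\<alpha> t) = 0" using B_act[OF t(4), of "\<alpha> t" "\<alpha> t"] by (simp add: B_simps)
    then show ?thesis using B_simple_self[OF t(2)] by simp
  qed
qed

end

section \<open>Discreteness of the root system\<close>

context root_basis
begin

definition root_set :: "'g set \<Rightarrow> 'v set" where
  "root_set K = {act us (\<alpha> s) | us s. us \<in> lists K \<and> s \<in> K}"

lemma root_set_mono: "K \<subseteq> L \<Longrightarrow> root_set K \<subseteq> root_set L"
  unfolding root_set_def using lists_mono[of K L] by blast

lemma simple_in_root_set: "s \<in> K \<Longrightarrow> \<alpha> s \<in> root_set K"
  unfolding root_set_def by (rule CollectI, rule exI[of _ "[]"]) auto

lemma roots_eq: "roots W S \<alpha> \<rho> = root_set S"
proof -
  have c: "carrier W = word_prod ` lists S" using generates generate_eq_words by simp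
  have "orbit W \<rho> (\<alpha> s) = (\<lambda>us. act us (\<alpha> s)) ` lists S" for s
  proof -
    have "orbit W \<rho> (\<alpha> s) = (\<lambda>us. \<rho> (word_prod us) (\<alpha> s)) ` lists S"
      unfolding orbit_def c by auto
    also have "\<dots> = (\<lambda>us. act us (\<alpha> s)) ` lists S"
      by (rule image_cong) (simp_all add: \<rho>_word_prod)
    finally show ?thesis .
  qed
  then show ?thesis unfolding roots_def root_set_def by auto
qed

lemma pos_roots_eq: "pos_roots W S \<alpha> \<rho> = root_set S \<inter> cone S"
  unfolding pos_roots_def roots_eq cone_def by auto

lemma root_norm: "K \<subseteq> S \<Longrightarrow> \<beta> \<in> root_set K \<Longrightarrow> B \<beta> \<beta> = 1"
proof -
  assume K: "K \<subseteq> S" and "\<beta> \<in> root_set K"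
  then obtain us s where us: "us \<in> lists K" "s \<in> K" "\<beta> = act us (\<alpha> s)" unfolding root_set_def by auto
  then have "us \<in> lists S" using K by auto
  from B_act[OF this] show ?thesis using us K B_simple_self by auto
qed

lemma act_root: "\<beta> \<in> root_set K \<Longrightarrow> us \<in> lists K \<Longrightarrow> act us \<beta> \<in> root_set K"
proof -
  assume "\<beta> \<in> root_set K" and us: "us \<in> lists K"
  then obtain vs t where "vs \<in> lists K" "t \<in> K" "\<beta> = act vs (\<alpha> t)" unfolding root_set_def by blast
  with us show ?thesis unfolding root_set_def
    by (intro CollectI exI[of _ "us @ vs"] exI[of _ t]) simp
qed

lemma reflection_word:
  assumes "K \<subseteq> S" "\<beta> \<in> root_set K"
  obtains us where "us \<in> lists K" "act us = refl_in \<beta>"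
proof -
  obtain vs t where vs: "vs \<in> lists K" "t \<in> K" "\<beta> = act vs (\<alpha> t)"
    using assms unfolding root_set_def by blast
  have "vs \<in> lists S" using vs assms by auto
  then have "act (vs @ [t] @ rev vs) = refl_in \<beta>" unfolding vs(3) by (intro ext act_conj_reflection)
  moreover have "vs @ [t] @ rev vs \<in> lists K" using vs by auto
  ultimately show thesis using that by blast
qed

lemma refl_in_root: "K \<subseteq> S \<Longrightarrow> \<beta> \<in> root_set K \<Longrightarrow> \<gamma> \<in> root_set K \<Longrightarrow> refl_in \<beta> \<gamma> \<in> root_set K"
  by (metis reflection_word act_root)

lemma root_sign: "K \<subseteq> S \<Longrightarrow> \<beta> \<in> root_set K \<Longrightarrow> \<beta> \<in> cone K \<or> - \<beta> \<in> cone K"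
  unfolding root_set_def using sign_coherence by auto

lemma uminus_root: "K \<subseteq> S \<Longrightarrow> \<beta> \<in> root_set K \<Longrightarrow> - \<beta> \<in> root_set K"
  using refl_in_root[of K \<beta> \<beta>] refl_in_self[OF root_norm] by simp

lemma root_not_both: "K \<subseteq> S \<Longrightarrow> \<beta> \<in> root_set K \<Longrightarrow> \<beta> \<in> cone K \<Longrightarrow> - \<beta> \<in> cone K \<Longrightarrow> False"
  using cone_pointed[of K \<beta>] root_norm[of K \<beta>] by (simp add: B_simps)

abbreviation gram :: "'g \<Rightarrow> 'g \<Rightarrow> real" where
  "gram s t \<equiv> B (\<alpha> s) (\<alpha> t)"

definition combination :: "'g set \<Rightarrow> ('g \<Rightarrow> real) \<Rightarrow> 'v" where
  "combination K x = (\<Sum>s\<in>K. x s *\<^sub>R \<alpha> s)"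

lemma B_combination_left: "B (combination K x) v = (\<Sum>s\<in>K. x s * B (\<alpha> s) v)"
  unfolding combination_def B_sum_left by (simp add: B_simps)

lemma B_combination_right: "B v (combination K x) = (\<Sum>s\<in>K. x s * B v (\<alpha> s))"
  unfolding combination_def B_sum_right by (simp add: B_simps)

lemma B_combinations: "B (combination K x) (combination K y) = matrix_form K gram x y"
  by (subst B_combination_left)
    (simp add: B_combination_right matrix_form_def sum_distrib_left mult.assoc)

lemma combination_add: "combination K (\<lambda>s. x s + y s) = combination K x + combination K y"
  by (simp add: combination_def scaleR_left_distrib sum.distrib)

lemma combination_diff: "combination K (\<lambda>s. x s - y s) = combination K x - combination K y"
  by (simp add: combination_def scaleR_left_diff_distrib sum_subtractf)

lemma combination_scale: "combination K (\<lambda>s. c * x s) = c *\<^sub>R combination K x"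
  by (simp add: combination_def scaleR_sum_right)

lemma combination_indicator: "finite K \<Longrightarrow> s \<in> K \<Longrightarrow> combination K (\<lambda>u. if u = s then 1 else 0) = \<alpha> s"
proof -
  assume "finite K" "s \<in> K"
  moreover have "combination K (\<lambda>u. if u = s then 1 else 0) = (\<Sum>u\<in>K. if u = s then \<alpha> s else 0)"
    unfolding combination_def by (intro sum.cong HOL.refl) auto
  ultimately show ?thesis by simp
qed

lemma cone_combinationE:
  assumes "finite K" "v \<in> cone K"
  obtains x where "\<forall>s. 0 \<le> x s" "v = combination K x"
  using cone_coefficients[OF assms] unfolding combination_def by blast

lemma combination_in_cone: "finite K \<Longrightarrow> (\<And>s. s \<in> K \<Longrightarrow> 0 \<le> x s) \<Longrightarrow> combination K x \<in> cone K"
  unfolding combination_def by (rule cone_combination)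

text \<open>
  Infinitely many bounded positive roots would contain a sequence of distinct roots with
  convergent coordinates. The product of the reflections in two late neighbours is then close
  to the identity, so it keeps each simple root positive; by Tits' theorem it is the identity.
  But then the two roots agree up to sign, hence agree.\<close>

theorem finite_bounded_positive_roots:
  assumes K: "finite K" "K \<subseteq> S"
    and indep: "\<And>x s. combination K x = 0 \<Longrightarrow> s \<in> K \<Longrightarrow> x s = 0"
  shows "finite {\<beta> \<in> root_set K. \<exists>x. \<beta> = combination K x \<and> (\<forall>s\<in>K. 0 \<le> x s \<and> x s \<le> M)}"
    (is "finite ?P")
proof (rule ccontr)
  assume "infinite ?P"
  then obtain b :: "nat \<Rightarrow> 'v" where b: "inj b" "range b \<subseteq> ?P" using infinite_countable_subset by blast
  then have "\<forall>n. \<exists>x. b n = combination K x \<and> (\<forall>s\<in>K. 0 \<le> x s \<and> x s \<le> M)" by blast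
  then obtain x where x: "\<And>n. b n = combination K (x n)" "\<And>n s. s \<in> K \<Longrightarrow> 0 \<le> x n s"
      "\<And>n s. s \<in> K \<Longrightarrow> x n s \<le> M" by metis
  have "\<bar>x n s\<bar> \<le> M" if "s \<in> K" for n s using x(2,3)[OF that, of n] by simp
  then obtain l r where r: "strict_mono r" and l: "\<And>s. s \<in> K \<Longrightarrow> (\<lambda>n. x (r n) s) \<longlonglongrightarrow> l s"
    using bounded_coords_convergent_subseq[OF K(1), of x M] by blast
  define y where "y n = x (r n)" for n
  have y0: "0 \<le> y n s" if "s \<in> K" for n s using x(2)[OF that] by (simp add: y_def)
  have bn: "b (r n) = combination K (y n)" for n by (simp add: y_def x(1))
  have root: "combination K (y n) \<in> root_set K" for n using b(2) unfolding bn[symmetric] by blast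
  have yl: "(\<lambda>n. y n s) \<longlonglongrightarrow> l s" if "s \<in> K" for s using l[OF that] by (simp add: y_def)
  have yl': "(\<lambda>n. y (Suc n) s) \<longlonglongrightarrow> l s" if "s \<in> K" for s
    using LIMSEQ_Suc[OF yl[OF that]] .
  define q where "q n = B (combination K (y (Suc n))) (combination K (y n))" for n
  define p where "p n s = B (\<alpha> s) (combination K (y n))" for n s
  define L where "L s = B (\<alpha> s) (combination K l)" for s
  have "(\<lambda>n. matrix_form K gram (y n) (y n)) \<longlonglongrightarrow> matrix_form K gram l l"
    unfolding matrix_form_def by (intro tendsto_intros yl)
  moreover have "matrix_form K gram (y n) (y n) = 1" for n
    using root_norm[OF K(2) root[of n]] unfolding B_combinations .
  ultimately have l1: "matrix_form K gram l l = 1" by (simp add: LIMSEQ_const_iff)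
  have "q \<longlonglongrightarrow> matrix_form K gram l l"
    unfolding q_def B_combinations matrix_form_def by (intro tendsto_intros yl yl')
  then have q: "q \<longlonglongrightarrow> 1" using l1 by simp
  have p: "(\<lambda>n. p n s) \<longlonglongrightarrow> L s" for s
    unfolding p_def L_def B_combination_right by (intro tendsto_intros yl)
  have p': "(\<lambda>n. p (Suc n) s) \<longlonglongrightarrow> L s" for s using LIMSEQ_Suc[OF p] .
  \<comment> \<open>The coordinates of \<open>\<alpha> s\<close> after the reflections in two consecutive roots of the sequence. In the limit the two reflections cancel.\<close>
  define z where "z n s u = (if u = s then 1 else 0) - 2 * p (Suc n) s * y (Suc n) u
      - 2 * (p n s - 2 * p (Suc n) s * q n) * y n u" for n s u
  have z_act: "refl_in (combination K (y n)) (refl_in (combination K (y (Suc n))) (\<alpha> s)) = combination K (z n s)"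
    if s: "s \<in> K" for n s
  proof -
    have "combination K (z n s) = \<alpha> s - (2 * p (Suc n) s) *\<^sub>R combination K (y (Suc n))
        - (2 * (p n s - 2 * p (Suc n) s * q n)) *\<^sub>R combination K (y n)"
      unfolding z_def combination_diff combination_scale combination_indicator[OF K(1) s] ..
    then show ?thesis
      unfolding refl_in_def p_def q_def by (simp add: B_simps)
  qed
  have "(\<lambda>n. z n s s) \<longlonglongrightarrow> 1 - 2 * L s * l s - 2 * (L s - 2 * L s * 1) * l s" if "s \<in> K" for s
  proof -
    have "(\<lambda>n. 1 - 2 * p (Suc n) s * y (Suc n) s - 2 * (p n s - 2 * p (Suc n) s * q n) * y n s)
        \<longlonglongrightarrow> 1 - 2 * L s * l s - 2 * (L s - 2 * L s * 1) * l s"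
      by (intro tendsto_diff tendsto_mult tendsto_const yl yl' p p' q that)
    then show ?thesis by (simp add: z_def)
  qed
  then have "(\<lambda>n. z n s s) \<longlonglongrightarrow> 1" if "s \<in> K" for s using that by (fastforce simp: algebra_simps)
  then have "\<forall>s\<in>K. \<forall>\<^sub>F n in sequentially. 0 < z n s s"
    by (intro ballI order_tendstoD(1)) auto
  then have "\<forall>\<^sub>F n in sequentially. \<forall>s\<in>K. 0 < z n s s"
    using K(1) by (simp add: eventually_ball_finite)
  then obtain n where n: "\<And>s. s \<in> K \<Longrightarrow> 0 < z n s s" unfolding eventually_sequentially by auto
  let ?\<beta> = "combination K (y n)" and ?\<gamma> = "combination K (y (Suc n))"
  obtain us where us: "us \<in> lists K" "act us = refl_in ?\<beta>" using reflection_word[OF K(2) root] .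
  obtain vs where vs: "vs \<in> lists K" "act vs = refl_in ?\<gamma>" using reflection_word[OF K(2) root] .
  have "act (us @ vs) (\<alpha> s) \<in> cone K" if s: "s \<in> K" for s
  proof (rule ccontr)
    assume "act (us @ vs) (\<alpha> s) \<notin> cone K"
    then have "- act (us @ vs) (\<alpha> s) \<in> cone K" using sign_coherence[OF K(2), of "us @ vs" s] us vs s by simp
    then obtain x where x: "\<forall>s. 0 \<le> x s" "- combination K (z n s) = combination K x"
      using z_act[OF s] us vs cone_combinationE[OF K(1)] by auto
    have "combination K (\<lambda>u. z n s u + x u) = 0" unfolding combination_add x(2)[symmetric] by simp
    from indep[OF this s] n[OF s] x(1)[rule_format, of s] show False by simp
  qed
  then have "word_prod (us @ vs) = \<one>"
    using us vs by (intro trivial_if_preserves_positivity[OF K(2)]) auto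
  then have "act (us @ vs) = act []"
    using us vs K(2) by (intro act_eq_of_word_prod_eq) auto
  then have "refl_in ?\<beta> (refl_in ?\<gamma> v) = v" for v using us vs by (metis act_simps(1,3))
  then have "refl_in ?\<beta> ?\<gamma> = refl_in ?\<gamma> ?\<gamma>"
    using refl_in_invol[OF root_norm[OF K(2) root[of n]]] by metis
  then have "?\<gamma> - (2 * B ?\<gamma> ?\<beta>) *\<^sub>R ?\<beta> = - ?\<gamma>"
    unfolding refl_in_self[OF root_norm[OF K(2) root]] by (simp add: refl_in_def)
  then have "2 *\<^sub>R ?\<gamma> = 2 *\<^sub>R (B ?\<gamma> ?\<beta> *\<^sub>R ?\<beta>)" by (simp add: scaleR_2 algebra_simps)
  then have g: "?\<gamma> = B ?\<gamma> ?\<beta> *\<^sub>R ?\<beta>" by (metis scaleR_cancel_left zero_neq_numeral)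
  define k where "k = B ?\<gamma> ?\<beta>"
  have g: "?\<gamma> = k *\<^sub>R ?\<beta>" using g by (simp add: k_def)
  have "1 = B ?\<gamma> ?\<gamma>" using root_norm[OF K(2) root] by simp
  also have "\<dots> = k * k" unfolding g using root_norm[OF K(2) root[of n]] by (simp add: B_simps)
  finally have "k = 1 \<or> k = -1" by (metis power2_eq_1_iff power2_eq_square)
  then show False
  proof
    assume "k = 1"
    then have "b (r (Suc n)) = b (r n)" using g bn by simp
    then show False using b(1) r by (metis injD n_not_Suc_n strict_mono_eq)
  next
    assume "k = -1"
    then have "- ?\<beta> = ?\<gamma>" using g by simp
    moreover have "?\<beta> \<in> cone K" "?\<gamma> \<in> cone K" using y0 by (auto intro: combination_in_cone[OF K(1)])
    ultimately show False using root_not_both[OF K(2) root[of n]] by simp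
  qed
qed

lemma independent_of_positive_definite:
  assumes K: "finite K" and "\<mu> > 0" "\<And>y. \<mu> * (\<Sum>s\<in>K. (y s)^2) \<le> matrix_form K gram y y"
    and "combination K x = 0" "s \<in> K"
  shows "x s = 0"
proof -
  have "matrix_form K gram x x = 0" unfolding B_combinations[symmetric] assms(4) by (simp add: B_simps)
  with assms(2) assms(3)[of x] have "(\<Sum>s\<in>K. (x s)^2) \<le> 0" by (simp add: mult_le_0_iff)
  moreover have "(x s)^2 \<le> (\<Sum>s\<in>K. (x s)^2)" using K \<open>s \<in> K\<close> by (intro member_le_sum) auto
  ultimately show ?thesis by (metis order_trans power2_less_eq_zero_iff)
qed

text \<open>
  In a positive definite space the roots, being unit vectors, have bounded coordinates, so
  there are finitely many of them, and a group element is determined by the images of the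
  simple roots.\<close>

theorem finite_subgroup_of_positive_definite:
  assumes K: "finite K" "K \<subseteq> S" and \<mu>: "\<mu> > 0"
    and pd: "\<And>y. \<mu> * (\<Sum>s\<in>K. (y s)^2) \<le> matrix_form K gram y y"
  shows "finite (generate W K)"
proof -
  define M where "M = 1 / \<mu> + 1"
  let ?P = "{\<beta> \<in> root_set K. \<exists>x. \<beta> = combination K x \<and> (\<forall>s\<in>K. 0 \<le> x s \<and> x s \<le> M)}"
  have "finite ?P"
    by (rule finite_bounded_positive_roots[OF K]) (rule independent_of_positive_definite[OF K(1) \<mu> pd])
  moreover have pos: "\<beta> \<in> ?P" if \<beta>: "\<beta> \<in> root_set K" "\<beta> \<in> cone K" for \<beta>
  proof -
    obtain x where x: "\<forall>s. 0 \<le> x s" "\<beta> = combination K x"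
      using cone_combinationE[OF K(1) \<beta>(2)] .
    have "x s \<le> M" if s: "s \<in> K" for s
    proof (rule ccontr)
      assume "\<not> x s \<le> M"
      then have big: "x s > 1 / \<mu> + 1" by (simp add: M_def)
      have "(x s)^2 \<le> (\<Sum>s\<in>K. (x s)^2)" using K s by (intro member_le_sum) auto
      then have "\<mu> * (x s)^2 \<le> \<mu> * (\<Sum>s\<in>K. (x s)^2)" using \<mu> by simp
      also have "\<dots> \<le> 1" using pd[of x] root_norm[OF K(2) \<beta>(1)] unfolding x(2) B_combinations by simp
      finally have "(x s)^2 \<le> 1 / \<mu>" using \<mu> by (simp add: field_simps)
      moreover have "x s \<le> (x s)^2"
      proof -
        have "0 < 1 / \<mu>" using \<mu> by simp
        with big have "1 \<le> x s" by linarith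
        then show ?thesis by (simp add: power2_eq_square)
      qed
      ultimately show False using big by linarith
    qed
    with x \<beta> show ?thesis by blast
  qed
  have "root_set K \<subseteq> ?P \<union> uminus ` ?P"
  proof
    fix \<beta> assume \<beta>: "\<beta> \<in> root_set K"
    show "\<beta> \<in> ?P \<union> uminus ` ?P"
      using root_sign[OF K(2) \<beta>]
    proof
      assume "\<beta> \<in> cone K"
      with pos[OF \<beta>] show ?thesis by blast
    next
      assume "- \<beta> \<in> cone K"
      with pos[OF uminus_root[OF K(2) \<beta>]] have "- \<beta> \<in> ?P" by blast
      then have "- (- \<beta>) \<in> uminus ` ?P" by (rule imageI)
      then show ?thesis by simp
    qed
  qed
  ultimately have fin: "finite (root_set K)" by (meson finite_UnI finite_imageI finite_subset)
  define \<Psi> where "\<Psi> g s = (if s \<in> K then \<rho> g (\<alpha> s) else 0)" for g s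
  have lK: "us \<in> lists K \<Longrightarrow> us \<in> lists S" for us using K(2) by auto
  have \<Psi>w: "\<Psi> (word_prod us) s = act us (\<alpha> s)" if "us \<in> lists K" "s \<in> K" for us s
    using \<rho>_word_prod[OF lK] that by (simp add: \<Psi>_def)
  have "inj_on \<Psi> (generate W K)"
  proof (rule inj_onI)
    fix g h assume "g \<in> generate W K" "h \<in> generate W K" and eq: "\<Psi> g = \<Psi> h"
    then obtain us vs where us: "us \<in> lists K" "g = word_prod us" and vs: "vs \<in> lists K" "h = word_prod vs"
      unfolding generate_eq_words[OF K(2)] by blast
    have "act (rev vs @ us) (\<alpha> s) \<in> cone K" if "s \<in> K" for s
    proof -
      have "act us (\<alpha> s) = act vs (\<alpha> s)" using \<Psi>w[OF us(1) that] \<Psi>w[OF vs(1) that] eq us vs by simp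
      then have "act (rev vs @ us) (\<alpha> s) = \<alpha> s" using act_rev'[OF lK[OF vs(1)]] by simp
      then show ?thesis using cone_simple[OF that] by simp
    qed
    then have "word_prod (rev vs @ us) = \<one>" using us vs by (intro trivial_if_preserves_positivity[OF K(2)]) auto
    then have 1: "word_prod (rev vs) \<otimes> word_prod us = \<one>" using word_prod_append lK us vs by simp
    have "word_prod us = (word_prod vs \<otimes> word_prod (rev vs)) \<otimes> word_prod us"
      using word_prod_rev[OF lK[OF vs(1)]] word_prod_closed[OF lK[OF us(1)]] by simp
    also have "\<dots> = word_prod vs"
      using 1 word_prod_closed lK us vs by (simp add: m_assoc)
    finally show "g = h" using us vs by simp
  qed
  moreover have "\<Psi> ` generate W K \<subseteq> {f. \<forall>s. (s \<in> K \<longrightarrow> f s \<in> root_set K) \<and> (s \<notin> K \<longrightarrow> f s = 0)}"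
  proof (rule image_subsetI, rule CollectI, intro allI conjI impI)
    fix g s assume "g \<in> generate W K" and s: "s \<in> K"
    then obtain us where us: "us \<in> lists K" "g = word_prod us" unfolding generate_eq_words[OF K(2)] by blast
    with \<Psi>w[OF us(1) s] act_root[OF simple_in_root_set[OF s] us(1)] show "\<Psi> g s \<in> root_set K" by simp
  qed (simp add: \<Psi>_def)
  then have "finite (\<Psi> ` generate W K)"
    by (rule finite_subset) (rule finite_set_of_finite_funs[OF K(1) fin])
  ultimately show ?thesis using finite_image_iff by blast
qed

end

section \<open>Connected finite sets of generators\<close>

lemma standard_entry_offdiag:
  assumes "2 \<le> k"
  shows "standard_entry k \<le> 0" and "standard_entry k = 0 \<longleftrightarrow> k = 2" and "- 1 \<le> standard_entry k"
proof -
  have "standard_entry k \<le> 0 \<and> (standard_entry k = 0 \<longleftrightarrow> k = 2) \<and> - 1 \<le> standard_entry k"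
  proof (cases k)
    case (enat n)
    with assms have n: "2 \<le> n" by (metis enat_ord_simps(1) numeral_eq_enat)
    then have le: "pi / real n \<le> pi / 2" by (intro divide_left_mono) auto
    have pos: "0 < pi / real n" using n by simp
    show ?thesis
    proof (cases "n = 2")
      case True
      then show ?thesis using enat by (simp add: standard_entry_def numeral_eq_enat)
    next
      case False
      then have "pi / real n < pi / 2" using n by (intro divide_strict_left_mono) auto
      then have "cos (pi / real n) > 0" using pos by (intro cos_gt_zero_pi) auto
      then show ?thesis using enat False by (simp add: standard_entry_def numeral_eq_enat)
    qed
  next
    case infinity
    then show ?thesis by (simp add: standard_entry_def)
  qed
  then show "standard_entry k \<le> 0" "standard_entry k = 0 \<longleftrightarrow> k = 2" "- 1 \<le> standard_entry k" by auto
qed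

context root_basis
begin

lemma gram_standard: "s \<in> S \<Longrightarrow> t \<in> S \<Longrightarrow> m s t \<noteq> \<infinity> \<Longrightarrow> gram s t = standard_entry (m s t)"
  using B_finite[of s t] by (cases "m s t") (auto simp: standard_entry_def)

lemma gram_le_standard: "s \<in> S \<Longrightarrow> t \<in> S \<Longrightarrow> gram s t \<le> standard_entry (m s t)"
  using B_infinite[of s t] gram_standard[of s t] by (cases "m s t") (auto simp: standard_entry_def)

lemma gram_zero_iff: "s \<in> S \<Longrightarrow> t \<in> S \<Longrightarrow> s \<noteq> t \<Longrightarrow> gram s t = 0 \<longleftrightarrow> m s t = 2"
  using standard_entry_offdiag(2)[OF m_ge_2, of s t] gram_standard[of s t] B_infinite[of s t]
  by (cases "m s t") auto

text \<open>
  Connected finite vertex sets of the Coxeter graph, together with a way to build them.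
  Growing one vertex at a time from a fixed start makes unions of such sets easy and gives
  access to the moment at which the form becomes indefinite.\<close>

inductive grown :: "'g \<Rightarrow> 'g set \<Rightarrow> bool" for s0 :: 'g where
  grown_start: "s0 \<in> S \<Longrightarrow> grown s0 {s0}"
| grown_step: "grown s0 K \<Longrightarrow> t \<in> S \<Longrightarrow> t \<notin> K \<Longrightarrow> s \<in> K \<Longrightarrow> m s t \<noteq> 2 \<Longrightarrow> grown s0 (insert t K)"

lemma grown_finite: "grown s0 K \<Longrightarrow> finite K \<and> K \<subseteq> S \<and> s0 \<in> K"
  by (induction rule: grown.induct) auto

lemma grown_connected:
  assumes "grown s0 K" "J \<subset> K" "J \<noteq> {}"
  shows "\<exists>s\<in>J. \<exists>t\<in>K - J. m s t \<noteq> 2"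
  using assms
proof (induction arbitrary: J rule: grown.induct)
  case grown_start
  then show ?case by auto
next
  case (grown_step K t s)
  have K: "K \<subseteq> S" using grown_finite[OF grown_step.hyps(1)] by blast
  consider "J \<inter> K = {}" | "K \<subseteq> J" | "J \<inter> K \<noteq> {}" "J \<inter> K \<subset> K" by blast
  then show ?case
  proof cases
    case 1
    then have "J = {t}" using grown_step.prems by auto
    moreover have "m t s \<noteq> 2" using grown_step.hyps K m_sym[of s t] by auto
    ultimately show ?thesis using grown_step.hyps by auto
  next
    case 2
    then have "J = K" using grown_step.prems by auto
    then show ?thesis using grown_step.hyps by auto
  next
    case 3
    from grown_step.IH[OF 3(2,1)] show ?thesis by blast
  qed
qed

lemma grown_union:
  assumes "grown s0 K" "grown s0 L"
  shows "grown s0 (K \<union> L)"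
  using assms(2)
proof (induction rule: grown.induct)
  case grown_start
  have "K \<union> {s0} = K" using grown_finite[OF assms(1)] by auto
  with assms(1) show ?case by simp
next
  case (grown_step L t s)
  show ?case
  proof (cases "t \<in> K")
    case True
    then have "K \<union> insert t L = K \<union> L" by auto
    with grown_step.IH show ?thesis by simp
  next
    case False
    then have "grown s0 (insert t (K \<union> L))" using grown_step by (intro grown.grown_step[where s = s]) auto
    then show ?thesis by simp
  qed
qed

text \<open>
  The set of all vertices that can be reached is closed under adjacency, so irreducibility
  makes it all of \<open>S\<close>.\<close>

lemma grown_covers:
  assumes irr: "irreducible_coxeter S m" and s0: "s0 \<in> S" and "finite F" "F \<subseteq> S"
  shows "\<exists>K. grown s0 K \<and> F \<subseteq> K"
proof -
  define R where "R = {t. \<exists>K. grown s0 K \<and> t \<in> K}"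
  have R: "R \<subseteq> S" "s0 \<in> R" unfolding R_def using grown_finite grown_start[OF s0] by blast+
  have "R = S"
  proof (rule ccontr)
    assume "R \<noteq> S"
    then obtain s t where st: "s \<in> R" "t \<in> S - R" "m s t \<noteq> 2"
      using irr R unfolding irreducible_coxeter_def by blast
    then obtain K where K: "grown s0 K" "s \<in> K" unfolding R_def by blast
    moreover from K st have "t \<notin> K" unfolding R_def by blast
    ultimately have "grown s0 (insert t K)" using st by (intro grown_step[where s = s]) auto
    with st show False unfolding R_def by blast
  qed
  with assms(3,4) show ?thesis
  proof (induction F rule: finite_induct)
    case empty
    then show ?case using grown_start[OF s0] by blast
  next
    case (insert t F)
    then obtain K L where "grown s0 K" "F \<subseteq> K" "grown s0 L" "t \<in> L" unfolding R_def by blast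
    then show ?case using grown_union[of s0 K L] by (intro exI[of _ "K \<union> L"]) auto
  qed
qed

text \<open>
  The eigenvector is a function of coefficients, so it makes sense even if the simple roots
  are linearly dependent.\<close>

lemma grown_frobenius:
  assumes K: "grown s0 K"
  obtains \<mu> x where "\<forall>s\<in>K. 0 < x s"
    and "\<forall>s\<in>K. B (combination K x) (\<alpha> s) = \<mu> * x s"
    and "\<forall>y. \<mu> * (\<Sum>s\<in>K. (y s)^2) \<le> matrix_form K gram y y"
proof -
  note f = grown_finite[OF K]
  have off: "gram s t \<le> 0" if "s \<in> K" "t \<in> K" "s \<noteq> t" for s t using B_simple_nonpos f that by blast
  have conn: "\<exists>s\<in>J. \<exists>t\<in>K - J. gram s t \<noteq> 0" if J: "J \<subset> K" "J \<noteq> {}" for J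
  proof -
    obtain s t where st: "s \<in> J" "t \<in> K - J" "m s t \<noteq> 2" using grown_connected[OF K J] by blast
    then have "s \<in> S" "t \<in> S" "s \<noteq> t" using J f by auto
    with st gram_zero_iff[of s t] show ?thesis by blast
  qed
  show thesis
  proof (rule perron_frobenius[of K gram])
    fix \<mu> x
    assume pos: "\<And>s. s \<in> K \<Longrightarrow> 0 < x s" and eig: "\<And>s. s \<in> K \<Longrightarrow> (\<Sum>t\<in>K. gram s t * x t) = \<mu> * x s"
      and low: "\<And>y. \<mu> * (\<Sum>s\<in>K. (y s)^2) \<le> matrix_form K gram y y"
    have "B (combination K x) (\<alpha> s) = \<mu> * x s" if "s \<in> K" for s
      using eig[OF that] unfolding B_sym[of "combination K x" "\<alpha> s"] B_combination_right by (simp add: mult.commute)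
    with pos low show thesis by (intro that[of x \<mu>]) auto
  qed (use f off conn B_sym in auto)
qed

definition indefinite :: "'g set \<Rightarrow> bool" where
  "indefinite K \<longleftrightarrow> (\<exists>y. matrix_form K gram y y < 0)"

text \<open>
  Since \<open>K\<close> generates an infinite group, \<open>B\<close> is not positive definite on it. If it is
  semidefinite, there is an isotropic vector with all coordinates positive. A neighbour \<open>t\<close>
  outside \<open>K\<close> has negative product with it, and a small multiple of \<open>\<alpha> t\<close> pushes it to
  negative norm.\<close>

lemma indefinite_superset_of_infinite:
  assumes irr: "irreducible_coxeter S m" and K: "grown s0 K" and inf: "infinite (generate W K)"
    and proper: "K \<noteq> S"
  shows "\<exists>L. grown s0 L \<and> K \<subseteq> L \<and> indefinite L"
proof -
  note f = grown_finite[OF K]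
  obtain \<mu> x where x': "\<forall>s\<in>K. 0 < x s"
    "\<forall>s\<in>K. B (combination K x) (\<alpha> s) = \<mu> * x s"
    "\<forall>y. \<mu> * (\<Sum>s\<in>K. (y s)^2) \<le> matrix_form K gram y y" using grown_frobenius[OF K] .
  note x = x'(1,2)[THEN bspec] x'(3)[THEN spec]
  have "\<not> 0 < \<mu>" using finite_subgroup_of_positive_definite[of K \<mu>] x(3) inf f by blast
  have form: "B (combination K x) (combination K x) = \<mu> * (\<Sum>s\<in>K. (x s)^2)"
    unfolding B_combination_right[of "combination K x"]
    by (simp add: x(2) sum_distrib_left power2_eq_square mult_ac)
  show ?thesis
  proof (cases "\<mu> < 0")
    case True
    have "x s \<noteq> 0" if "s \<in> K" for s using x(1)[OF that] by simp
    then have "0 < (\<Sum>s\<in>K. (x s)^2)" using f by (intro sum_pos) auto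
    with True form have "indefinite K" unfolding indefinite_def B_combinations[symmetric]
      by (intro exI[of _ x]) (simp add: mult_neg_pos)
    with K show ?thesis by blast
  next
    case False
    with \<open>\<not> 0 < \<mu>\<close> have \<mu>: "\<mu> = 0" by simp
    obtain s t where st: "s \<in> K" "t \<in> S - K" "m s t \<noteq> 2"
      using irr f proper unfolding irreducible_coxeter_def by (metis empty_iff psubsetI)
    define b where "b = B (combination K x) (\<alpha> t)"
    have nonpos: "x u * gram u t \<le> 0" if "u \<in> K" for u
    proof -
      have "u \<in> S" "t \<in> S" "u \<noteq> t" using that st f by auto
      with x(1)[OF that] B_simple_nonpos show ?thesis by (simp add: mult_nonneg_nonpos)
    qed
    have "x s * gram s t < 0"
    proof -
      have "s \<in> S" "t \<in> S" "s \<noteq> t" using st f by auto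
      then have "gram s t < 0" using gram_zero_iff[of s t] B_simple_nonpos[of s t] st by fastforce
      with x(1)[OF st(1)] show ?thesis by (simp add: mult_pos_neg)
    qed
    moreover have "(\<Sum>u\<in>K. x u * gram u t) = x s * gram s t + (\<Sum>u\<in>K - {s}. x u * gram u t)"
      using f st by (intro sum.remove) auto
    moreover have "(\<Sum>u\<in>K - {s}. x u * gram u t) \<le> 0" using nonpos by (intro sum_nonpos) auto
    ultimately have b: "b < 0" unfolding b_def B_combination_left by linarith
    \<comment> \<open>At \<open>- b\<close> the form \<open>2 * e * b + e^2\<close>, as a function of the coefficient \<open>e\<close> of \<open>\<alpha> t\<close>, has its minimum \<open>- b^2\<close>.\<close>
    define y where "y = x(t := - b)"
    have "combination (insert t K) y = - b *\<^sub>R \<alpha> t + combination K x"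
    proof -
      have "combination K y = combination K x" unfolding combination_def y_def
        using st by (intro sum.cong HOL.refl) auto
      moreover have "combination (insert t K) y = y t *\<^sub>R \<alpha> t + combination K y"
        unfolding combination_def using f st by (intro sum.insert) auto
      ultimately show ?thesis by (simp add: y_def)
    qed
    then have y: "combination (insert t K) y = combination K x - b *\<^sub>R \<alpha> t" by simp
    have "gram t t = 1" "B (combination K x) (combination K x) = 0"
      using form \<mu> B_simple_self[of t] st by auto
    then have "matrix_form (insert t K) gram y y = - (b * b)"
      unfolding B_combinations[symmetric] y
      by (simp add: B_simps B_sym[of "\<alpha> t" "combination K x"] b_def[symmetric] del: B_combinations)
    with b have "indefinite (insert t K)" unfolding indefinite_def
      by (metis mult_neg_neg neg_less_0_iff_less)
    moreover have "grown s0 (insert t K)" using K st by (intro grown_step[where s = s]) auto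
    ultimately show ?thesis by blast
  qed
qed

lemma two_point_psd:
  assumes "a \<in> S" "b \<in> S" "a \<noteq> b" "- 1 \<le> gram a b"
  shows "0 \<le> matrix_form {a, b} gram y y"
proof -
  have ident: "p^2 + q^2 + 2 * g * (p * q) = (1 + g) * (p^2 + q^2) + (- g) * (p - q)^2" for g p q :: real
    by (simp add: power2_eq_square algebra_simps)
  have g: "gram a b \<le> 0" using B_simple_nonpos assms by blast
  have "matrix_form {a, b} gram y y = (y a)^2 + (y b)^2 + 2 * gram a b * (y a * y b)"
  proof -
    have "matrix_form {a, b} gram y y =
        y a * y a * gram a a + y a * y b * gram a b + (y b * y a * gram b a + y b * y b * gram b b)"
      using \<open>a \<noteq> b\<close> by (simp add: matrix_form_def)
    then show ?thesis unfolding B_simple_self[OF assms(1)] B_simple_self[OF assms(2)] B_sym[of "\<alpha> b" "\<alpha> a"]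
      by (simp add: power2_eq_square)
  qed
  also have "\<dots> = (1 + gram a b) * ((y a)^2 + (y b)^2) + (- gram a b) * (y a - y b)^2"
    by (rule ident)
  also have "\<dots> \<ge> 0"
  proof -
    have "0 \<le> 1 + gram a b" "0 \<le> - gram a b" using g assms by auto
    then show ?thesis by (simp only: add_nonneg_nonneg mult_nonneg_nonneg zero_le_power2)
  qed
  finally show ?thesis .
qed

text \<open>
  Follow the growth of \<open>K\<close> and stop at the first indefinite set with three or more elements.
  If it has at least four, the set before the last step is semidefinite. If it has three,
  either some pair has product above \<open>- 1\<close>, so that the form is semidefinite on this pair, or
  no pair does.\<close>

lemma indefinite_with_psd_hyperplane:
  assumes "grown s0 K" "indefinite K" "3 \<le> card K"
  shows "\<exists>J. grown s0 J \<and> 3 \<le> card J \<and> indefinite J \<and>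
    ((\<exists>s\<in>J. \<not> indefinite (J - {s})) \<or> (\<forall>a\<in>J. \<forall>b\<in>J. a \<noteq> b \<longrightarrow> gram a b \<le> - 1))"
  using assms
proof (induction rule: grown.induct)
  case grown_start
  then show ?case by simp
next
  case (grown_step K t s)
  have K: "grown s0 (insert t K)" by (rule grown.grown_step) fact+
  note f = grown_finite[OF grown_step.hyps(1)]
  show ?case
  proof (cases "3 \<le> card K")
    case True
    show ?thesis
    proof (cases "indefinite K")
      case True
      with \<open>3 \<le> card K\<close> grown_step.IH show ?thesis by blast
    next
      case False
      moreover have "insert t K - {t} = K" using grown_step.hyps by auto
      ultimately show ?thesis using K grown_step.prems by (intro exI[of _ "insert t K"]) auto
    qed
  next
    case False
    then have c3: "card (insert t K) = 3" using grown_step f by simp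
    show ?thesis
    proof (cases "\<forall>a\<in>insert t K. \<forall>b\<in>insert t K. a \<noteq> b \<longrightarrow> gram a b \<le> - 1")
      case True
      with K grown_step.prems show ?thesis by blast
    next
      case False
      then obtain a b where ab: "a \<in> insert t K" "b \<in> insert t K" "a \<noteq> b" "- 1 < gram a b" by force
      have fin: "finite (insert t K)" using f by simp
      have "card (insert t K - {a, b}) = 1" using c3 ab fin by (subst card_Diff_subset) auto
      then obtain c where c: "insert t K - {a, b} = {c}" using card_1_singletonE by blast
      have "insert t K - {c} = {a, b}" using c ab by blast
      moreover have "\<not> indefinite {a, b}"
        unfolding indefinite_def not_ex not_less using two_point_psd[of a b] ab f grown_step.hyps by auto
      moreover have "c \<in> insert t K" using c by blast
      ultimately show ?thesis using K grown_step.prems by (intro exI[of _ "insert t K"]) metis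
    qed
  qed
qed

end

section \<open>Roots of unbounded height\<close>

context root_basis
begin

lemma combination_range_closed:
  assumes "v \<in> range (combination K)" "w \<in> range (combination K)"
  shows "v + c *\<^sub>R w \<in> range (combination K)"
proof -
  obtain x y where "v = combination K x" "w = combination K y" using assms by blast
  then have "v + c *\<^sub>R w = combination K (\<lambda>s. x s + c * y s)" by (simp add: combination_add combination_scale)
  then show ?thesis by blast
qed

lemma combination_range_simple: "finite K \<Longrightarrow> s \<in> K \<Longrightarrow> \<alpha> s \<in> range (combination K)"
  by (metis combination_indicator rangeI)

lemma combination_range_refl:
  assumes "finite K" "s \<in> K" "v \<in> range (combination K)"
  shows "refl_in (\<alpha> s) v \<in> range (combination K)"
  using combination_range_closed[OF assms(3) combination_range_simple[OF assms(1,2)], of "- (2 * B v (\<alpha> s))"]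
  by (simp add: refl_in_def)

lemma orthogonal_to_combination:
  assumes "\<And>t. t \<in> K \<Longrightarrow> B u (\<alpha> t) = 0" "v \<in> range (combination K)"
  shows "B u v = 0"
proof -
  obtain x where "v = combination K x" using assms by blast
  then show ?thesis using assms(1) by (simp add: B_combination_right)
qed

lemma act_combination: "act us (combination K x) = (\<Sum>s\<in>K. x s *\<^sub>R act us (\<alpha> s))"
  unfolding combination_def linear_sum[OF act_linear] by (simp add: act_scale)

lemma B_act_combinations:
  "B (act us (combination K x)) (act vs (combination K y)) =
    matrix_form K (\<lambda>s t. B (act us (\<alpha> s)) (act vs (\<alpha> t))) x y"
  unfolding act_combination B_sum_left matrix_form_def
  by (simp add: B_sum_right B_simps sum_distrib_left mult_ac)

end

text \<open>
  The Perron-Frobenius vector \<open>z = combination J x\<close> of an indefinite connected set \<open>J\<close>. Since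
  \<open>\<mu> < 0\<close>, it has negative norm and negative product with every simple root of \<open>J\<close>.\<close>

locale indefinite_subsystem = root_basis W S m B \<alpha> \<rho>
  for W :: "('g, 'b) monoid_scheme" (structure) and S :: "'g set" and m :: "'g \<Rightarrow> 'g \<Rightarrow> enat"
    and B :: "'v::real_vector \<Rightarrow> 'v \<Rightarrow> real" and \<alpha> :: "'g \<Rightarrow> 'v" and \<rho> :: "'g \<Rightarrow> 'v \<Rightarrow> 'v" +
  fixes s0 :: 'g and J :: "'g set" and \<mu> :: real and x :: "'g \<Rightarrow> real"
  assumes J: "grown s0 J" and \<mu>: "\<mu> < 0" and xpos: "\<And>s. s \<in> J \<Longrightarrow> 0 < x s"
    and eig: "\<And>s. s \<in> J \<Longrightarrow> B (combination J x) (\<alpha> s) = \<mu> * x s"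
begin

definition height :: "'v \<Rightarrow> real" where
  "height v = - B (combination J x) v"

lemma J_finite: "finite J" and J_sub: "J \<subseteq> S" and J_s0: "s0 \<in> J"
  using grown_finite[OF J] by auto

lemma height_linear: "height (v + w) = height v + height w" "height (v - w) = height v - height w"
  "height (c *\<^sub>R v) = c * height v" "height (- v) = - height v"
  by (simp_all add: height_def B_simps)

lemma height_simple: "s \<in> J \<Longrightarrow> height (\<alpha> s) > 0"
  using eig xpos \<mu> by (simp add: height_def mult_neg_pos)

lemma height_combination: "height (combination J c) = (\<Sum>s\<in>J. c s * height (\<alpha> s))"
  unfolding height_def B_combination_right by (simp add: sum_negf)

lemma height_cone: "v \<in> cone J \<Longrightarrow> 0 \<le> height v"
proof -
  assume "v \<in> cone J"
  then obtain c where c: "\<forall>s. 0 \<le> c s" "v = combination J c" using cone_combinationE[OF J_finite] by metis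
  show ?thesis unfolding c(2) height_combination
    by (intro sum_nonneg mult_nonneg_nonneg) (use c(1) height_simple less_imp_le in blast)+
qed

lemma height_eq_sum: "height v = (\<Sum>s\<in>J. x s * (- B v (\<alpha> s)))"
  unfolding height_def B_combination_left by (simp add: sum_negf B_sym)

text \<open>
  The height is a fixed positive combination of the numbers \<open>- B v (\<alpha> s)\<close>. So for a root of
  height at least \<open>h0\<close> one of these numbers is bounded below by a positive constant, and
  reflecting in that \<open>\<alpha> s\<close> raises the height by at least a fixed amount without leaving the
  cone.\<close>

lemma roots_of_large_height: "\<exists>\<beta>\<in>root_set J \<inter> cone J. M \<le> height \<beta>"
proof -
  define X where "X = (\<Sum>s\<in>J. x s)"
  define h0 where "h0 = height (\<alpha> s0)"
  define d where "d = Min ((\<lambda>s. height (\<alpha> s)) ` J)"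
  have d: "d > 0" "\<And>s. s \<in> J \<Longrightarrow> d \<le> height (\<alpha> s)"
    unfolding d_def using J_finite J_s0 height_simple
    by (subst Min_gr_iff, auto)
  have h0: "h0 > 0" using height_simple[OF J_s0] by (simp add: h0_def)
  have X: "X > 0" unfolding X_def using J_finite J_s0 xpos by (intro sum_pos) auto
  \<comment> \<open>A lower bound for the gain of height in one reflection.\<close>
  define c where "c = 2 * (h0 / X) * d"
  have c: "c > 0" using h0 X d by (simp add: c_def)
  have "\<exists>\<beta>\<in>root_set J \<inter> cone J. h0 + real n * c \<le> height \<beta>" for n
  proof (induction n)
    case 0
    show ?case using simple_in_root_set[OF J_s0] cone_simple[OF J_s0] by (auto simp: h0_def)
  next
    case (Suc n)
    then obtain \<beta> where \<beta>: "\<beta> \<in> root_set J" "\<beta> \<in> cone J" "h0 + real n * c \<le> height \<beta>" by blast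
    have hb: "h0 \<le> height \<beta>" using \<beta>(3) c by (smt (verit) mult_nonneg_nonneg of_nat_0_le_iff)
    have "\<exists>s\<in>J. h0 / X \<le> - B \<beta> (\<alpha> s)"
    proof (rule ccontr)
      assume "\<not> ?thesis"
      then have "(\<Sum>s\<in>J. x s * (- B \<beta> (\<alpha> s))) < (\<Sum>s\<in>J. x s * (h0 / X))"
        using J_finite J_s0 xpos by (intro sum_strict_mono mult_strict_left_mono) (auto simp: not_le)
      also have "\<dots> = X * (h0 / X)" unfolding X_def by (rule sum_distrib_right[symmetric])
      also have "\<dots> = h0" using X by simp
      finally show False using hb by (simp add: height_eq_sum)
    qed
    then obtain s where s: "s \<in> J" "h0 / X \<le> - B \<beta> (\<alpha> s)" by blast
    define b where "b = - B \<beta> (\<alpha> s)"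
    have "0 < h0 / X" using h0 X by simp
    then have b: "h0 / X \<le> b" "0 < b" using s by (auto simp: b_def)
    have r: "refl_in (\<alpha> s) \<beta> = \<beta> + (2 * b) *\<^sub>R \<alpha> s" by (simp add: refl_in_def b_def)
    have "refl_in (\<alpha> s) \<beta> \<in> root_set J"
      by (rule refl_in_root[OF J_sub simple_in_root_set[OF s(1)] \<beta>(1)])
    moreover have "refl_in (\<alpha> s) \<beta> \<in> cone J" unfolding r using \<beta>(2) b s by (intro cone_add cone_scale cone_simple) auto
    moreover have "h0 + real (Suc n) * c \<le> height (refl_in (\<alpha> s) \<beta>)"
    proof -
      have "2 * (h0 / X) * d \<le> 2 * b * height (\<alpha> s)"
        using b d s h0 X by (intro mult_mono) auto
      then show ?thesis using \<beta>(3) unfolding r height_linear c_def[symmetric] by (simp add: algebra_simps)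
    qed
    ultimately show ?case by blast
  qed
  moreover obtain n where "M < real n * c" using c reals_Archimedean3 by blast
  ultimately show ?thesis using h0 by (smt (verit))
qed

text \<open>
  Dividing by the height keeps the coordinates bounded and sends the norm \<open>1\<close> of a root to
  \<open>0\<close>.\<close>

lemma isotropic_limit_of_roots:
  obtains \<beta> c e where "\<forall>n. \<beta> n \<in> root_set J \<and> 0 < height (\<beta> n) \<and> \<beta> n = combination J (c n)"
    "filterlim (\<lambda>n. height (\<beta> n)) at_top sequentially"
    "\<forall>s\<in>J. (\<lambda>n. c n s / height (\<beta> n)) \<longlonglongrightarrow> e s"
    "height (combination J e) = 1" "B (combination J e) (combination J e) = 0"
proof -
  have "\<forall>n. \<exists>\<beta> c. \<beta> \<in> root_set J \<and> real (Suc n) \<le> height \<beta> \<and> (\<forall>s. 0 \<le> c s) \<and> \<beta> = combination J c"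
  proof
    fix n
    obtain \<beta> where \<beta>: "\<beta> \<in> root_set J" "\<beta> \<in> cone J" "real (Suc n) \<le> height \<beta>"
      using roots_of_large_height by blast
    obtain c where "\<forall>s. 0 \<le> c s" "\<beta> = combination J c" using cone_combinationE[OF J_finite \<beta>(2)] .
    with \<beta> show "\<exists>\<beta> c. \<beta> \<in> root_set J \<and> real (Suc n) \<le> height \<beta> \<and> (\<forall>s. 0 \<le> c s) \<and> \<beta> = combination J c"
      by (intro exI[of _ \<beta>] exI[of _ c]) simp
  qed
  then obtain \<beta> c where \<beta>: "\<And>n. \<beta> n \<in> root_set J" "\<And>n. real (Suc n) \<le> height (\<beta> n)"
      "\<And>n s. 0 \<le> c n s" "\<And>n. \<beta> n = combination J (c n)" by metis
  have hpos: "0 < height (\<beta> n)" for n using \<beta>(2)[of n] by linarith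
  define M where "M = (\<Sum>s\<in>J. 1 / height (\<alpha> s))"
  have "\<bar>c n s / height (\<beta> n)\<bar> \<le> M" if s: "s \<in> J" for n s
  proof -
    have "c n s * height (\<alpha> s) \<le> height (\<beta> n)" unfolding \<beta>(4) height_combination
      using s J_finite \<beta>(3) height_simple by (intro member_le_sum mult_nonneg_nonneg) (auto intro: less_imp_le)
    then have "c n s / height (\<beta> n) \<le> 1 / height (\<alpha> s)"
      using hpos[of n] height_simple[OF s] by (simp add: field_simps)
    also have "\<dots> \<le> M" unfolding M_def using s J_finite height_simple
      by (intro member_le_sum) (auto intro: less_imp_le)
    finally show ?thesis using \<beta>(3)[of n s] hpos[of n] by simp
  qed
  then obtain e r where r: "strict_mono r" and e: "\<And>s. s \<in> J \<Longrightarrow> (\<lambda>n. c (r n) s / height (\<beta> (r n))) \<longlonglongrightarrow> e s"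
    using bounded_coords_convergent_subseq[OF J_finite, of "\<lambda>n s. c n s / height (\<beta> n)" M] by blast
  let ?h = "\<lambda>n. height (\<beta> (r n))"
  have lim: "filterlim ?h at_top sequentially"
  proof (rule filterlim_at_top_mono[OF filterlim_real_sequentially], rule always_eventually, rule allI)
    fix n
    have "n \<le> r n" using r by (simp add: seq_suble)
    then show "real n \<le> ?h n" using \<beta>(2)[of "r n"] by linarith
  qed
  have "(\<lambda>n. \<Sum>s\<in>J. c (r n) s / ?h n * height (\<alpha> s)) \<longlonglongrightarrow> (\<Sum>s\<in>J. e s * height (\<alpha> s))"
    by (intro tendsto_intros e)
  moreover have "(\<Sum>s\<in>J. c (r n) s / ?h n * height (\<alpha> s)) = 1" for n
  proof -
    have "(\<Sum>s\<in>J. c (r n) s / ?h n * height (\<alpha> s)) = (\<Sum>s\<in>J. c (r n) s * height (\<alpha> s)) / ?h n"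
      by (simp add: sum_divide_distrib)
    also have "(\<Sum>s\<in>J. c (r n) s * height (\<alpha> s)) = ?h n" using height_combination[of "c (r n)"] \<beta>(4) by simp
    finally show ?thesis using hpos[of "r n"] by simp
  qed
  ultimately have h1: "height (combination J e) = 1" by (simp add: LIMSEQ_const_iff height_combination)
  have "(\<lambda>n. matrix_form J gram (\<lambda>s. c (r n) s / ?h n) (\<lambda>s. c (r n) s / ?h n)) \<longlonglongrightarrow> matrix_form J gram e e"
    unfolding matrix_form_def by (intro tendsto_intros e)
  moreover have "matrix_form J gram (\<lambda>s. c (r n) s / ?h n) (\<lambda>s. c (r n) s / ?h n) = inverse (?h n) * inverse (?h n)" for n
  proof -
    have "matrix_form J gram (c (r n)) (c (r n)) = 1"
      using root_norm[OF J_sub \<beta>(1)[of "r n"]] unfolding \<beta>(4)[of "r n"] B_combinations .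
    then show ?thesis
      using matrix_form_scale[of J gram "inverse (?h n)" "c (r n)" "inverse (?h n)" "c (r n)"]
      by (simp add: divide_inverse mult.commute)
  qed
  moreover have "(\<lambda>n. inverse (?h n) * inverse (?h n)) \<longlonglongrightarrow> 0 * 0"
    using tendsto_inverse_0_at_top[OF lim] by (intro tendsto_mult)
  ultimately have "matrix_form J gram e e = 0" using LIMSEQ_unique by simp
  then have B0: "B (combination J e) (combination J e) = 0" unfolding B_combinations .
  show thesis
    by (rule that[of "\<lambda>n. \<beta> (r n)" "\<lambda>n. c (r n)" e]) (use \<beta> lim hpos e h1 B0 in auto)
qed

end

section \<open>Three roots generating a universal reflection group\<close>

text \<open>
  Semidefiniteness on the hyperplane without \<open>r\<close> leaves room for only one negative direction,
  the one of the Perron-Frobenius vector.\<close>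

locale lorentzian_subsystem = indefinite_subsystem W S m B \<alpha> \<rho> s0 J \<mu> x
  for W :: "('g, 'b) monoid_scheme" (structure) and S :: "'g set" and m :: "'g \<Rightarrow> 'g \<Rightarrow> enat"
    and B :: "'v::real_vector \<Rightarrow> 'v \<Rightarrow> real" and \<alpha> :: "'g \<Rightarrow> 'v" and \<rho> :: "'g \<Rightarrow> 'v \<Rightarrow> 'v"
    and s0 :: 'g and J :: "'g set" and \<mu> :: real and x :: "'g \<Rightarrow> real" +
  fixes r :: 'g
  assumes r: "r \<in> J" and psd: "\<not> indefinite (J - {r})"
begin

abbreviation span_J :: "'v set" where
  "span_J \<equiv> range (combination J)"

lemma B_height: "B (combination J x) v = - height v"
  by (simp add: height_def)

lemma form_frobenius_neg: "B (combination J x) (combination J x) < 0"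
proof -
  have "B (combination J x) (combination J x) = (\<Sum>s\<in>J. \<mu> * (x s)^2)"
    unfolding B_combination_right[of "combination J x"]
    by (intro sum.cong HOL.refl) (simp add: eig power2_eq_square)
  also have "\<dots> = \<mu> * (\<Sum>s\<in>J. (x s)^2)" by (simp add: sum_distrib_left)
  also have "\<dots> < 0"
  proof -
    have "x s \<noteq> 0" if "s \<in> J" for s using xpos[OF that] by simp
    then have "0 < (\<Sum>s\<in>J. (x s)^2)" using J_finite J_s0 by (intro sum_pos) auto
    with \<mu> show ?thesis by (simp add: mult_neg_pos)
  qed
  finally show ?thesis .
qed

text \<open>
  Modulo the radical, \<open>B\<close> is positive definite on the orthogonal complement of the negative
  vector \<open>z\<close>. The plane spanned by \<open>u\<close> and \<open>z\<close> meets the semidefinite hyperplane; if \<open>B\<close> is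
  nonpositive on it, the intersection is isotropic, which forces it to be spanned by \<open>u\<close>.\<close>

lemma radical_of_timelike_orthogonal:
  assumes u: "u \<in> span_J" and h: "height u = 0" and uu: "B u u \<le> 0" and t: "t \<in> J"
  shows "B u (\<alpha> t) = 0"
proof -
  obtain c where c: "u = combination J c" using u by blast
  let ?z = "combination J x"
  \<comment> \<open>Subtracting \<open>k\<close> times \<open>z\<close> kills the coordinate at \<open>r\<close>.\<close>
  define k where "k = c r / x r"
  define y where "y s = c s - k * x s" for s
  have yr: "y r = 0" using xpos[OF r] by (simp add: y_def k_def)
  have rest: "combination (J - {r}) y = combination J y"
  proof -
    have "combination J y = y r *\<^sub>R \<alpha> r + combination (J - {r}) y"
      unfolding combination_def by (rule sum.remove[OF J_finite r])
    with yr show ?thesis by simp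
  qed
  have y: "combination (J - {r}) y = u - k *\<^sub>R ?z"
    unfolding rest y_def combination_diff combination_scale c ..
  have uz: "B u ?z = 0" "B ?z u = 0" using h B_sym[of u ?z] by (simp_all add: B_height)
  have pos: "0 \<le> B (combination (J - {r}) y) (combination (J - {r}) y)"
    using psd unfolding indefinite_def B_combinations not_ex not_less by blast
  have "B (u - k *\<^sub>R ?z) (u - k *\<^sub>R ?z) = B u u + k^2 * B ?z ?z"
    using uz by (simp add: B_simps power2_eq_square)
  then have *: "0 \<le> B u u + k^2 * B ?z ?z" using pos unfolding y by simp
  have "k = 0"
  proof (rule ccontr)
    assume "k \<noteq> 0"
    then have "k^2 * B ?z ?z < 0" using form_frobenius_neg by (simp add: mult_pos_neg)
    with * uu show False by linarith
  qed
  with * uu have u0: "B u u = 0" by simp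
  have "y = c" by (rule ext) (simp add: y_def \<open>k = 0\<close>)
  then have u': "u = combination (J - {r}) c" using y \<open>k = 0\<close> by simp
  have ker: "B u (\<alpha> t) = 0" if t: "t \<in> J - {r}" for t
  proof -
    have "(\<Sum>s\<in>J - {r}. gram t s * c s) = 0"
    proof (rule psd_isotropic_kernel)
      show "0 \<le> matrix_form (J - {r}) gram y y" for y
        using psd unfolding indefinite_def not_ex not_less by blast
      show "matrix_form (J - {r}) gram c c = 0" using u0 unfolding u' B_combinations .
    qed (use J_finite B_sym t in auto)
    then have "B (\<alpha> t) (combination (J - {r}) c) = 0" unfolding B_combination_right by (simp add: mult.commute)
    then show ?thesis using u' B_sym by metis
  qed
  have "(\<Sum>s\<in>J. x s * B u (\<alpha> s)) = 0" using uz unfolding B_combination_right by simp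
  moreover have "(\<Sum>s\<in>J. x s * B u (\<alpha> s)) = x r * B u (\<alpha> r) + (\<Sum>s\<in>J - {r}. x s * B u (\<alpha> s))"
    by (rule sum.remove[OF J_finite r])
  moreover have "(\<Sum>s\<in>J - {r}. x s * B u (\<alpha> s)) = 0" using ker by simp
  ultimately have "B u (\<alpha> r) = 0" using xpos[OF r] by simp
  with ker t show ?thesis by blast
qed

text \<open>
  The isotropic vectors in the half of the light cone that contains the limits of positive
  roots.\<close>

definition future :: "'v set" where
  "future = {v \<in> span_J. B v v = 0 \<and> 0 < height v}"

text \<open>
  The reverse Cauchy-Schwarz inequality: after scaling \<open>v\<close> to the height of \<open>w\<close>, the
  difference is orthogonal to \<open>z\<close> and has norm at most \<open>0\<close>, so it lies in the radical.\<close>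

lemma future_pair:
  assumes v: "v \<in> future" and w: "w \<in> future" and vw: "0 \<le> B v w" and t: "t \<in> J"
  shows "B (w - (height w / height v) *\<^sub>R v) (\<alpha> t) = 0" and "B v w = 0"
proof -
  define k where "k = height w / height v"
  have hv: "height v > 0" "height w > 0" "B v v = 0" "B w w = 0" using v w by (auto simp: future_def)
  then have k: "k > 0" by (simp add: k_def)
  have span: "w - k *\<^sub>R v \<in> span_J"
    using combination_range_closed[of w J v "- k"] v w by (simp add: future_def)
  have "B (w - k *\<^sub>R v) (w - k *\<^sub>R v) = - 2 * k * B v w"
    using hv B_sym[of w v] by (simp add: B_simps)
  also have "\<dots> \<le> 0" using k vw by (simp add: mult_nonneg_nonneg)
  finally have le: "B (w - k *\<^sub>R v) (w - k *\<^sub>R v) \<le> 0" .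
  have h0: "height (w - k *\<^sub>R v) = 0" using hv by (simp add: height_linear k_def)
  have rad: "B (w - k *\<^sub>R v) (\<alpha> t) = 0" if "t \<in> J" for t
    by (rule radical_of_timelike_orthogonal[OF span h0 le that])
  then show "B (w - (height w / height v) *\<^sub>R v) (\<alpha> t) = 0" using t by (simp add: k_def)
  have "B (w - k *\<^sub>R v) v = 0"
    by (rule orthogonal_to_combination[OF rad]) (use v in \<open>auto simp: future_def\<close>)
  then show "B v w = 0" using hv B_sym[of w v] by (simp add: B_simps)
qed

text \<open>
  The product of \<open>v\<close> with its mirror image is \<open>- 2 * (B v (\<alpha> t))^2\<close>. If it is zero, nothing
  moves; if it is negative, both vectors are in the same half of the light cone.\<close>

lemma future_refl:
  assumes v: "v \<in> future" and t: "t \<in> J"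
  shows "refl_in (\<alpha> t) v \<in> future"
proof -
  let ?w = "refl_in (\<alpha> t) v"
  have tS: "t \<in> S" using t J_sub by blast
  have v': "v \<in> span_J" "B v v = 0" "0 < height v" using v by (auto simp: future_def)
  have w: "?w \<in> span_J" "B ?w ?w = 0"
    using combination_range_refl[OF J_finite t v'(1)] B_refl_in[OF B_simple_self[OF tS]] v' by auto
  have vw: "B ?w v = - 2 * (B v (\<alpha> t))^2"
    using v' B_sym[of "\<alpha> t" v] by (simp add: refl_in_def B_simps power2_eq_square)
  have "0 < height ?w"
  proof (cases "B v (\<alpha> t) = 0")
    case True
    then show ?thesis using v' by (simp add: refl_in_def)
  next
    case False
    then have neg: "B ?w v < 0" unfolding vw by simp
    show ?thesis
    proof (rule ccontr)
      assume h: "\<not> 0 < height ?w"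
      define k where "k = - height ?w / height v"
      have k: "0 \<le> k" unfolding k_def using h v'(3) by (intro divide_nonneg_pos) auto
      have span: "?w + k *\<^sub>R v \<in> span_J" by (rule combination_range_closed[OF w(1) v'(1)])
      have h0: "height (?w + k *\<^sub>R v) = 0" using v' by (simp add: height_linear k_def)
      have "B (?w + k *\<^sub>R v) (?w + k *\<^sub>R v) = 2 * k * B ?w v"
        using w(2) v'(2) B_sym[of v ?w] by (simp add: B_simps)
      also have "\<dots> \<le> 0" using k neg by (simp add: mult_nonneg_nonpos)
      finally have le: "B (?w + k *\<^sub>R v) (?w + k *\<^sub>R v) \<le> 0" .
      have "B (?w + k *\<^sub>R v) v = 0"
        by (rule orthogonal_to_combination[OF radical_of_timelike_orthogonal[OF span h0 le] v'(1)])
      then show False using neg v'(2) by (simp add: B_simps)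
    qed
  qed
  with w show ?thesis by (simp add: future_def)
qed

lemma future_act: "us \<in> lists J \<Longrightarrow> v \<in> future \<Longrightarrow> act us v \<in> future"
  by (induction us) (auto intro: future_refl)

text \<open>
  Some reflection moves \<open>\<eta>\<close>, to \<open>\<zeta>\<close> say. If every ray of the orbit were equivalent to that of
  \<open>\<eta>\<close> or of \<open>\<zeta>\<close> modulo the radical, each simple reflection would either fix both vectors or
  carry \<open>\<eta>\<close> to a multiple of \<open>\<zeta>\<close>. In the second case the simple root lies in their plane
  modulo the radical, and by connectedness the second case holds for all of them. A unit
  vector of this plane has coordinates \<open>p, q\<close> of opposite signs, and two unit vectors with the
  same sign pattern have positive product. There are only two sign patterns, but at least
  three simple roots with nonpositive products.\<close>

theorem three_independent_future_directions:
  assumes \<eta>: "\<eta> \<in> future" and card: "3 \<le> card J"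
  shows "\<exists>us vs ws. us \<in> lists J \<and> vs \<in> lists J \<and> ws \<in> lists J \<and>
    B (act us \<eta>) (act vs \<eta>) < 0 \<and> B (act us \<eta>) (act ws \<eta>) < 0 \<and> B (act vs \<eta>) (act ws \<eta>) < 0"
proof (rule ccontr)
  assume no: "\<not> ?thesis"
  have e: "\<eta> \<in> span_J" "B \<eta> \<eta> = 0" "0 < height \<eta>" using \<eta> by (auto simp: future_def)
  have "\<exists>i\<in>J. B \<eta> (\<alpha> i) \<noteq> 0"
  proof (rule ccontr)
    assume "\<not> ?thesis"
    then have "height \<eta> = 0" by (simp add: height_eq_sum)
    with e show False by simp
  qed
  then obtain i where i: "i \<in> J" "B \<eta> (\<alpha> i) \<noteq> 0" by blast
  define \<zeta> where "\<zeta> = refl_in (\<alpha> i) \<eta>"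
  have \<zeta>: "\<zeta> \<in> future" unfolding \<zeta>_def by (rule future_refl[OF \<eta> i(1)])
  have z: "\<zeta> \<in> span_J" "B \<zeta> \<zeta> = 0" "0 < height \<zeta>" using \<zeta> by (auto simp: future_def)
  define \<kappa> where "\<kappa> = B \<eta> \<zeta>"
  have "\<kappa> = - 2 * (B \<eta> (\<alpha> i))^2"
    using e by (simp add: \<kappa>_def \<zeta>_def refl_in_def B_simps power2_eq_square)
  then have \<kappa>: "\<kappa> < 0" using i by simp
  have \<kappa>': "B \<zeta> \<eta> = \<kappa>" by (simp add: \<kappa>_def B_sym)
  have alt: "B \<eta> (act us \<eta>) = 0 \<or> B \<zeta> (act us \<eta>) = 0" if us: "us \<in> lists J" for us
  proof (rule ccontr)
    assume *: "\<not> ?thesis"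
    have f: "act us \<eta> \<in> future" by (rule future_act[OF us \<eta>])
    have "B \<eta> (act us \<eta>) < 0" "B \<zeta> (act us \<eta>) < 0"
      using * future_pair(2)[OF \<eta> f _ i(1)] future_pair(2)[OF \<zeta> f _ i(1)] by (auto simp: not_le[symmetric])
    moreover have "act [] \<eta> = \<eta>" "act [i] \<eta> = \<zeta>" by (simp_all add: \<zeta>_def)
    moreover have "[] \<in> lists J" "[i] \<in> lists J" using i(1) by auto
    ultimately show False using no us \<kappa> unfolding \<kappa>_def by metis
  qed
  define orth where "orth j \<longleftrightarrow> B \<eta> (\<alpha> j) = 0 \<and> B \<zeta> (\<alpha> j) = 0" for j
  have plane: "\<exists>p q. \<forall>t\<in>J. B (\<alpha> j - (p *\<^sub>R \<eta> + q *\<^sub>R \<zeta>)) (\<alpha> t) = 0" if j: "j \<in> J" "\<not> orth j" for j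
  proof -
    have jS: "B (\<alpha> j) (\<alpha> j) = 1" using j J_sub B_simple_self by blast
    have c: "B \<eta> (\<alpha> j) \<noteq> 0"
    proof
      assume c: "B \<eta> (\<alpha> j) = 0"
      have "B \<eta> (refl_in (\<alpha> j) \<zeta>) = B \<eta> \<zeta>" using c by (simp add: refl_in_def B_simps)
      then have "B \<eta> (act [j, i] \<eta>) \<noteq> 0" using \<kappa> by (simp add: \<kappa>_def \<zeta>_def)
      then have "B \<zeta> (act [j, i] \<eta>) = 0" using alt[of "[j, i]"] i j by auto
      then have "(B \<zeta> (\<alpha> j))^2 = 0" using z B_sym[of "\<alpha> j" \<zeta>]
        by (simp add: \<zeta>_def[symmetric] refl_in_def[of "\<alpha> j"] B_simps power2_eq_square)
      with c j show False by (simp add: orth_def)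
    qed
    define w where "w = refl_in (\<alpha> j) \<eta>"
    have w: "w \<in> future" unfolding w_def by (rule future_refl[OF \<eta> j(1)])
    have "B \<eta> w \<noteq> 0" using c e B_sym[of "\<alpha> j" \<eta>] by (simp add: w_def refl_in_def B_simps)
    then have "B \<zeta> w = 0" using alt[of "[j]"] j by (simp add: w_def)
    define k where "k = height w / height \<zeta>"
    define b where "b = B \<eta> (\<alpha> j)"
    have rad: "B (w - k *\<^sub>R \<zeta>) (\<alpha> t) = 0" if "t \<in> J" for t
      unfolding k_def using future_pair(1)[OF \<zeta> w _ that] \<open>B \<zeta> w = 0\<close> by simp
    have b: "b \<noteq> 0" using c by (simp add: b_def)
    have "B (\<alpha> j - ((1 / (2 * b)) *\<^sub>R \<eta> + (- k / (2 * b)) *\<^sub>R \<zeta>)) (\<alpha> t) = 0" if t: "t \<in> J" for t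
    proof -
      have "B \<eta> (\<alpha> t) - 2 * b * gram j t - k * B \<zeta> (\<alpha> t) = 0"
        using rad[OF t] by (simp add: w_def refl_in_def B_simps b_def)
      then have "gram j t = (B \<eta> (\<alpha> t) - k * B \<zeta> (\<alpha> t)) / (2 * b)" using b by (simp add: field_simps)
      then show ?thesis by (simp add: B_simps diff_divide_distrib)
    qed
    then show ?thesis by blast
  qed
  have all: "\<not> orth j" if j: "j \<in> J" for j
  proof -
    define J1 where "J1 = {j\<in>J. \<not> orth j}"
    have "J1 = J"
    proof (rule ccontr)
      assume "J1 \<noteq> J"
      moreover have "i \<in> J1" using i by (simp add: J1_def orth_def)
      ultimately obtain s t where st: "s \<in> J1" "t \<in> J - J1" "m s t \<noteq> 2"
        using grown_connected[OF J, of J1] unfolding J1_def by blast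
      then have "s \<in> S" "t \<in> S" "s \<noteq> t" using J_sub by (auto simp: J1_def)
      then have "gram s t \<noteq> 0" using gram_zero_iff st by blast
      moreover obtain p q where "B (\<alpha> s - (p *\<^sub>R \<eta> + q *\<^sub>R \<zeta>)) (\<alpha> t) = 0"
        using plane[of s] st by (auto simp: J1_def)
      moreover have "B \<eta> (\<alpha> t) = 0" "B \<zeta> (\<alpha> t) = 0" using st by (auto simp: J1_def orth_def)
      ultimately show False by (simp add: B_simps)
    qed
    with j show ?thesis by (auto simp: J1_def)
  qed
  have "\<forall>j\<in>J. \<exists>p q. \<forall>t\<in>J. B (\<alpha> j - (p *\<^sub>R \<eta> + q *\<^sub>R \<zeta>)) (\<alpha> t) = 0" using plane all by blast
  then obtain p q where pq: "\<And>j t. j \<in> J \<Longrightarrow> t \<in> J \<Longrightarrow> B (\<alpha> j - (p j *\<^sub>R \<eta> + q j *\<^sub>R \<zeta>)) (\<alpha> t) = 0"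
    by metis
  have pe: "B (\<alpha> j) \<eta> = q j * \<kappa>" "B (\<alpha> j) \<zeta> = p j * \<kappa>" if j: "j \<in> J" for j
    using orthogonal_to_combination[OF pq[OF j] e(1)] orthogonal_to_combination[OF pq[OF j] z(1)] e(2) z(2) \<kappa>'
    by (simp_all add: B_simps \<kappa>_def[symmetric])
  have gram_pq: "gram j k = \<kappa> * (p j * q k + q j * p k)" if "j \<in> J" "k \<in> J" for j k
    using pq[OF that] pe[OF that(2)] B_sym[of \<eta> "\<alpha> k"] B_sym[of \<zeta> "\<alpha> k"]
    by (simp add: B_simps algebra_simps)
  have opp: "p j * q j < 0" if j: "j \<in> J" for j
  proof -
    have "\<kappa> * (2 * (p j * q j)) = 1"
      using gram_pq[OF j j] B_simple_self[of j] j J_sub by (auto simp: mult_ac)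
    then show ?thesis using \<kappa> by (smt (verit) mult_nonpos_nonneg)
  qed
  have cross: "0 \<le> p j * q k + q j * p k" if "j \<in> J" "k \<in> J" "j \<noteq> k" for j k
  proof -
    have "\<kappa> * (p j * q k + q j * p k) \<le> 0"
      using gram_pq[of j k] B_simple_nonpos[of j k] that J_sub by auto
    then show ?thesis using \<kappa> by (simp add: mult_le_0_iff)
  qed
  have same: False if jk: "j \<in> J" "k \<in> J" "j \<noteq> k" "(0 < p j) = (0 < p k)" for j k
  proof (cases "0 < p j")
    case True
    then have "q j < 0" "q k < 0" "0 < p k" using opp[OF jk(1)] opp[OF jk(2)] jk(4) by (auto simp: mult_less_0_iff)
    with True have "p j * q k < 0" "q j * p k < 0" by (auto simp: mult_pos_neg mult_neg_pos)
    with cross[OF jk(1-3)] show False by linarith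
  next
    case False
    then have "p j < 0" "p k < 0" "0 < q j" "0 < q k" using opp[OF jk(1)] opp[OF jk(2)] jk(4) by (auto simp: mult_less_0_iff)
    then have "p j * q k < 0" "q j * p k < 0" by (auto simp: mult_pos_neg mult_neg_pos)
    with cross[OF jk(1-3)] show False by linarith
  qed
  obtain a b c where abc: "a \<in> J" "b \<in> J" "c \<in> J" "a \<noteq> b" "b \<noteq> c" "a \<noteq> c"
    using card by (metis card_3_iff card_le_Suc_iff obtain_subset_with_card_n insert_subset)
  with same show False by metis
qed

text \<open>
  Apply the three words to one root \<open>\<beta>\<close> of great height close to the ray of \<open>\<eta>\<close>. The products
  grow like the square of the height times negative numbers. The height also decides the signs
  of the three roots.\<close>

theorem three_universal_roots:
  assumes card: "3 \<le> card J"
  obtains a b c where "a \<in> root_set J \<inter> cone J" "b \<in> root_set J \<inter> cone J" "c \<in> root_set J \<inter> cone J"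
    "B a b \<le> - 1" "B a c \<le> - 1" "B b c \<le> - 1"
proof -
  obtain \<beta> c e where "\<forall>n. \<beta> n \<in> root_set J \<and> 0 < height (\<beta> n) \<and> \<beta> n = combination J (c n)"
    "filterlim (\<lambda>n. height (\<beta> n)) at_top sequentially"
    "\<forall>s\<in>J. (\<lambda>n. c n s / height (\<beta> n)) \<longlonglongrightarrow> e s"
    and e: "height (combination J e) = 1" "B (combination J e) (combination J e) = 0"
    using isotropic_limit_of_roots .
  then have \<beta>: "\<And>n. \<beta> n \<in> root_set J" "filterlim (\<lambda>n. height (\<beta> n)) at_top sequentially"
    "\<And>n. 0 < height (\<beta> n)" "\<And>n. \<beta> n = combination J (c n)"
    and lim: "\<And>s. s \<in> J \<Longrightarrow> (\<lambda>n. c n s / height (\<beta> n)) \<longlonglongrightarrow> e s"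
    by blast+
  define \<eta> where "\<eta> = combination J e"
  define h where "h n = height (\<beta> n)" for n
  have h: "filterlim h at_top sequentially" "\<And>n. 0 < h n" using \<beta> by (simp_all add: h_def[abs_def])
  have \<eta>: "\<eta> \<in> future" using e by (simp add: future_def \<eta>_def)
  obtain us vs ws where w: "us \<in> lists J" "vs \<in> lists J" "ws \<in> lists J"
    "B (act us \<eta>) (act vs \<eta>) < 0" "B (act us \<eta>) (act ws \<eta>) < 0" "B (act vs \<eta>) (act ws \<eta>) < 0"
    using three_independent_future_directions[OF \<eta> card] by blast
  have far: "\<forall>\<^sub>F n in sequentially. B (act us (\<beta> n)) (act vs (\<beta> n)) \<le> - 1"
    if neg: "B (act us \<eta>) (act vs \<eta>) < 0" for us vs
  proof -
    let ?A = "\<lambda>s t. B (act us (\<alpha> s)) (act vs (\<alpha> t))"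
    have "(\<lambda>n. matrix_form J ?A (\<lambda>s. c n s / h n) (\<lambda>s. c n s / h n)) \<longlonglongrightarrow> matrix_form J ?A e e"
      unfolding matrix_form_def h_def by (intro tendsto_intros lim)
    moreover have "matrix_form J ?A e e < 0" using neg unfolding \<eta>_def B_act_combinations .
    ultimately have "filterlim (\<lambda>n. matrix_form J ?A (\<lambda>s. c n s / h n) (\<lambda>s. c n s / h n) * (h n * h n)) at_bot sequentially"
      by (rule filterlim_tendsto_neg_mult_at_bot) (rule filterlim_at_top_mult_at_top[OF h(1) h(1)])
    moreover have "matrix_form J ?A (\<lambda>s. c n s / h n) (\<lambda>s. c n s / h n) * (h n * h n)
        = B (act us (\<beta> n)) (act vs (\<beta> n))" for n
    proof -
      have "matrix_form J ?A (\<lambda>s. c n s / h n) (\<lambda>s. c n s / h n)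
          = inverse (h n) * inverse (h n) * matrix_form J ?A (c n) (c n)"
        using matrix_form_scale[of J ?A "inverse (h n)" "c n" "inverse (h n)" "c n"]
        by (simp add: divide_inverse mult.commute)
      moreover have "inverse (h n) * inverse (h n) * (h n * h n) = 1"
        using h(2)[of n] by (simp add: field_simps)
      ultimately show ?thesis unfolding \<beta>(4)[of n] B_act_combinations by (simp add: mult_ac)
    qed
    ultimately have "filterlim (\<lambda>n. B (act us (\<beta> n)) (act vs (\<beta> n))) at_bot sequentially" by simp
    then show ?thesis unfolding filterlim_at_bot by blast
  qed
  have pos: "\<forall>\<^sub>F n in sequentially. act us (\<beta> n) \<in> root_set J \<inter> cone J" if us: "us \<in> lists J" for us
  proof -
    have "height (act us \<eta>) > 0" using future_act[OF us \<eta>] by (simp add: future_def)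
    moreover have "(\<lambda>n. \<Sum>s\<in>J. c n s / h n * height (act us (\<alpha> s))) \<longlonglongrightarrow> (\<Sum>s\<in>J. e s * height (act us (\<alpha> s)))"
      unfolding h_def by (intro tendsto_intros lim)
    moreover have H: "height (act us (combination J y)) = (\<Sum>s\<in>J. y s * height (act us (\<alpha> s)))" for y
      unfolding act_combination height_def B_sum_right by (simp add: B_simps sum_negf)
    ultimately have "\<forall>\<^sub>F n in sequentially. 0 < (\<Sum>s\<in>J. c n s / h n * height (act us (\<alpha> s)))"
      unfolding \<eta>_def H by (intro order_tendstoD(1)) auto
    then show ?thesis
    proof (rule eventually_mono)
      fix n assume *: "0 < (\<Sum>s\<in>J. c n s / h n * height (act us (\<alpha> s)))"
      have "(\<Sum>s\<in>J. c n s / h n * height (act us (\<alpha> s))) = height (act us (\<beta> n)) / h n"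
        unfolding \<beta>(4)[of n] H by (simp add: sum_divide_distrib)
      with * h(2)[of n] have hp: "0 < height (act us (\<beta> n))" by (simp add: zero_less_divide_iff)
      have root: "act us (\<beta> n) \<in> root_set J" by (rule act_root[OF \<beta>(1) us])
      have "\<not> - act us (\<beta> n) \<in> cone J" using height_cone[of "- act us (\<beta> n)"] hp by (auto simp: height_linear)
      with root_sign[OF J_sub root] root show "act us (\<beta> n) \<in> root_set J \<inter> cone J" by blast
    qed
  qed
  have "\<forall>\<^sub>F n in sequentially. act us (\<beta> n) \<in> root_set J \<inter> cone J \<and> act vs (\<beta> n) \<in> root_set J \<inter> cone J
      \<and> act ws (\<beta> n) \<in> root_set J \<inter> cone J \<and> B (act us (\<beta> n)) (act vs (\<beta> n)) \<le> - 1
      \<and> B (act us (\<beta> n)) (act ws (\<beta> n)) \<le> - 1 \<and> B (act vs (\<beta> n)) (act ws (\<beta> n)) \<le> - 1"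
    using w by (intro eventually_conj pos far)
  then obtain n where "act us (\<beta> n) \<in> root_set J \<inter> cone J \<and> act vs (\<beta> n) \<in> root_set J \<inter> cone J
      \<and> act ws (\<beta> n) \<in> root_set J \<inter> cone J \<and> B (act us (\<beta> n)) (act vs (\<beta> n)) \<le> - 1
      \<and> B (act us (\<beta> n)) (act ws (\<beta> n)) \<le> - 1 \<and> B (act vs (\<beta> n)) (act ws (\<beta> n)) \<le> - 1"
    unfolding eventually_sequentially by blast
  then show thesis using that by blast
qed

end

section \<open>Chains of type \<open>\<omega> + \<omega>\<^sup>*\<close> from dihedral subgroups\<close>

text \<open>
  The relation is a total order on \<open>P\<close> only, so that the sorting functions for linearly
  ordered types do not apply.\<close>

lemma sorted_enumeration:
  assumes "finite X" "X \<subseteq> P" "transp_on P lt" "totalp_on P lt"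
  shows "\<exists>xs. sorted_wrt lt xs \<and> set xs = X"
  using assms(1,2)
proof (induction X rule: finite_induct)
  case (insert a X)
  then obtain xs where xs: "sorted_wrt lt xs" "set xs = X" by auto
  let ?l = "filter (\<lambda>y. lt y a) xs" and ?g = "filter (\<lambda>y. lt a y) xs"
  have "set (?l @ a # ?g) = insert a X"
    using xs(2) insert.hyps insert.prems totalp_onD[OF assms(4), of a] by auto
  moreover have "sorted_wrt lt (?l @ a # ?g)"
  proof -
    have "lt y z" if "y \<in> X" "z \<in> X" "lt y a" "lt a z" for y z
      using transp_onD[OF assms(3) _ _ _ that(3,4)] that insert.prems by auto
    then show ?thesis using xs by (auto simp: sorted_wrt_append sorted_wrt_filter)
  qed
  ultimately show ?case by blast
qed (auto intro: exI[of _ "[]"])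

lemma copies_less_total: "p \<noteq> q \<Longrightarrow> copies_less p q \<or> copies_less q p"
proof -
  assume "p \<noteq> q"
  have "omega_omega_star_less a b \<or> omega_omega_star_less b a" if "a \<noteq> b" for a b
    using that by (cases a; cases b) auto
  with \<open>p \<noteq> q\<close> show ?thesis unfolding copies_less_def by (metis linorder_neqE_nat prod_eqI)
qed

text \<open>
  It suffices to preserve the strict order: it is total on the source, and irreflexive and
  transitive on the target.\<close>

lemma copies_embedding:
  assumes lt: "irreflp_on P lt" "transp_on P lt"
    and u: "\<And>i n. i < k \<Longrightarrow> u i n \<in> P" and v: "\<And>i n. i < k \<Longrightarrow> v i n \<in> P"
    and uu: "\<And>i n. i < k \<Longrightarrow> lt (u i n) (u i (Suc n))"
    and vv: "\<And>i n. i < k \<Longrightarrow> lt (v i (Suc n)) (v i n)"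
    and uv: "\<And>i n n'. i < k \<Longrightarrow> lt (u i n) (v i n')"
    and sep: "\<And>i j a b. i < j \<Longrightarrow> j < k \<Longrightarrow> a \<in> range (u i) \<union> range (v i) \<Longrightarrow> b \<in> range (u j) \<union> range (v j) \<Longrightarrow> lt a b"
  shows "\<exists>E\<subseteq>P. has_type_omega_omega_star_copies k E lt"
proof -
  define f where "f p = (case snd p of Inl n \<Rightarrow> u (fst p) n | Inr n \<Rightarrow> v (fst p) n)" for p :: "nat \<times> (nat + nat)"
  let ?D = "{..<k} \<times> (UNIV :: (nat + nat) set)"
  have fP: "f p \<in> P" if "p \<in> ?D" for p
    using that u v by (cases "snd p") (auto simp: f_def)
  have umono: "lt (u i n) (u i n')" if "i < k" "n < n'" for i n n'
    using \<open>n < n'\<close>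
  proof (induction n')
    case (Suc n')
    then show ?case using uu[OF that(1)] transp_onD[OF lt(2)] u[OF that(1)] less_Suc_eq by metis
  qed simp
  have vmono: "lt (v i n') (v i n)" if "i < k" "n < n'" for i n n'
    using \<open>n < n'\<close>
  proof (induction n')
    case (Suc n')
    then show ?case using vv[OF that(1)] transp_onD[OF lt(2)] v[OF that(1)] less_Suc_eq by metis
  qed simp
  have mono: "lt (f p) (f q)" if pq: "p \<in> ?D" "q \<in> ?D" "copies_less p q" for p q
  proof -
    obtain i a j b where ij: "p = (i, a)" "q = (j, b)" by (cases p; cases q)
    have k: "i < k" "j < k" using pq ij by auto
    show ?thesis
    proof (cases "i < j")
      case True
      moreover have "f p \<in> range (u i) \<union> range (v i)" "f q \<in> range (u j) \<union> range (v j)"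
        unfolding f_def ij by (auto split: sum.splits)
      ultimately show ?thesis using sep k by blast
    next
      case False
      then have "i = j" "omega_omega_star_less a b" using pq(3) ij by (auto simp: copies_less_def)
      then show ?thesis using k umono vmono uv unfolding f_def ij by (cases a; cases b) auto
    qed
  qed
  have irr: "\<not> lt (f p) (f p)" if "p \<in> ?D" for p using irreflp_onD[OF lt(1) fP[OF that]] .
  have "inj_on f ?D"
  proof (rule inj_onI, rule ccontr)
    fix p q assume pq: "p \<in> ?D" "q \<in> ?D" "f p = f q" "p \<noteq> q"
    then show False using copies_less_total[OF pq(4)] mono[of p q] mono[of q p] irr[of p] irr[of q] by metis
  qed
  then have "bij_betw f ?D (f ` ?D)" by (rule inj_on_imp_bij_betw)
  moreover have "copies_less p q \<longleftrightarrow> lt (f p) (f q)" if pq: "p \<in> ?D" "q \<in> ?D" for p q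
  proof
    assume l: "lt (f p) (f q)"
    show "copies_less p q"
    proof (rule ccontr)
      assume n: "\<not> copies_less p q"
      show False
      proof (cases "p = q")
        case True
        with l irr[OF pq(1)] show False by simp
      next
        case False
        with n copies_less_total[OF False] have "lt (f q) (f p)" using mono[OF pq(2,1)] by blast
        with l have "lt (f p) (f p)" using transp_onD[OF lt(2) fP[OF pq(1)] fP[OF pq(2)] fP[OF pq(1)]] by blast
        with irr[OF pq(1)] show False by simp
      qed
    qed
  qed (rule mono[OF pq])
  ultimately have "has_type_omega_omega_star_copies k (f ` ?D) lt"
    unfolding has_type_omega_omega_star_copies_def order_isomorphic_def by blast
  moreover have "f ` ?D \<subseteq> P" using fP by blast
  ultimately show ?thesis by blast
qed

context root_basis
begin

lemma three_roots_of_indefinite: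
  assumes K: "grown s0 K" "indefinite K" "3 \<le> card K"
  obtains X where "finite X" "X \<subseteq> root_set S \<inter> cone S" "3 \<le> card X"
    "\<forall>a\<in>X. \<forall>b\<in>X. a \<noteq> b \<longrightarrow> B a b \<le> - 1"
proof -
  obtain J where J: "grown s0 J" "3 \<le> card J" "indefinite J"
    and alt: "(\<exists>s\<in>J. \<not> indefinite (J - {s})) \<or> (\<forall>a\<in>J. \<forall>b\<in>J. a \<noteq> b \<longrightarrow> gram a b \<le> - 1)"
    using indefinite_with_psd_hyperplane[OF K] by blast
  have f: "finite J" "J \<subseteq> S" using grown_finite[OF J(1)] by auto
  have sub: "root_set J \<inter> cone J \<subseteq> root_set S \<inter> cone S"
    using root_set_mono[OF f(2)] cone_mono[OF f(2)] by blast
  from alt show thesis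
  proof
    assume "\<forall>a\<in>J. \<forall>b\<in>J. a \<noteq> b \<longrightarrow> gram a b \<le> - 1"
    then have "\<forall>a\<in>\<alpha> ` J. \<forall>b\<in>\<alpha> ` J. a \<noteq> b \<longrightarrow> B a b \<le> - 1" by auto
    moreover have "card (\<alpha> ` J) = card J" using card_image inj_on_subset[OF \<alpha>_inj f(2)] by blast
    moreover have "\<alpha> ` J \<subseteq> root_set J \<inter> cone J" using simple_in_root_set cone_simple by auto
    then have "\<alpha> ` J \<subseteq> root_set S \<inter> cone S" using sub by (rule order_trans)
    ultimately show thesis using that[of "\<alpha> ` J"] f J by simp
  next
    assume "\<exists>s\<in>J. \<not> indefinite (J - {s})"
    then obtain r where r: "r \<in> J" "\<not> indefinite (J - {r})" by blast
    obtain \<mu> x where x: "\<forall>s\<in>J. 0 < x s" "\<forall>s\<in>J. B (combination J x) (\<alpha> s) = \<mu> * x s"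
      "\<forall>y. \<mu> * (\<Sum>s\<in>J. (y s)^2) \<le> matrix_form J gram y y" using grown_frobenius[OF J(1)] .
    have "\<mu> < 0"
    proof (rule ccontr)
      assume "\<not> \<mu> < 0"
      then have "0 \<le> \<mu> * (\<Sum>s\<in>J. (y s)^2)" for y by (intro mult_nonneg_nonneg sum_nonneg) auto
      then show False using x(3) J(3) unfolding indefinite_def by (meson not_le order_trans)
    qed
    then interpret L: lorentzian_subsystem W S m B \<alpha> \<rho> s0 J \<mu> x r
      by unfold_locales (use J(1) x r in auto)
    obtain a b c where abc: "a \<in> root_set J \<inter> cone J" "b \<in> root_set J \<inter> cone J" "c \<in> root_set J \<inter> cone J"
      "B a b \<le> - 1" "B a c \<le> - 1" "B b c \<le> - 1" using L.three_universal_roots[OF J(2)] .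
    have n: "B a a = 1" "B b b = 1" "B c c = 1" using abc root_norm[OF f(2)] by auto
    then have "a \<noteq> b" "a \<noteq> c" "b \<noteq> c" using abc by auto
    then have "card {a, b, c} = 3" by simp
    moreover have "\<forall>p\<in>{a, b, c}. \<forall>q\<in>{a, b, c}. p \<noteq> q \<longrightarrow> B p q \<le> - 1"
      using abc B_sym[of b a] B_sym[of c a] B_sym[of c b] by auto
    ultimately show thesis using that[of "{a, b, c}"] abc sub by auto
  qed
qed

text \<open>
  For \<open>a, b\<close> different from \<open>c\<close> the product of \<open>a\<close> with the mirror image of \<open>b\<close> is
  \<open>B a b - 2 * B a c * B b c \<le> 1 - 2\<close>, also for \<open>a = b\<close>. Of \<open>n\<close> members \<open>2 * (n - 1)\<close> are
  obtained, which exceeds \<open>n\<close> from \<open>n = 3\<close> on.\<close>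

lemma universal_family_doubling:
  assumes X: "finite X" "X \<subseteq> root_set S \<inter> cone S" "3 \<le> card X"
    "\<forall>a\<in>X. \<forall>b\<in>X. a \<noteq> b \<longrightarrow> B a b \<le> - 1"
  shows "\<exists>Y. finite Y \<and> Y \<subseteq> root_set S \<inter> cone S \<and> card X < card Y \<and>
    (\<forall>a\<in>Y. \<forall>b\<in>Y. a \<noteq> b \<longrightarrow> B a b \<le> - 1)"
proof -
  obtain c where c: "c \<in> X" using X(3) by fastforce
  define Z where "Z = X - {c}"
  have norm: "B a a = 1" if "a \<in> X" for a using root_norm[of S a] that X by auto
  have Zc: "B a c \<le> - 1" if "a \<in> Z" for a using X(4) c that by (auto simp: Z_def)
  have ZZ: "B a b \<le> 1" if "a \<in> Z" "b \<in> Z" for a b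
  proof (cases "a = b")
    case True
    then show ?thesis using norm that by (simp add: Z_def)
  next
    case False
    then have "B a b \<le> - 1" using X(4) that by (auto simp: Z_def)
    then show ?thesis by simp
  qed
  have cross: "B a (refl_in c b) \<le> - 1" if "a \<in> Z" "b \<in> Z" for a b
  proof -
    have "1 * 1 \<le> (- B a c) * (- B b c)" using Zc[OF that(1)] Zc[OF that(2)] by (intro mult_mono) auto
    then have "1 \<le> B a c * B b c" by simp
    moreover have "B a (refl_in c b) = B a b - 2 * (B a c * B b c)" by (simp add: refl_in_def B_simps)
    ultimately show ?thesis using ZZ[OF that] by linarith
  qed
  have pos: "refl_in c b \<in> root_set S \<inter> cone S" if b: "b \<in> Z" for b
  proof
    show "refl_in c b \<in> root_set S" using refl_in_root[of S c b] c b X by (auto simp: Z_def)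
    have eq: "refl_in c b = b + (- 2 * B b c) *\<^sub>R c" by (simp add: refl_in_def)
    have "0 \<le> - 2 * B b c" using Zc[OF b] by simp
    moreover have "b \<in> cone S" "c \<in> cone S" using b c X by (auto simp: Z_def)
    ultimately show "refl_in c b \<in> cone S" unfolding eq by (intro cone_add cone_scale)
  qed
  have "inj_on (refl_in c) Z" by (rule inj_on_inverseI[of _ "refl_in c"]) (rule refl_in_invol[OF norm[OF c]])
  then have card_im: "card (refl_in c ` Z) = card Z" by (rule card_image)
  have disj: "Z \<inter> refl_in c ` Z = {}"
  proof (rule equals0I)
    fix a assume "a \<in> Z \<inter> refl_in c ` Z"
    then obtain b where "a \<in> Z" "b \<in> Z" "a = refl_in c b" by blast
    then have "B a a \<le> - 1" using cross by metis
    then show False using norm \<open>a \<in> Z\<close> by (simp add: Z_def)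
  qed
  define Y where "Y = Z \<union> refl_in c ` Z"
  have "card Z = card X - 1" using X c by (simp add: Z_def)
  then have "card X < card Y" using X(1,3) card_im disj
    by (simp add: Y_def card_Un_disjoint Z_def)
  moreover have "\<forall>a\<in>Y. \<forall>b\<in>Y. a \<noteq> b \<longrightarrow> B a b \<le> - 1"
  proof (intro ballI impI)
    fix a b assume ab: "a \<in> Y" "b \<in> Y" "a \<noteq> b"
    have ZZ': "B p q \<le> - 1" if "p \<in> Z" "q \<in> Z" "p \<noteq> q" for p q using X(4) that by (auto simp: Z_def)
    consider "a \<in> Z" "b \<in> Z" | p where "p \<in> Z" "a = refl_in c p" "b \<in> Z"
      | q where "a \<in> Z" "q \<in> Z" "b = refl_in c q" | p q where "p \<in> Z" "q \<in> Z" "a = refl_in c p" "b = refl_in c q"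
      using ab unfolding Y_def by blast
    then show "B a b \<le> - 1"
    proof cases
      case 1
      then show ?thesis using ZZ' ab by blast
    next
      case 2
      then show ?thesis using cross B_sym[of a b] by auto
    next
      case 3
      then show ?thesis using cross by auto
    next
      case 4
      then have "p \<noteq> q" using ab by blast
      then show ?thesis using ZZ' 4 B_refl_in[OF norm[OF c]] by auto
    qed
  qed
  moreover have "finite Y" "Y \<subseteq> root_set S \<inter> cone S" using X pos by (auto simp: Y_def Z_def)
  ultimately show ?thesis by blast
qed

lemma large_universal_family:
  assumes X: "finite X" "X \<subseteq> root_set S \<inter> cone S" "3 \<le> card X"
    "\<forall>a\<in>X. \<forall>b\<in>X. a \<noteq> b \<longrightarrow> B a b \<le> - 1"
  shows "\<exists>Y. finite Y \<and> Y \<subseteq> root_set S \<inter> cone S \<and> n + 3 \<le> card Y \<and>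
    (\<forall>a\<in>Y. \<forall>b\<in>Y. a \<noteq> b \<longrightarrow> B a b \<le> - 1)"
proof (induction n)
  case 0
  then show ?case using X by (intro exI[of _ X]) auto
next
  case (Suc n)
  then obtain Y where Y: "finite Y" "Y \<subseteq> root_set S \<inter> cone S" "n + 3 \<le> card Y"
    "\<forall>a\<in>Y. \<forall>b\<in>Y. a \<noteq> b \<longrightarrow> B a b \<le> - 1" by blast
  obtain Z where "finite Z" "Z \<subseteq> root_set S \<inter> cone S" "card Y < card Z"
    "\<forall>a\<in>Z. \<forall>b\<in>Z. a \<noteq> b \<longrightarrow> B a b \<le> - 1"
    using universal_family_doubling[OF Y(1,2) _ Y(4)] Y(3) by auto
  then show ?case using Y(3) by (intro exI[of _ Z]) auto
qed

text \<open>
  The roots are \<open>U n\<close>, with coordinates \<open>(a (n + 1), a n)\<close> with respect to \<open>x, y\<close>, and \<open>V n\<close>,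
  with the two coordinates exchanged. Geometrically they run from \<open>x\<close> and from \<open>y\<close> towards the
  two isotropic lines of the plane (one line if \<open>B x y = - 1\<close>). Each \<open>V (n + 1)\<close> is a positive
  combination of \<open>x\<close> and \<open>V n\<close>, and each \<open>U (n + 1)\<close> is one of \<open>U n\<close> and any \<open>V k\<close>, so the
  order axiom places them. The sequences returned omit \<open>x\<close> and \<open>y\<close>, so that chains of
  consecutive pairs are disjoint.\<close>

lemma dihedral_chains:
  assumes x: "x \<in> root_set S \<inter> cone S" and y: "y \<in> root_set S \<inter> cone S" and xy: "B x y \<le> - 1"
    and lt: "reflection_order (root_set S \<inter> cone S) lt" and less: "lt x y"
  shows "\<exists>u v. (\<forall>n. u n \<in> root_set S \<inter> cone S \<and> v n \<in> root_set S \<inter> cone S \<and>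
      lt (u n) (u (Suc n)) \<and> lt (v (Suc n)) (v n) \<and> lt x (u n) \<and> lt (v n) y) \<and> (\<forall>n k. lt (u n) (v k))"
proof -
  let ?P = "root_set S \<inter> cone S"
  define a where "a = cheb (- B x y)"
  have a_inc: "a n + 1 \<le> a (Suc n)" "0 \<le> a n" for n
    using cheb_increasing[of "- B x y" n] xy by (auto simp: a_def)
  have a_pos: "0 < a (Suc n)" for n using a_inc[of n] by linarith
  have a_det: "a (Suc n) * a (Suc n) - a n * a (Suc (Suc n)) = 1" for n
    unfolding a_def by (rule cheb_det)
  have a_rec: "a (Suc (Suc n)) = 2 * (- B x y) * a (Suc n) - a n" for n by (simp add: a_def)
  have a01: "a 0 = 0" "a (Suc 0) = 1" by (simp_all add: a_def)
  define U where "U n = a (Suc n) *\<^sub>R x + a n *\<^sub>R y" for n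
  define V where "V n = a (Suc n) *\<^sub>R y + a n *\<^sub>R x" for n
  have norm: "B x x = 1" "B y y = 1" using root_norm[of S] x y by auto
  have UV: "refl_in y (U n) = V (Suc n)" "refl_in x (V n) = U (Suc n)" for n
    unfolding U_def V_def a_rec using norm B_sym[of y x]
    by (simp_all add: refl_in_def B_simps algebra_simps,
        simp_all add: scaleR_left_distrib[symmetric] mult_2_right)
  have roots: "U n \<in> root_set S \<and> V n \<in> root_set S" for n
  proof (induction n)
    case 0
    then show ?case using x y by (simp add: U_def V_def a01)
  next
    case (Suc n)
    then show ?case using UV[of n] refl_in_root[of S y "U n"] refl_in_root[of S x "V n"] x y by auto
  qed
  have P: "U n \<in> ?P" "V n \<in> ?P" for n
    using roots[of n] x y a_inc(2)[of n] a_inc(2)[of "Suc n"] unfolding U_def V_def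
    by (auto intro!: cone_add cone_scale)
  have between: "lt p (s *\<^sub>R p + t *\<^sub>R q) \<and> lt (s *\<^sub>R p + t *\<^sub>R q) q"
    if "p \<in> ?P" "q \<in> ?P" "lt p q" "0 < s" "0 < t" "s *\<^sub>R p + t *\<^sub>R q \<in> ?P" for p q s t
    using lt that unfolding reflection_order_def by blast
  have trans: "lt p r" if "lt p q" "lt q r" "p \<in> ?P" "q \<in> ?P" "r \<in> ?P" for p q r
    using lt that unfolding reflection_order_def by (blast dest: transp_onD)
  have Vdec: "lt x (V k) \<and> (\<forall>j. k = Suc j \<longrightarrow> lt (V k) (V j))" for k
  proof (induction k)
    case 0
    show ?case using less by (simp add: V_def a01)
  next
    case (Suc k)
    have "V (Suc k) = (1 / a (Suc k)) *\<^sub>R x + (a (Suc (Suc k)) / a (Suc k)) *\<^sub>R V k"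
    proof -
      have "a (Suc k) = 1 / a (Suc k) + (a (Suc (Suc k)) / a (Suc k)) * a k"
        using a_det[of k] a_pos[of k] by (simp add: field_simps)
      then have "a (Suc k) *\<^sub>R x = (1 / a (Suc k)) *\<^sub>R x + ((a (Suc (Suc k)) / a (Suc k)) * a k) *\<^sub>R x"
        by (metis scaleR_left_distrib)
      then show ?thesis using a_pos[of k] by (simp add: V_def scaleR_right_distrib)
    qed
    with between[of x "V k" "1 / a (Suc k)" "a (Suc (Suc k)) / a (Suc k)"] Suc P[of k] P[of "Suc k"] x
      a_pos[of k] a_pos[of "Suc k"]
    show ?case by auto
  qed
  define D where "D n k = a (Suc n) * a (Suc k) - a n * a k" for n k
  have D: "0 < D n k" for n k
  proof -
    have "a n * a k \<le> a n * a (Suc k)" using a_inc[of k] a_inc(2)[of n] by (intro mult_left_mono) auto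
    also have "\<dots> < a (Suc n) * a (Suc k)" using a_inc(1)[of n] a_pos[of k] by (intro mult_strict_right_mono) auto
    finally show ?thesis by (simp add: D_def)
  qed
  have step: "lt (U n) (U (Suc n)) \<and> lt (U (Suc n)) (V k)" if "lt (U n) (V k)" for n k
  proof -
    define d where "d = D n k"
    have d: "0 < d" using D by (simp add: d_def)
    \<comment> \<open>Cramer's rule: \<open>D\<close> gives the coefficients of \<open>U (n + 1)\<close> with respect to \<open>U n\<close> and \<open>V k\<close>.\<close>
    have det: "a n * a (Suc (Suc n)) = a (Suc n) * a (Suc n) - 1" using a_det[of n] by simp
    have "D (Suc n) k * a (Suc n) + a k = d * a (Suc (Suc n)) + a k * (1 + a n * a (Suc (Suc n)) - a (Suc n) * a (Suc n))"
      unfolding d_def D_def by (simp add: algebra_simps)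
    then have 1: "D (Suc n) k * a (Suc n) + a k = d * a (Suc (Suc n))" unfolding det by simp
    have "D (Suc n) k * a n + a (Suc k) = d * a (Suc n) + a (Suc k) * (1 + a n * a (Suc (Suc n)) - a (Suc n) * a (Suc n))"
      unfolding d_def D_def by (simp add: algebra_simps)
    then have 2: "D (Suc n) k * a n + a (Suc k) = d * a (Suc n)" unfolding det by simp
    have "d *\<^sub>R U (Suc n) = D (Suc n) k *\<^sub>R U n + V k"
    proof -
      have "D (Suc n) k *\<^sub>R U n + V k
          = (D (Suc n) k * a (Suc n) + a k) *\<^sub>R x + (D (Suc n) k * a n + a (Suc k)) *\<^sub>R y"
        by (simp add: U_def V_def algebra_simps)
      then show ?thesis unfolding 1 2 by (simp add: U_def scaleR_right_distrib)
    qed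
    then have "U (Suc n) = (1 / d) *\<^sub>R (D (Suc n) k *\<^sub>R U n + V k)" using d
      by (metis (no_types, lifting) divide_self_if less_irrefl mult.commute scaleR_one scaleR_scaleR times_divide_eq_right mult_1_right)
    then have "U (Suc n) = (D (Suc n) k / d) *\<^sub>R U n + (1 / d) *\<^sub>R V k" by (simp add: scaleR_right_distrib)
    with between[of "U n" "V k" "D (Suc n) k / d" "1 / d"] that P[of n] P[of k] P[of "Suc n"] d D[of "Suc n" k]
    show ?thesis by auto
  qed
  have UVlt: "lt (U n) (V k)" for n k
  proof (induction n)
    case 0
    show ?case using Vdec[of k] by (simp add: U_def a01)
  next
    case (Suc n)
    then show ?case using step by blast
  qed
  have xU: "lt x (U (Suc n))" for n
  proof (induction n)
    case 0
    show ?case using step[OF UVlt, of 0] by (simp add: U_def a01)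
  next
    case (Suc n)
    then show ?case using trans[of x "U (Suc n)" "U (Suc (Suc n))"] step[OF UVlt] x P by blast
  qed
  have Vy: "lt (V (Suc n)) y" for n
  proof (induction n)
    case 0
    show ?case using Vdec[of "Suc 0"] by (simp add: V_def a01)
  next
    case (Suc n)
    then show ?case using trans[of "V (Suc (Suc n))" "V (Suc n)" y] Vdec[of "Suc (Suc n)"] y P by blast
  qed
  show ?thesis
    by (rule exI[of _ "\<lambda>n. U (Suc n)"], rule exI[of _ "\<lambda>n. V (Suc n)"])
      (use P xU Vy UVlt step[OF UVlt] Vdec in blast)
qed

theorem copies_of_universal_families:
  assumes X: "finite X" "X \<subseteq> root_set S \<inter> cone S" "k < card X"
    "\<forall>a\<in>X. \<forall>b\<in>X. a \<noteq> b \<longrightarrow> B a b \<le> - 1"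
    and lt: "reflection_order (root_set S \<inter> cone S) lt"
  shows "\<exists>E\<subseteq>root_set S \<inter> cone S. has_type_omega_omega_star_copies k E lt"
proof -
  let ?P = "root_set S \<inter> cone S"
  have ord: "irreflp_on ?P lt" "transp_on ?P lt" "totalp_on ?P lt" using lt unfolding reflection_order_def by auto
  obtain xs where xs: "sorted_wrt lt xs" "set xs = X" using sorted_enumeration[OF X(1,2) ord(2,3)] by blast
  have len: "k < length xs" using X(3) xs(2) card_length[of xs] by simp
  have less: "lt (xs ! i) (xs ! j)" if "i < j" "j \<le> k" for i j
    using sorted_wrt_nth_less[OF xs(1) that(1)] that len by auto
  have inP: "xs ! i \<in> ?P" "xs ! i \<in> X" if "i \<le> k" for i using that len xs(2) X(2) nth_mem[of i xs] by auto
  have "\<forall>i. \<exists>u v. i < k \<longrightarrow> (\<forall>n. u n \<in> ?P \<and> v n \<in> ?P \<and> lt (u n) (u (Suc n)) \<and> lt (v (Suc n)) (v n) \<and>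
      lt (xs ! i) (u n) \<and> lt (v n) (xs ! Suc i)) \<and> (\<forall>n j. lt (u n) (v j))"
  proof
    fix i
    show "\<exists>u v. i < k \<longrightarrow> (\<forall>n. u n \<in> ?P \<and> v n \<in> ?P \<and> lt (u n) (u (Suc n)) \<and> lt (v (Suc n)) (v n) \<and>
      lt (xs ! i) (u n) \<and> lt (v n) (xs ! Suc i)) \<and> (\<forall>n j. lt (u n) (v j))"
    proof (cases "i < k")
      case True
      then have l: "lt (xs ! i) (xs ! Suc i)" using less by auto
      have "xs ! i \<noteq> xs ! Suc i" using l irreflp_onD[OF ord(1) inP(1)[of i]] True by auto
      then have "B (xs ! i) (xs ! Suc i) \<le> - 1" using X(4) inP(2)[of i] inP(2)[of "Suc i"] True by auto
      from dihedral_chains[OF inP(1) inP(1) this lt l] True show ?thesis by auto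
    qed simp
  qed
  then obtain u v where uv: "\<And>i. i < k \<Longrightarrow> (\<forall>n. u i n \<in> ?P \<and> v i n \<in> ?P \<and> lt (u i n) (u i (Suc n)) \<and>
      lt (v i (Suc n)) (v i n) \<and> lt (xs ! i) (u i n) \<and> lt (v i n) (xs ! Suc i)) \<and> (\<forall>n j. lt (u i n) (v i j))"
    by metis
  have lo: "b \<in> ?P \<and> lt (xs ! j) b" if "j < k" "b \<in> range (u j) \<union> range (v j)" for j b
  proof -
    have j: "xs ! j \<in> ?P" using inP(1) that(1) by simp
    from that(2) consider n where "b = u j n" | n where "b = v j n" by blast
    then show ?thesis
    proof cases
      case 1
      with uv[OF that(1)] show ?thesis by blast
    next
      case 2
      with uv[OF that(1)] have "b \<in> ?P" "u j 0 \<in> ?P" "lt (xs ! j) (u j 0)" "lt (u j 0) b" by blast+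
      with transp_onD[OF ord(2) j] show ?thesis by blast
    qed
  qed
  have hi: "b \<in> ?P \<and> lt b (xs ! Suc j)" if "j < k" "b \<in> range (u j) \<union> range (v j)" for j b
  proof -
    have j: "xs ! Suc j \<in> ?P" using inP(1) that(1) by simp
    from that(2) consider n where "b = u j n" | n where "b = v j n" by blast
    then show ?thesis
    proof cases
      case 1
      with uv[OF that(1)] have "b \<in> ?P" "v j 0 \<in> ?P" "lt b (v j 0)" "lt (v j 0) (xs ! Suc j)" by blast+
      with transp_onD[OF ord(2) _ _ j] show ?thesis by blast
    next
      case 2
      with uv[OF that(1)] show ?thesis by blast
    qed
  qed
  show ?thesis
  proof (rule copies_embedding[OF ord(1,2), where u = u and v = v])
    fix i j a b assume ij: "i < j" "j < k"
      and a: "a \<in> range (u i) \<union> range (v i)" and b: "b \<in> range (u j) \<union> range (v j)"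
    have 1: "a \<in> ?P" "lt a (xs ! Suc i)" using hi[OF _ a] ij by auto
    have 2: "b \<in> ?P" "lt (xs ! j) b" using lo[OF ij(2) b] by auto
    have "lt a (xs ! j)"
    proof (cases "Suc i = j")
      case True
      then show ?thesis using 1 by simp
    next
      case False
      then have "lt (xs ! Suc i) (xs ! j)" using less ij by simp
      then show ?thesis using transp_onD[OF ord(2) 1(1) inP(1)[of "Suc i"] inP(1)[of j] 1(2)] ij by auto
    qed
    then show "lt a b" using transp_onD[OF ord(2) 1(1) inP(1)[of j] 2(1) _ 2(2)] ij by auto
  qed (use uv in blast)+
qed

end

section \<open>Non-affine systems\<close>

context root_basis
begin

text \<open>
  The Gram matrix of the standard representation. It decides affineness, and it can differ
  from \<open>gram\<close> only at the edges labelled \<open>\<infinity>\<close>, where \<open>gram\<close> may be smaller.\<close>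

definition standard_gram :: "'g \<Rightarrow> 'g \<Rightarrow> real" where
  "standard_gram s t = standard_entry (m s t)"

lemma standard_gram_diag: "s \<in> S \<Longrightarrow> standard_gram s s = 1"
  using m_diag[of s] by (simp add: standard_gram_def standard_entry_def one_enat_def)

lemma standard_gram_sym: "s \<in> S \<Longrightarrow> t \<in> S \<Longrightarrow> standard_gram s t = standard_gram t s"
  using m_sym[of s t] by (simp add: standard_gram_def)

lemma standard_gram_offdiag:
  assumes "s \<in> S" "t \<in> S" "s \<noteq> t"
  shows "standard_gram s t \<le> 0" "standard_gram s t = 0 \<longleftrightarrow> m s t = 2" "- 1 \<le> standard_gram s t"
  using standard_entry_offdiag[OF m_ge_2[OF assms]] by (simp_all add: standard_gram_def)

lemma standard_gram_connected:
  assumes "irreducible_coxeter S m" "J \<subset> S" "J \<noteq> {}"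
  shows "\<exists>s\<in>J. \<exists>t\<in>S - J. standard_gram s t \<noteq> 0"
proof -
  obtain s t where "s \<in> J" "t \<in> S - J" "m s t \<noteq> 2"
    using assms unfolding irreducible_coxeter_def by blast
  moreover from this assms have "s \<in> S" "t \<in> S" "s \<noteq> t" by auto
  ultimately show ?thesis using standard_gram_offdiag(2) by blast
qed

lemma standard_form_matrix_form:
  assumes "finite S" "x \<in> standard_space S"
  shows "standard_form m x x = matrix_form S standard_gram x x"
proof -
  have sub: "{s. x s \<noteq> 0} \<subseteq> S" using assms by (simp add: standard_space_def)
  have "standard_form m x x = (\<Sum>s | x s \<noteq> 0. \<Sum>t\<in>S. x s * x t * standard_gram s t)"
    unfolding standard_form_def standard_gram_def
    by (intro sum.cong HOL.refl sum.mono_neutral_left) (use assms sub in auto)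
  also have "\<dots> = matrix_form S standard_gram x x"
    unfolding matrix_form_def by (intro sum.mono_neutral_left) (use assms sub in auto)
  finally show ?thesis .
qed

lemma matrix_form_restrict:
  "matrix_form S A (\<lambda>s. if s \<in> S then y s else 0) (\<lambda>s. if s \<in> S then y s else 0) = matrix_form S A y y"
  unfolding matrix_form_def by (intro sum.cong HOL.refl) auto

lemma restrict_in_standard_space: "finite S \<Longrightarrow> (\<lambda>s. if s \<in> S then y s else 0) \<in> standard_space S"
  by (auto simp: standard_space_def)

lemma standard_frobenius:
  assumes irr: "irreducible_coxeter S m" and S: "finite S"
  obtains \<mu> x where "\<forall>s\<in>S. 0 < x s" "\<forall>s\<in>S. (\<Sum>t\<in>S. standard_gram s t * x t) = \<mu> * x s"
    "\<forall>y. \<mu> * (\<Sum>s\<in>S. (y s)^2) \<le> matrix_form S standard_gram y y"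
    "affine_coxeter S m \<longleftrightarrow> \<mu> = 0"
proof -
  have ne: "S \<noteq> {}" using irr by (simp add: irreducible_coxeter_def)
  note conn = standard_gram_connected[OF irr]
  show thesis
  proof (rule perron_frobenius[of S standard_gram])
    fix \<mu> x
    assume pos: "\<And>s. s \<in> S \<Longrightarrow> 0 < x s" and eig: "\<And>s. s \<in> S \<Longrightarrow> (\<Sum>t\<in>S. standard_gram s t * x t) = \<mu> * x s"
      and low: "\<And>y. \<mu> * (\<Sum>s\<in>S. (y s)^2) \<le> matrix_form S standard_gram y y"
    have form: "matrix_form S standard_gram x x = \<mu> * (\<Sum>s\<in>S. (x s)^2)"
      by (rule matrix_form_eigenvector[OF eig])
    have "x s \<noteq> 0" if "s \<in> S" for s using pos[OF that] by simp
    then have xx: "0 < (\<Sum>s\<in>S. (x s)^2)" using S ne by (intro sum_pos) auto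
    define x' where "x' s = (if s \<in> S then x s else 0)" for s
    have x': "x' \<in> standard_space S" unfolding x'_def[abs_def] by (rule restrict_in_standard_space[OF S])
    have fx': "standard_form m x' x' = \<mu> * (\<Sum>s\<in>S. (x s)^2)"
      using standard_form_matrix_form[OF S x'] form matrix_form_restrict[of standard_gram x] by (simp add: x'_def[abs_def])
    have nz: "x' \<noteq> (\<lambda>_. 0)"
    proof
      assume "x' = (\<lambda>_. 0)"
      then have "x' s = 0" for s by simp
      moreover obtain s where "s \<in> S" using ne by blast
      ultimately show False using pos[of s] unfolding x'_def by (metis less_irrefl)
    qed
    have "affine_coxeter S m \<longleftrightarrow> \<mu> = 0"
    proof
      assume aff: "affine_coxeter S m"
      then have "0 \<le> \<mu> * (\<Sum>s\<in>S. (x s)^2)" using x' fx' unfolding affine_coxeter_def by metis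
      with xx have "0 \<le> \<mu>" by (simp add: zero_le_mult_iff)
      moreover have "\<not> 0 < \<mu>"
      proof
        assume \<mu>: "0 < \<mu>"
        obtain y where y: "y \<in> standard_space S" "y \<noteq> (\<lambda>_. 0)" "\<not> 0 < standard_form m y y"
          using aff unfolding affine_coxeter_def by blast
        have "\<mu> * (\<Sum>s\<in>S. (y s)^2) \<le> 0"
          using low[of y] y(3) standard_form_matrix_form[OF S y(1)] by simp
        with \<mu> have "(\<Sum>s\<in>S. (y s)^2) \<le> 0" by (simp add: mult_le_0_iff)
        moreover have "0 \<le> (\<Sum>s\<in>S. (y s)^2)" by (intro sum_nonneg) auto
        ultimately have "(\<Sum>s\<in>S. (y s)^2) = 0" by simp
        then have "y s = 0" if "s \<in> S" for s using S that by (simp add: sum_nonneg_eq_0_iff)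
        moreover have "y s = 0" if "s \<notin> S" for s using y(1) that by (auto simp: standard_space_def)
        ultimately have "y = (\<lambda>_. 0)" by blast
        with y(2) show False by simp
      qed
      ultimately show "\<mu> = 0" by simp
    next
      assume \<mu>: "\<mu> = 0"
      have "0 \<le> standard_form m y y" if "y \<in> standard_space S" for y
        using low[of y] \<mu> standard_form_matrix_form[OF S that] by simp
      moreover have "standard_form m x' x' = 0" using fx' \<mu> by simp
      ultimately show "affine_coxeter S m" unfolding affine_coxeter_def using S x' nz by (metis less_irrefl)
    qed
    then show thesis using that[of x \<mu>] pos eig low by blast
  qed (use S ne conn standard_gram_sym standard_gram_offdiag(1) in auto)
qed

text \<open>
  Two generators span at worst an infinite dihedral group, whose standard form is semidefinite
  even if \<open>B\<close> is indefinite. So an infinite irreducible non-affine system has rank at least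
  three.\<close>

lemma standard_form_nonneg_of_small_rank:
  assumes S: "finite S" "card S \<le> 2"
  shows "0 \<le> matrix_form S standard_gram y y"
proof -
  consider "card S = 0" | "card S = 1" | "card S = 2" using S by linarith
  then show ?thesis
  proof cases
    case 1
    then show ?thesis using S by (simp add: matrix_form_def)
  next
    case 2
    then obtain s where "S = {s}" using card_1_singletonE by blast
    then show ?thesis using standard_gram_diag[of s] by (simp add: matrix_form_def)
  next
    case 3
    then obtain a b where ab: "S = {a, b}" "a \<noteq> b" by (meson card_2_iff)
    define g where "g = standard_gram a b"
    have g: "0 \<le> 1 + g" "0 \<le> - g" using standard_gram_offdiag[of a b] ab by (auto simp: g_def)
    have "matrix_form S standard_gram y y = y a * y a + y a * y b * g + (y b * y a * g + y b * y b)"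
      unfolding ab(1) matrix_form_def using ab standard_gram_diag[of a] standard_gram_diag[of b] standard_gram_sym[of b a] by (simp add: g_def)
    also have "\<dots> = (1 + g) * ((y a)^2 + (y b)^2) + (- g) * (y a - y b)^2"
      by (simp add: power2_eq_square algebra_simps)
    also have "\<dots> \<ge> 0" using g by (simp only: add_nonneg_nonneg mult_nonneg_nonneg zero_le_power2)
    finally show ?thesis .
  qed
qed

text \<open>
  The two ends of an edge labelled \<open>\<infinity>\<close> add up to an isotropic vector. Hence a definite system
  has no such edge, and an irreducible semidefinite one with such an edge consists of its two
  ends.\<close>

lemma infinite_edge_form:
  assumes S: "finite S" and st: "s \<in> S" "t \<in> S" and inf: "m s t = \<infinity>"
  shows "s \<noteq> t" "matrix_form S standard_gram (\<lambda>u. if u = s \<or> u = t then 1 else 0) (\<lambda>u. if u = s \<or> u = t then 1 else 0) = 0"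
proof -
  show ne: "s \<noteq> t" using inf m_diag[OF st(1)] by (auto simp: one_enat_def)
  let ?y = "\<lambda>u. if u = s \<or> u = t then 1 else (0::real)"
  have "matrix_form S standard_gram ?y ?y = matrix_form {s, t} standard_gram ?y ?y"
    unfolding matrix_form_def
    by (intro sum.mono_neutral_cong_right ballI sum.neutral) (use S st in auto)
  also have "\<dots> = 0"
    using ne standard_gram_diag[OF st(1)] standard_gram_diag[OF st(2)] standard_gram_sym[OF st] inf
    by (simp add: matrix_form_def standard_gram_def standard_entry_def)
  finally show "matrix_form S standard_gram ?y ?y = 0" .
qed

lemma gram_form_eq_standard:
  assumes "\<And>s t. s \<in> S \<Longrightarrow> t \<in> S \<Longrightarrow> m s t \<noteq> \<infinity>"
  shows "matrix_form S gram x y = matrix_form S standard_gram x y"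
  unfolding matrix_form_def standard_gram_def
  by (intro sum.cong HOL.refl) (use gram_standard assms in auto)

text \<open>
  For infinite \<open>S\<close>, a finite set with infinite subgroup is enlarged to a connected one, which
  is proper and so can be made indefinite. For finite \<open>S\<close>, the standard form is neither
  definite (the group is infinite) nor affine, so its least eigenvalue is negative; as \<open>gram\<close>
  is entrywise at most the standard matrix and the eigenvector is positive, \<open>B\<close> is negative on
  it as well.\<close>

lemma indefinite_subset_of_nonaffine:
  assumes irr: "irreducible_coxeter S m" and inf: "infinite (carrier W)"
    and nlf: "\<exists>J. J \<subseteq> S \<and> finite J \<and> infinite (generate W J)"
    and na: "\<not> affine_coxeter S m"
  shows "\<exists>s0 K. grown s0 K \<and> indefinite K \<and> 3 \<le> card K"
proof -
  obtain s0 where s0: "s0 \<in> S" using irr by (auto simp: irreducible_coxeter_def)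
  show ?thesis
  proof (cases "finite S")
    case False
    obtain J where J: "J \<subseteq> S" "finite J" "infinite (generate W J)" using nlf by blast
    obtain T where T: "T \<subseteq> S" "finite T" "card T = 3" using infinite_arbitrarily_large[OF False] by blast
    obtain K where K: "grown s0 K" "J \<union> T \<subseteq> K" using grown_covers[OF irr s0, of "J \<union> T"] J T by auto
    have f: "finite K" "K \<subseteq> S" using grown_finite[OF K(1)] by auto
    have "generate W J \<subseteq> generate W K" using mono_generate K(2) by auto
    then have "infinite (generate W K)" using J(3) finite_subset by blast
    moreover have "K \<noteq> S" using f False by blast
    ultimately obtain L where L: "grown s0 L" "K \<subseteq> L" "indefinite L"
      using indefinite_superset_of_infinite[OF irr K(1)] by blast
    have "card T \<le> card L" using K(2) L(2) grown_finite[OF L(1)] by (intro card_mono) auto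
    with L T show ?thesis by auto
  next
    case True
    obtain K where K: "grown s0 K" "S \<subseteq> K" using grown_covers[OF irr s0 True] by blast
    then have KS: "K = S" using grown_finite[OF K(1)] by blast
    obtain \<mu> x where x: "\<forall>s\<in>S. 0 < x s" "\<forall>s\<in>S. (\<Sum>t\<in>S. standard_gram s t * x t) = \<mu> * x s"
      "\<forall>y. \<mu> * (\<Sum>s\<in>S. (y s)^2) \<le> matrix_form S standard_gram y y" "affine_coxeter S m \<longleftrightarrow> \<mu> = 0"
      using standard_frobenius[OF irr True] .
    have xx: "0 < (\<Sum>s\<in>S. (x s)^2)"
    proof -
      have "x s \<noteq> 0" if "s \<in> S" for s using x(1) that by force
      then show ?thesis using True s0 by (intro sum_pos) auto
    qed
    have form: "matrix_form S standard_gram x x = \<mu> * (\<Sum>s\<in>S. (x s)^2)"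
      by (rule matrix_form_eigenvector) (use x(2) in blast)
    have "\<not> 0 < \<mu>"
    proof
      assume \<mu>: "0 < \<mu>"
      have "m s t \<noteq> \<infinity>" if st: "s \<in> S" "t \<in> S" for s t
      proof
        assume *: "m s t = \<infinity>"
        let ?y = "\<lambda>u. if u = s \<or> u = t then 1 else (0::real)"
        have "\<mu> * (\<Sum>s\<in>S. (?y s)^2) \<le> 0" using x(3) infinite_edge_form(2)[OF True st *] by metis
        then have "(\<Sum>s\<in>S. (?y s)^2) \<le> 0" using \<mu> by (simp only: mult_le_0_iff) linarith
        moreover have "(?y s)^2 \<le> (\<Sum>s\<in>S. (?y s)^2)" using True st by (intro member_le_sum) simp_all
        ultimately show False by simp
      qed
      then have "\<mu> * (\<Sum>s\<in>S. (y s)^2) \<le> matrix_form S gram y y" for y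
        using gram_form_eq_standard x(3) by metis
      from finite_subgroup_of_positive_definite[OF True order_refl \<mu> this] inf generates show False by simp
    qed
    with na x(4) have \<mu>: "\<mu> < 0" by linarith
    then have neg: "matrix_form S standard_gram x x < 0" unfolding form using xx by (simp add: mult_neg_pos)
    have "matrix_form S gram x x \<le> matrix_form S standard_gram x x"
      unfolding matrix_form_def standard_gram_def
      by (intro sum_mono mult_left_mono gram_le_standard) (use x(1) in \<open>auto intro: less_imp_le\<close>)
    with neg have "indefinite S" unfolding indefinite_def by (intro exI[of _ x]) simp
    moreover have "3 \<le> card S"
    proof (rule ccontr)
      assume "\<not> 3 \<le> card S"
      then show False using standard_form_nonneg_of_small_rank[OF True, of x] neg by simp
    qed
    ultimately show ?thesis using K KS by blast
  qed
qed

theorem nonaffine_contains_copies: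
  assumes "irreducible_coxeter S m" "infinite (carrier W)"
    "\<exists>J. J \<subseteq> S \<and> finite J \<and> infinite (generate W J)" "\<not> affine_coxeter S m"
    and lt: "reflection_order (root_set S \<inter> cone S) lt"
  shows "\<exists>E\<subseteq>root_set S \<inter> cone S. has_type_omega_omega_star_copies k E lt"
proof -
  obtain s0 K where K: "grown s0 K" "indefinite K" "3 \<le> card K"
    using indefinite_subset_of_nonaffine[OF assms(1-4)] by blast
  obtain X where "finite X" "X \<subseteq> root_set S \<inter> cone S" "3 \<le> card X" "\<forall>a\<in>X. \<forall>b\<in>X. a \<noteq> b \<longrightarrow> B a b \<le> - 1"
    using three_roots_of_indefinite[OF K] .
  from large_universal_family[OF this, of k] obtain Y where
    "finite Y" "Y \<subseteq> root_set S \<inter> cone S" "k + 3 \<le> card Y" "\<forall>a\<in>Y. \<forall>b\<in>Y. a \<noteq> b \<longrightarrow> B a b \<le> - 1" by blast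
  then show ?thesis using copies_of_universal_families[of Y k lt] lt by auto
qed

end

section \<open>Slope orders of affine systems\<close>

text \<open>
  The ascending half of each copy converges, and its limit lies between the two halves of the
  copy; so the limits of different copies are different.\<close>

lemma copies_bounded_by_limit_points:
  fixes \<sigma> :: "'a \<Rightarrow> real"
  assumes C: "finite C"
    and lim: "\<And>b c. inj b \<Longrightarrow> range b \<subseteq> P \<Longrightarrow> (\<lambda>n. \<sigma> (b n)) \<longlonglongrightarrow> c \<Longrightarrow> c \<in> C"
    and E: "E \<subseteq> P" "has_type_omega_omega_star_copies k E (\<lambda>v w. \<sigma> v < \<sigma> w)"
  shows "k \<le> card C"
proof -
  let ?D = "{..<k} \<times> (UNIV :: (nat + nat) set)"
  obtain f where f: "bij_betw f ?D E" "\<And>p q. p \<in> ?D \<Longrightarrow> q \<in> ?D \<Longrightarrow> copies_less p q \<Longrightarrow> \<sigma> (f p) < \<sigma> (f q)"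
    using E(2) unfolding has_type_omega_omega_star_copies_def order_isomorphic_def by blast
  have "\<exists>c\<in>C. \<sigma> (f (i, Inl 0)) \<le> c \<and> c \<le> \<sigma> (f (i, Inr 0))" if i: "i < k" for i
  proof -
    define b where "b n = f (i, Inl n)" for n
    have "inj b"
    proof (rule injI)
      fix n n' assume eq: "b n = b n'"
      have "(i, Inl n) = (i, Inl n' :: nat + nat)"
        by (rule inj_onD[OF bij_betw_imp_inj_on[OF f(1)]]) (use eq i in \<open>auto simp: b_def\<close>)
      then show "n = n'" by simp
    qed
    moreover have "range b \<subseteq> P" using bij_betw_imp_surj_on[OF f(1)] i E(1) unfolding b_def by auto
    moreover have inc: "incseq (\<lambda>n. \<sigma> (b n))"
      unfolding b_def by (intro incseq_SucI less_imp_le f(2)) (use i in \<open>auto simp: copies_less_def\<close>)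
    have up: "\<sigma> (b n) \<le> \<sigma> (f (i, Inr 0))" for n
      unfolding b_def by (intro less_imp_le f(2)) (use i in \<open>auto simp: copies_less_def\<close>)
    obtain c where c: "(\<lambda>n. \<sigma> (b n)) \<longlonglongrightarrow> c" "\<And>n. \<sigma> (b n) \<le> c"
      using incseq_convergent[OF inc] up by metis
    ultimately have "c \<in> C" using lim by blast
    moreover have "c \<le> \<sigma> (f (i, Inr 0))" by (rule LIMSEQ_le_const2[OF c(1)]) (use up in blast)
    ultimately show ?thesis using c(2)[of 0] unfolding b_def by blast
  qed
  then obtain c where c: "\<And>i. i < k \<Longrightarrow> c i \<in> C \<and> \<sigma> (f (i, Inl 0)) \<le> c i \<and> c i \<le> \<sigma> (f (i, Inr 0))"
    by metis
  have "c i < c j" if "i < j" "j < k" for i j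
  proof -
    have "\<sigma> (f (i, Inr 0)) < \<sigma> (f (j, Inl 0))" by (rule f(2)) (use that in \<open>auto simp: copies_less_def\<close>)
    with c[of i] c[of j] that show ?thesis by auto
  qed
  then have "inj_on c {..<k}" by (intro inj_onI) (metis lessThan_iff less_irrefl linorder_neqE_nat)
  moreover have "c ` {..<k} \<subseteq> C" using c by auto
  ultimately have "card {..<k} \<le> card C" using C by (intro card_inj_on_le)
  then show ?thesis by simp
qed

lemma finite_product_with_complement: "finite {p::real. p * (1 - p) = \<kappa>}"
proof (cases "{p::real. p * (1 - p) = \<kappa>} = {}")
  case False
  then obtain p where p: "p * (1 - p) = \<kappa>" by blast
  have "{q. q * (1 - q) = \<kappa>} \<subseteq> {p, 1 - p}"
  proof
    fix q assume "q \<in> {q. q * (1 - q) = \<kappa>}"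
    then have "(q - p) * (1 - p - q) = 0" using p by (simp add: algebra_simps)
    then show "q \<in> {p, 1 - p}" by auto
  qed
  then show ?thesis by (rule finite_subset) simp
qed simp

context root_basis
begin

text \<open>
  The possible limits of positive roots, divided by the sum of their coordinates.\<close>

definition isotropic_simplex :: "('g \<Rightarrow> real) set" where
  "isotropic_simplex = {e. (\<forall>s. s \<notin> S \<longrightarrow> e s = 0) \<and> (\<forall>s\<in>S. 0 \<le> e s) \<and> (\<Sum>s\<in>S. e s) = 1 \<and>
     matrix_form S gram e e = 0}"

text \<open>
  Positive independence excludes relations whose coefficients all have the same sign.\<close>

lemma independent_of_one_signed_relations:
  assumes "finite S" and sgn: "\<And>k. combination S k = 0 \<Longrightarrow> (\<forall>s\<in>S. 0 \<le> k s) \<or> (\<forall>s\<in>S. k s \<le> 0)"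
    and k: "combination S k = 0" "s \<in> S"
  shows "k s = 0"
  using sgn[OF k(1)]
proof
  assume "\<forall>s\<in>S. 0 \<le> k s"
  then show ?thesis using positively_independent[of S k s] assms by (auto simp: combination_def)
next
  assume "\<forall>s\<in>S. k s \<le> 0"
  moreover have "(\<Sum>s\<in>S. (- k s) *\<^sub>R \<alpha> s) = 0" using k(1) by (simp add: combination_def sum_negf)
  ultimately show ?thesis using positively_independent[of S "\<lambda>s. - k s" s] assms by auto
qed

text \<open>
  Without an edge labelled \<open>\<infinity>\<close>, the form \<open>B\<close> is the standard one. Its isotropic vectors are
  multiples of the positive vector \<open>\<delta>\<close>, which leaves one point in the simplex, and a linear
  relation between the simple roots is a multiple of \<open>\<delta>\<close> as well. With such an edge \<open>S\<close>
  consists of its two ends; \<open>B\<close> may then be indefinite, but isotropy is a quadratic equation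
  in one coordinate.\<close>

lemma affine_structure:
  assumes irr: "irreducible_coxeter S m" and aff: "affine_coxeter S m"
  shows "finite S" and "\<And>k s. combination S k = 0 \<Longrightarrow> s \<in> S \<Longrightarrow> k s = 0" and "finite isotropic_simplex"
proof -
  show S: "finite S" using aff by (simp add: affine_coxeter_def)
  have ne: "S \<noteq> {}" using irr by (simp add: irreducible_coxeter_def)
  obtain \<mu> \<delta> where x: "\<forall>s\<in>S. 0 < \<delta> s" "\<forall>s\<in>S. (\<Sum>t\<in>S. standard_gram s t * \<delta> t) = \<mu> * \<delta> s"
    "\<forall>y. \<mu> * (\<Sum>s\<in>S. (y s)^2) \<le> matrix_form S standard_gram y y" "affine_coxeter S m \<longleftrightarrow> \<mu> = 0"
    using standard_frobenius[OF irr S] .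
  have \<mu>: "\<mu> = 0" using x(4) aff by simp
  have psd: "0 \<le> matrix_form S standard_gram y y" for y using x(3) \<mu> by simp
  have ker: "(\<Sum>t\<in>S. standard_gram s t * y t) = 0" if "matrix_form S standard_gram y y = 0" "s \<in> S" for y s
    by (rule psd_isotropic_kernel[OF S standard_gram_sym psd that])
  note conn = standard_gram_connected[OF irr]
  have full: "0 < y s" if "\<And>s. s \<in> S \<Longrightarrow> 0 \<le> y s" "\<exists>s\<in>S. y s \<noteq> 0" "matrix_form S standard_gram y y = 0" "s \<in> S" for y s
    by (rule nonneg_eigenvector_pos[where A = standard_gram and \<mu> = 0 and K = S])
      (use S standard_gram_offdiag(1) conn that ker[OF that(3)] in auto)
  have unique: "\<exists>c. \<forall>s\<in>S. k s = c * \<delta> s" if k: "\<And>s. s \<in> S \<Longrightarrow> (\<Sum>t\<in>S. standard_gram s t * k t) = 0" for k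
  proof -
    obtain a where a: "a \<in> S" using ne by blast
    \<comment> \<open>A multiple of \<open>\<delta>\<close> is subtracted so that one coordinate vanishes; the absolute value of the rest is then a nonnegative kernel vector without full support, hence zero.\<close>
    define c where "c = k a / \<delta> a"
    define y where "y s = k s - c * \<delta> s" for s
    have ya: "y a = 0" using x(1) a by (force simp: y_def c_def)
    have "(\<Sum>t\<in>S. standard_gram s t * y t) = 0" if s: "s \<in> S" for s
    proof -
      have "(\<Sum>t\<in>S. standard_gram s t * y t) = (\<Sum>t\<in>S. standard_gram s t * k t) - c * (\<Sum>t\<in>S. standard_gram s t * \<delta> t)"
        by (simp add: y_def algebra_simps sum_subtractf sum_distrib_left)
      then show ?thesis using k[OF s] x(2) \<mu> s by simp
    qed
    moreover have "matrix_form S standard_gram y y = (\<Sum>s\<in>S. y s * (\<Sum>t\<in>S. standard_gram s t * y t))"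
      unfolding matrix_form_def by (simp add: sum_distrib_left mult_ac)
    ultimately have "matrix_form S standard_gram y y = 0" by simp
    with matrix_form_abs_le[of S standard_gram y] standard_gram_offdiag(1) psd[of "\<lambda>s. \<bar>y s\<bar>"]
    have abs0: "matrix_form S standard_gram (\<lambda>s. \<bar>y s\<bar>) (\<lambda>s. \<bar>y s\<bar>) = 0" by auto
    have "y s = 0" if "s \<in> S" for s
    proof (rule ccontr)
      assume "y s \<noteq> 0"
      then have "0 < \<bar>y a\<bar>" using full[of "\<lambda>s. \<bar>y s\<bar>" a] abs0 a that by auto
      then show False using ya by simp
    qed
    then show ?thesis by (intro exI[of _ c]) (auto simp: y_def)
  qed
  have "(\<forall>k s. combination S k = 0 \<longrightarrow> s \<in> S \<longrightarrow> k s = 0) \<and> finite isotropic_simplex"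
  proof (cases "\<forall>s\<in>S. \<forall>t\<in>S. m s t \<noteq> \<infinity>")
    case True
    have gs: "gram s t = standard_gram s t" if "s \<in> S" "t \<in> S" for s t using gram_standard that True by (simp add: standard_gram_def)
    have form: "matrix_form S gram y y = matrix_form S standard_gram y y" for y
      using gram_form_eq_standard True by blast
    have sgn: "(\<forall>s\<in>S. 0 \<le> k s) \<or> (\<forall>s\<in>S. k s \<le> 0)" if k: "combination S k = 0" for k
    proof -
      have "(\<Sum>t\<in>S. standard_gram s t * k t) = B (\<alpha> s) (combination S k)" if "s \<in> S" for s
        unfolding B_combination_right using gs that by (intro sum.cong HOL.refl) simp
      then obtain c where c: "\<forall>s\<in>S. k s = c * \<delta> s" using unique[of k] k by (auto simp: B_simps)
      show ?thesis
      proof (cases "0 \<le> c")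
        case True
        then show ?thesis using c x(1) by (simp add: less_imp_le)
      next
        case False
        then show ?thesis using c x(1) by (simp add: mult_nonpos_nonneg less_imp_le)
      qed
    qed
    have "isotropic_simplex \<subseteq> {\<lambda>s. if s \<in> S then \<delta> s / sum \<delta> S else 0}"
    proof
      fix e assume e: "e \<in> isotropic_simplex"
      then have e0: "matrix_form S standard_gram e e = 0" and e1: "(\<Sum>s\<in>S. e s) = 1" and eS: "\<forall>s. s \<notin> S \<longrightarrow> e s = 0"
        using form by (simp_all add: isotropic_simplex_def)
      obtain c where c: "\<forall>s\<in>S. e s = c * \<delta> s" using unique[OF ker[OF e0]] by blast
      have "1 = c * sum \<delta> S" using e1 c by (simp add: sum_distrib_left)
      then have "c = 1 / sum \<delta> S" by (metis mult_zero_right nonzero_eq_divide_eq zero_neq_one)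
      then show "e \<in> {\<lambda>s. if s \<in> S then \<delta> s / sum \<delta> S else 0}" using c eS by auto
    qed
    then have "finite isotropic_simplex" by (rule finite_subset) simp
    with independent_of_one_signed_relations[OF S sgn] show ?thesis by blast
  next
    case False
    then obtain a b where ab: "a \<in> S" "b \<in> S" "m a b = \<infinity>" by blast
    note edge = infinite_edge_form[OF S ab]
    have "s = a \<or> s = b" if "s \<in> S" for s
    proof -
      have "0 < (if s = a \<or> s = b then 1 else (0::real))"
        by (rule full[OF _ _ edge(2) that]) (use ab in auto)
      then show ?thesis by (auto split: if_splits)
    qed
    then have Sab: "S = {a, b}" using ab by blast
    define g where "g = gram a b"
    have g: "g \<le> - 1" using B_infinite ab by (simp add: g_def)
    have gba: "gram b a = g" by (simp add: g_def B_sym)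
    have norm: "gram a a = 1" "gram b b = 1" using ab B_simple_self by auto
    have comb: "combination S k = k a *\<^sub>R \<alpha> a + k b *\<^sub>R \<alpha> b" for k
      using edge(1) by (simp add: combination_def Sab)
    have sgn: "(\<forall>s\<in>S. 0 \<le> k s) \<or> (\<forall>s\<in>S. k s \<le> 0)" if k: "combination S k = 0" for k
    proof -
      have "B (combination S k) (\<alpha> a) = 0" using k by (simp add: B_simps)
      then have "k a + k b * g = 0" unfolding comb using norm gba by (simp add: B_simps)
      then have "k a = (- g) * k b" by (simp add: algebra_simps eq_neg_iff_add_eq_0)
      then show ?thesis using g unfolding Sab by (cases "0 \<le> k b") (auto simp: mult_nonneg_nonpos mult_nonneg_nonneg mult_nonpos_nonneg mult_nonpos_nonpos zero_le_mult_iff mult_le_0_iff)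
    qed
    define \<kappa> where "\<kappa> = 1 / (2 * (1 - g))"
    have "isotropic_simplex \<subseteq> (\<lambda>p u. if u = a then p else if u = b then 1 - p else 0) ` {p. p * (1 - p) = \<kappa>}"
    proof
      fix e assume e: "e \<in> isotropic_simplex"
      then have e1: "(\<Sum>s\<in>S. e s) = 1" and e0: "matrix_form S gram e e = 0" and eS: "\<forall>s. s \<notin> S \<longrightarrow> e s = 0"
        by (simp_all add: isotropic_simplex_def)
      have eb: "e b = 1 - e a" using e1 edge(1) by (simp add: Sab)
      have "matrix_form S gram e e = e a * e a + e a * e b * g + (e b * e a * g + e b * e b)"
        unfolding matrix_form_def Sab using edge(1) norm gba by (simp add: g_def)
      also have "\<dots> = 1 - 2 * (1 - g) * (e a * (1 - e a))" unfolding eb by (simp add: algebra_simps)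
      finally have "2 * (1 - g) * (e a * (1 - e a)) = 1" using e0 by simp
      then have "e a * (1 - e a) = \<kappa>" using g by (simp add: \<kappa>_def field_simps)
      moreover have "e = (\<lambda>u. if u = a then e a else if u = b then 1 - e a else 0)"
        using eS eb by (intro ext) (auto simp: Sab)
      ultimately show "e \<in> (\<lambda>p u. if u = a then p else if u = b then 1 - p else 0) ` {p. p * (1 - p) = \<kappa>}"
        by (intro image_eqI[where x = "e a"] CollectI)
    qed
    then have "finite isotropic_simplex"
      by (rule finite_subset) (rule finite_imageI[OF finite_product_with_complement])
    with independent_of_one_signed_relations[OF S sgn] show ?thesis by blast
  qed
  then show "\<And>k s. combination S k = 0 \<Longrightarrow> s \<in> S \<Longrightarrow> k s = 0" "finite isotropic_simplex" by blast+
qed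

end

text \<open>
  Linear independence gives vectors in the span of the simple roots unique coordinates.\<close>

locale slope_order = root_basis W S m B \<alpha> \<rho>
  for W :: "('g, 'b) monoid_scheme" (structure) and S :: "'g set" and m :: "'g \<Rightarrow> 'g \<Rightarrow> enat"
    and B :: "'v::real_vector \<Rightarrow> 'v \<Rightarrow> real" and \<alpha> :: "'g \<Rightarrow> 'v" and \<rho> :: "'g \<Rightarrow> 'v \<Rightarrow> 'v" +
  assumes S_finite: "finite S" and indep: "\<And>k s. combination S k = 0 \<Longrightarrow> s \<in> S \<Longrightarrow> k s = 0"
begin

abbreviation "pos \<equiv> root_set S \<inter> cone S"

definition coef :: "'v \<Rightarrow> 'g \<Rightarrow> real" where
  "coef v = (SOME x. v = combination S x)"

lemma combination_coef: "v \<in> range (combination S) \<Longrightarrow> combination S (coef v) = v"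
  unfolding coef_def by (metis (mono_tags) rangeE someI)

lemma coef_unique: "v = combination S x \<Longrightarrow> s \<in> S \<Longrightarrow> coef v s = x s"
proof -
  assume v: "v = combination S x" and s: "s \<in> S"
  then have "combination S (\<lambda>s. coef v s - x s) = 0"
    using combination_coef[of v] by (simp add: combination_diff)
  from indep[OF this s] show ?thesis by simp
qed

lemma pos_coef: "v \<in> pos \<Longrightarrow> combination S (coef v) = v" "v \<in> pos \<Longrightarrow> s \<in> S \<Longrightarrow> 0 \<le> coef v s"
proof -
  assume v: "v \<in> pos"
  obtain x where x: "\<forall>s. 0 \<le> x s" "v = combination S x" using cone_combinationE[OF S_finite] v by blast
  then show "combination S (coef v) = v" by (intro combination_coef) auto
  show "0 \<le> coef v s" if "s \<in> S" using coef_unique[OF x(2) that] x(1) by simp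
qed

definition weight :: "('g \<Rightarrow> real) \<Rightarrow> 'v \<Rightarrow> real" where
  "weight \<omega> v = (\<Sum>s\<in>S. \<omega> s * coef v s)"

abbreviation total :: "'v \<Rightarrow> real" where
  "total \<equiv> weight (\<lambda>_. 1)"

lemma weight_linear:
  assumes "v \<in> pos" "w \<in> pos"
  shows "weight \<omega> (a *\<^sub>R v + b *\<^sub>R w) = a * weight \<omega> v + b * weight \<omega> w"
proof -
  have "a *\<^sub>R v + b *\<^sub>R w = combination S (\<lambda>s. a * coef v s + b * coef w s)"
    using assms pos_coef(1) by (simp add: combination_add combination_scale)
  from coef_unique[OF this] show ?thesis
    unfolding weight_def by (simp add: algebra_simps sum.distrib sum_distrib_left)
qed

lemma coef_le_total: "v \<in> pos \<Longrightarrow> s \<in> S \<Longrightarrow> coef v s \<le> total v"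
  unfolding weight_def using member_le_sum[of s S "coef v"] pos_coef(2) S_finite by auto

text \<open>
  Roots are nonzero vectors with nonnegative coordinates.\<close>

lemma total_pos: "v \<in> pos \<Longrightarrow> 0 < total v"
proof -
  assume v: "v \<in> pos"
  have "0 \<le> total v" unfolding weight_def by (intro sum_nonneg) (use pos_coef(2)[OF v] in auto)
  moreover have "total v \<noteq> 0"
  proof
    assume "total v = 0"
    then have "coef v s = 0" if "s \<in> S" for s
      using coef_le_total[OF v that] pos_coef(2)[OF v that] by simp
    then have "combination S (coef v) = 0" by (simp add: combination_def)
    then have "v = 0" using pos_coef(1)[OF v] by simp
    then show False using root_norm[of S v] v by (simp add: B_simps)
  qed
  ultimately show ?thesis by simp
qed

lemma finite_bounded_total: "finite {v \<in> pos. total v \<le> M}"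
proof (rule finite_subset)
  show "finite {\<beta> \<in> root_set S. \<exists>x. \<beta> = combination S x \<and> (\<forall>s\<in>S. 0 \<le> x s \<and> x s \<le> M)}"
    by (rule finite_bounded_positive_roots[OF S_finite order_refl]) (rule indep)
  show "{v \<in> pos. total v \<le> M} \<subseteq> {\<beta> \<in> root_set S. \<exists>x. \<beta> = combination S x \<and> (\<forall>s\<in>S. 0 \<le> x s \<and> x s \<le> M)}"
  proof
    fix v assume "v \<in> {v \<in> pos. total v \<le> M}"
    then have v: "v \<in> pos" "total v \<le> M" by auto
    have "\<forall>s\<in>S. 0 \<le> coef v s \<and> coef v s \<le> M"
      using coef_le_total[OF v(1)] pos_coef(2)[OF v(1)] v(2) by fastforce
    then show "v \<in> {\<beta> \<in> root_set S. \<exists>x. \<beta> = combination S x \<and> (\<forall>s\<in>S. 0 \<le> x s \<and> x s \<le> M)}"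
      using v(1) pos_coef(1)[OF v(1)] by (auto intro!: exI[of _ "coef v"])
  qed
qed

definition slope :: "('g \<Rightarrow> real) \<Rightarrow> 'v \<Rightarrow> real" where
  "slope \<omega> v = weight \<omega> v / total v"

text \<open>
  The slope of \<open>a v + b w\<close> is a mediant of the slopes of \<open>v\<close> and \<open>w\<close>.\<close>

lemma slope_reflection_order:
  assumes inj: "inj_on (slope \<omega>) pos"
  shows "reflection_order pos (\<lambda>v w. slope \<omega> v < slope \<omega> w)"
proof -
  have "slope \<omega> v < slope \<omega> (a *\<^sub>R v + b *\<^sub>R w) \<and> slope \<omega> (a *\<^sub>R v + b *\<^sub>R w) < slope \<omega> w"
    if vw: "v \<in> pos" "w \<in> pos" and ab: "0 < a" "0 < b" and less: "slope \<omega> v < slope \<omega> w" for v w a b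
  proof -
    have t: "0 < total v" "0 < total w" using total_pos vw by auto
    have *: "weight \<omega> v * total w < weight \<omega> w * total v"
      using less t by (simp add: slope_def field_simps)
    have T: "0 < a * total v + b * total w" using t ab by (simp add: add_pos_pos)
    have "b * (weight \<omega> v * total w) < b * (weight \<omega> w * total v)"
      "a * (weight \<omega> v * total w) < a * (weight \<omega> w * total v)" using * ab by simp_all
    then show ?thesis
      unfolding slope_def weight_linear[OF vw] using t T by (simp add: field_simps)
  qed
  moreover have "totalp_on pos (\<lambda>v w. slope \<omega> v < slope \<omega> w)"
    using inj by (intro totalp_onI) (metis inj_onD linorder_neqE_linordered_idom)
  ultimately show ?thesis unfolding reflection_order_def
    by (auto intro!: irreflp_onI transp_onI)
qed

text \<open>
  Bounded totals occur only finitely often, so the totals tend to infinity; the roots divided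
  by their totals then have norms tending to \<open>0\<close>.\<close>

lemma slope_limit_points:
  assumes b: "inj b" "range b \<subseteq> pos" and lim: "(\<lambda>n. slope \<omega> (b n)) \<longlonglongrightarrow> c"
  shows "c \<in> (\<lambda>e. \<Sum>s\<in>S. \<omega> s * e s) ` isotropic_simplex"
proof -
  have bp: "b n \<in> pos" for n using b by auto
  have tp: "0 < total (b n)" for n by (rule total_pos[OF bp])
  have top: "filterlim (\<lambda>n. total (b n)) at_top sequentially"
    unfolding filterlim_at_top
  proof
    fix M
    have "b ` {n. \<not> M \<le> total (b n)} \<subseteq> {v \<in> pos. total v \<le> M}" using bp by auto
    then have "finite (b ` {n. \<not> M \<le> total (b n)})" using finite_bounded_total finite_subset by blast
    then have "finite {n. \<not> M \<le> total (b n)}" using b(1) by (metis finite_imageD inj_on_subset subset_UNIV)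
    then show "\<forall>\<^sub>F n in sequentially. M \<le> total (b n)"
      by (simp add: cofinite_eq_sequentially[symmetric] eventually_cofinite)
  qed
  define x where "x n s = coef (b n) s / total (b n)" for n s
  have x01: "0 \<le> x n s" "x n s \<le> 1" if "s \<in> S" for n s
    using pos_coef(2)[OF bp that] coef_le_total[OF bp that] tp[of n] by (simp_all add: x_def)
  then have "\<bar>x n s\<bar> \<le> 1" if "s \<in> S" for n s using that by force
  then obtain l r where r: "strict_mono r" and l: "\<And>s. s \<in> S \<Longrightarrow> (\<lambda>n. x (r n) s) \<longlonglongrightarrow> l s"
    using bounded_coords_convergent_subseq[OF S_finite, of x 1] by blast
  define e where "e s = (if s \<in> S then l s else 0)" for s
  have xe: "(\<lambda>n. x (r n) s) \<longlonglongrightarrow> e s" if "s \<in> S" for s using l that by (simp add: e_def)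
  have e0: "0 \<le> e s" if "s \<in> S" for s
    using x01(1)[OF that] by (intro LIMSEQ_le_const[OF xe[OF that]]) auto
  have xsum: "(\<Sum>s\<in>S. \<omega> s * x n s) = slope \<omega> (b n)" for \<omega> n
    by (simp add: x_def slope_def weight_def sum_divide_distrib)
  have "(\<lambda>n. \<Sum>s\<in>S. 1 * x (r n) s) \<longlonglongrightarrow> (\<Sum>s\<in>S. 1 * e s)" by (intro tendsto_intros xe)
  moreover have "(\<Sum>s\<in>S. 1 * x (r n) s) = 1" for n
    using xsum[of "\<lambda>_. 1"] tp[of "r n"] by (simp add: slope_def)
  ultimately have e1: "(\<Sum>s\<in>S. e s) = 1" by (simp add: LIMSEQ_const_iff)
  have "(\<lambda>n. matrix_form S gram (x (r n)) (x (r n))) \<longlonglongrightarrow> matrix_form S gram e e"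
    unfolding matrix_form_def by (intro tendsto_intros xe)
  moreover have "matrix_form S gram (x n) (x n) = inverse (total (b n)) * inverse (total (b n))" for n
  proof -
    have "matrix_form S gram (coef (b n)) (coef (b n)) = 1"
      using root_norm[of S "b n"] bp[of n] pos_coef(1)[OF bp[of n]] unfolding B_combinations[symmetric] by simp
    then show ?thesis
      using matrix_form_scale[of S gram "inverse (total (b n))" "coef (b n)" "inverse (total (b n))" "coef (b n)"]
      by (simp add: x_def[abs_def] divide_inverse mult.commute)
  qed
  moreover have "(\<lambda>n. inverse (total (b (r n))) * inverse (total (b (r n)))) \<longlonglongrightarrow> 0 * 0"
    using LIMSEQ_subseq_LIMSEQ[OF tendsto_inverse_0_at_top[OF top] r]
    by (intro tendsto_mult) (simp_all add: o_def)
  ultimately have "matrix_form S gram e e = 0" using LIMSEQ_unique by simp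
  with e0 e1 have e: "e \<in> isotropic_simplex" by (simp add: isotropic_simplex_def e_def)
  have "(\<lambda>n. \<Sum>s\<in>S. \<omega> s * x (r n) s) \<longlonglongrightarrow> (\<Sum>s\<in>S. \<omega> s * e s)" by (intro tendsto_intros xe)
  moreover have "(\<lambda>n. \<Sum>s\<in>S. \<omega> s * x (r n) s) \<longlonglongrightarrow> c"
    unfolding xsum using LIMSEQ_subseq_LIMSEQ[OF lim r] by (simp add: o_def)
  ultimately have "c = (\<Sum>s\<in>S. \<omega> s * e s)" by (rule LIMSEQ_unique[symmetric])
  with e show ?thesis by blast
qed

lemma countable_pos: "countable pos"
proof -
  have "root_set S = (\<lambda>(us, s). act us (\<alpha> s)) ` (lists S \<times> S)" unfolding root_set_def by auto
  moreover have "countable (lists S \<times> S)" using S_finite by (simp add: countable_finite countable_lists)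
  ultimately show ?thesis by (metis countable_Int1 countable_image)
qed

text \<open>
  Use the powers of a real number \<open>\<tau>\<close> as weights. For two given roots equality of slopes is a
  polynomial equation for \<open>\<tau>\<close>, nontrivial since distinct positive roots are not proportional.
  There are countably many pairs of roots and uncountably many \<open>\<tau>\<close>.\<close>

lemma generic_slope: "\<exists>\<omega>. inj_on (slope \<omega>) pos"
proof -
  obtain h where h: "bij_betw h S {..<card S}" using ex_bij_betw_finite_nat[OF S_finite] by (auto simp: atLeast0LessThan)
  define \<omega> where "\<omega> \<tau> s = \<tau> ^ h s" for \<tau> :: real and s
  define bad where "bad p = {\<tau>. slope (\<omega> \<tau>) (fst p) = slope (\<omega> \<tau>) (snd p)}" for p
  have "finite (bad (v, w))" if vw: "v \<in> pos" "w \<in> pos" "v \<noteq> w" for v w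
  proof -
    define d where "d s = coef v s / total v - coef w s / total w" for s
    have t: "0 < total v" "0 < total w" using total_pos vw by auto
    have "\<exists>s\<in>S. d s \<noteq> 0"
    proof (rule ccontr)
      assume "\<not> ?thesis"
      then have *: "coef v s = (total v / total w) * coef w s" if "s \<in> S" for s
        using that t by (simp add: d_def field_simps)
      define k where "k = total v / total w"
      have "v = combination S (coef v)" using pos_coef(1) vw by simp
      also have "\<dots> = combination S (\<lambda>s. k * coef w s)"
        unfolding combination_def k_def by (intro sum.cong HOL.refl) (simp add: *)
      also have "\<dots> = k *\<^sub>R w" using pos_coef(1) vw by (simp add: combination_scale)
      finally have v: "v = k *\<^sub>R w" .
      have "B v v = 1" "B w w = 1" using root_norm[of S] vw by auto
      then have "k * k = 1" unfolding v by (simp add: B_simps)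
      moreover have "0 < k" using t by (simp add: k_def)
      ultimately have "k = 1" by (metis abs_of_pos abs_square_eq_1 power2_eq_square)
      with v vw show False by simp
    qed
    then obtain s where s: "s \<in> S" "d s \<noteq> 0" by blast
    define c where "c i = (if i < card S then d (inv_into S h i) else 0)" for i
    have hs: "h s < card S" "c (h s) = d s" if "s \<in> S" for s
      using that h by (auto simp: c_def bij_betw_def inv_into_f_f)
    have "slope (\<omega> \<tau>) v - slope (\<omega> \<tau>) w = (\<Sum>i\<le>card S. c i * \<tau> ^ i)" for \<tau>
    proof -
      have "slope (\<omega> \<tau>) v - slope (\<omega> \<tau>) w = (\<Sum>s\<in>S. d s * \<tau> ^ h s)"
      proof -
        have "slope (\<omega> \<tau>) u = (\<Sum>s\<in>S. (coef u s / total u) * \<tau> ^ h s)" for u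
          unfolding slope_def weight_def[of "\<omega> \<tau>"] \<omega>_def sum_divide_distrib
          by (intro sum.cong HOL.refl) simp
        then show ?thesis unfolding d_def by (simp only: sum_subtractf[symmetric] left_diff_distrib)
      qed
      also have "\<dots> = (\<Sum>s\<in>S. c (h s) * \<tau> ^ h s)" by (intro sum.cong HOL.refl) (simp add: hs)
      also have "\<dots> = (\<Sum>i<card S. c i * \<tau> ^ i)" by (rule sum.reindex_bij_betw[OF h])
      also have "\<dots> = (\<Sum>i\<le>card S. c i * \<tau> ^ i)"
        by (intro sum.mono_neutral_left) (auto simp: c_def)
      finally show ?thesis .
    qed
    note diff = this
    have "bad (v, w) = {\<tau>. (\<Sum>i\<le>card S. c i * \<tau> ^ i) = 0}"
      unfolding bad_def fst_conv snd_conv diff[symmetric] by simp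
    moreover have "\<exists>i\<le>card S. c i \<noteq> 0" using hs[OF s(1)] s(2) by (intro exI[of _ "h s"]) simp
    ultimately show ?thesis using polyfun_finite_roots[of c "card S"] by simp
  qed
  then have "countable (bad p)" if "p \<in> {p \<in> pos \<times> pos. fst p \<noteq> snd p}" for p
    using that by (cases p) (auto intro: countable_finite)
  moreover have "countable {p \<in> pos \<times> pos. fst p \<noteq> snd p}"
    by (rule countable_subset[of _ "pos \<times> pos"]) (auto intro: countable_SIGMA countable_pos)
  ultimately have "countable (\<Union>p\<in>{p \<in> pos \<times> pos. fst p \<noteq> snd p}. bad p)" by (rule countable_UN[rotated])
  then have "(\<Union>p\<in>{p \<in> pos \<times> pos. fst p \<noteq> snd p}. bad p) \<noteq> UNIV" using uncountable_UNIV_real by metis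
  then obtain \<tau> where \<tau>: "\<And>p. p \<in> pos \<times> pos \<Longrightarrow> fst p \<noteq> snd p \<Longrightarrow> \<tau> \<notin> bad p" by blast
  have "inj_on (slope (\<omega> \<tau>)) pos"
  proof (rule inj_onI, rule ccontr)
    fix v w assume "v \<in> pos" "w \<in> pos" "slope (\<omega> \<tau>) v = slope (\<omega> \<tau>) w" "v \<noteq> w"
    then show False using \<tau>[of "(v, w)"] by (simp add: bad_def)
  qed
  then show ?thesis by blast
qed

theorem order_without_copies:
  assumes "finite isotropic_simplex"
  shows "\<exists>lt k. reflection_order pos lt \<and> 0 < k \<and> \<not> (\<exists>E\<subseteq>pos. has_type_omega_omega_star_copies k E lt)"
proof -
  obtain \<omega> where \<omega>: "inj_on (slope \<omega>) pos" using generic_slope by blast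
  let ?C = "(\<lambda>e. \<Sum>s\<in>S. \<omega> s * e s) ` isotropic_simplex"
  have C: "finite ?C" using assms by simp
  have "k \<le> card ?C" if "E \<subseteq> pos" "has_type_omega_omega_star_copies k E (\<lambda>v w. slope \<omega> v < slope \<omega> w)" for E k
    by (rule copies_bounded_by_limit_points[OF C slope_limit_points that])
  then have "\<not> (\<exists>E\<subseteq>pos. has_type_omega_omega_star_copies (Suc (card ?C)) E (\<lambda>v w. slope \<omega> v < slope \<omega> w))"
    using Suc_n_not_le_n by blast
  then show ?thesis using slope_reflection_order[OF \<omega>]
    by (intro exI[of _ "\<lambda>v w. slope \<omega> v < slope \<omega> w"] exI[of _ "Suc (card ?C)"] conjI) simp_all
qed

end

section \<open>The characterization of non-affine systems\<close>

theorem theorem4p8: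
  fixes W :: "('g, 'b) monoid_scheme" and S :: "'g set" and m :: "'g \<Rightarrow> 'g \<Rightarrow> enat"
    and B :: "'v::real_vector \<Rightarrow> 'v \<Rightarrow> real" and \<alpha> :: "'g \<Rightarrow> 'v" and \<rho> :: "'g \<Rightarrow> 'v \<Rightarrow> 'v"
  assumes "root_basis W S m B \<alpha> \<rho>"
    and "irreducible_coxeter S m"
    and "infinite (carrier W)"
    and not_locally_finite: "\<exists>J. J \<subseteq> S \<and> finite J \<and> infinite (generate W J)"
  shows "\<not> affine_coxeter S m \<longleftrightarrow>
    (\<forall>lt k. reflection_order (pos_roots W S \<alpha> \<rho>) lt \<and> 0 < k \<longrightarrow>
      (\<exists>E \<subseteq> pos_roots W S \<alpha> \<rho>. has_type_omega_omega_star_copies k E lt))"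
proof -
  interpret R: root_basis W S m B \<alpha> \<rho> by fact
  show ?thesis
  proof
    assume "\<not> affine_coxeter S m"
    then show "\<forall>lt k. reflection_order (pos_roots W S \<alpha> \<rho>) lt \<and> 0 < k \<longrightarrow>
      (\<exists>E \<subseteq> pos_roots W S \<alpha> \<rho>. has_type_omega_omega_star_copies k E lt)"
      unfolding R.pos_roots_eq using R.nonaffine_contains_copies assms(2-4) by blast
  next
    assume *: "\<forall>lt k. reflection_order (pos_roots W S \<alpha> \<rho>) lt \<and> 0 < k \<longrightarrow>
      (\<exists>E \<subseteq> pos_roots W S \<alpha> \<rho>. has_type_omega_omega_star_copies k E lt)"
    show "\<not> affine_coxeter S m"
    proof
      assume aff: "affine_coxeter S m"
      interpret O: slope_order W S m B \<alpha> \<rho>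
        by unfold_locales (use R.affine_structure[OF assms(2) aff] in auto)
      show False using O.order_without_copies[OF R.affine_structure(3)[OF assms(2) aff]] *
        unfolding R.pos_roots_eq by blast
    qed
  qed
qed

end
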